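(* Let $(H,\lambda)$ be a labelled quotient graph. Then there are finitely many periodic isotopy classes of (proper) linear 3-periodic nets $\mathcal{N}$ in $\mathbb{R}^3$ which have the labelled quotient graph $(H,\lambda)$ with respect to some periodicity basis.
   Context: A (proper) linear 3-periodic net in $\mathbb{R}^3$ is a pair $\mathcal{N}=(N,S)$ where (i) $S$, the set of edges, is a countable set of line segments $[p,q]$, $p\ne q$, which are essentially disjoint (two distinct segments meet at most in a common endpoint); (ii) $N$, the set of nodes, is the set of endpoints of members of $S$; (iii) there is a basis $\underline{a}=\{a_1,a_2,a_3\}$ of $\mathbb{R}^3$ such that $N$ and $S$ are invariant under the group $\mathcal{T}$ of translations $T_k:x\mapsto x+k_1a_1+k_2a_2+k_3a_3$, $k\in\mathbb{Z}^3$; (iv) $N$ and $S$ partition into finitely many $\mathcal{T}$-orbits. Such a basis is called a periodicity basis for $\mathcal{N}$. Nets are not required to be connected. The body $|\mathcal{N}|$ is the union of the segments in $S$. Labelled quotient graph with respect to a periodicity basis $\underline{a}$: take as representatives of the translation classes of nodes the nodes lying in the semi-open unit cell $\{t_1a_1+t_2a_2+t_3a_3:0\le t_i<1\}$. The vertices of the finite multigraph are (labelled by) these representatives $p(v)$, and the edges correspond to the $\mathcal{T}$-orbits of edges in $S$; an edge orbit represented by $[T_kp(v),T_lp(w)]$ gives an edge directed from $v$ to $w$ with label $k-l\in\mathbb{Z}^3$. The labelled directed edge $(vw,m)$ is identified with $(wv,-m)$. Proper linear 3-periodic nets $\mathcal{N}_0,\mathcal{N}_1$ are periodically isotopic if there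 is a family of proper linear 3-periodic nets $\mathcal{N}_t$, $0<t<1$, such that (a) there is a continuous path of bases $t\mapsto\underline{a}^t$ of $\mathbb{R}^3$, $0\le t\le1$, with $\underline{a}^t$ a right-handed periodicity basis for $\mathcal{N}_t$; (b) there are bijections $f_t:|\mathcal{N}_0|\to|\mathcal{N}_t|$, $0\le t\le1$, mapping nodes to nodes, such that $f_0$ is the identity, for each node $p$ of $\mathcal{N}_0$ the map $t\mapsto f_t(p)$ is continuous, and the restriction of $f_t$ to each edge $[a,b]$ is the affine map onto the edge $[f_t(a),f_t(b)]$ of $\mathcal{N}_t$ determined by linear interpolation. Periodic isotopy classes are the equivalence classes of this relation. *)

theory Defs
  imports "HOL-Analysis.Analysis" "Graph_Theory.Digraph"
begin

text \<open>
  A net is a pair \<open>(N, S)\<close> of a set of nodes and a set of edges, each edge being a segment, that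
  is, a set of points. A triple \<open>a\<^sub>1, a\<^sub>2, a\<^sub>3\<close> of vectors is the matrix \<open>a\<close> with rows \<open>a $ i\<close>.
\<close>

type_synonym net = "(real^3) set \<times> (real^3) set set"

abbreviation nodes :: "net \<Rightarrow> (real^3) set" where
  "nodes \<equiv> fst"

abbreviation edges :: "net \<Rightarrow> (real^3) set set" where
  "edges \<equiv> snd"

definition body :: "net \<Rightarrow> (real^3) set" where
  "body \<N> = \<Union> (edges \<N>)"

definition is_endpoint :: "real^3 \<Rightarrow> (real^3) set \<Rightarrow> bool" where
  "is_endpoint p s \<longleftrightarrow> (\<exists>q. p \<noteq> q \<and> s = closed_segment p q)"

definition essentially_disjoint :: "(real^3) set set \<Rightarrow> bool" where
  "essentially_disjoint S \<longleftrightarrow>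
     (\<forall>s\<in>S. \<forall>s'\<in>S. s \<noteq> s' \<longrightarrow>
        s \<inter> s' = {} \<or> (\<exists>p. s \<inter> s' = {p} \<and> is_endpoint p s \<and> is_endpoint p s'))"

definition basis3 :: "real^3^3 \<Rightarrow> bool" where
  "basis3 a \<longleftrightarrow>
     inj (($) a) \<and> independent (range (($) a)) \<and> span (range (($) a)) = UNIV"

definition right_handed :: "real^3^3 \<Rightarrow> bool" where
  "right_handed a \<longleftrightarrow> det a > 0"

definition translate :: "real^3^3 \<Rightarrow> int^3 \<Rightarrow> real^3 \<Rightarrow> real^3" where
  "translate a k x = x + (\<Sum>i\<in>UNIV. of_int (k $ i) *\<^sub>R a $ i)"

definition node_orbit :: "real^3^3 \<Rightarrow> real^3 \<Rightarrow> (real^3) set" where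
  "node_orbit a p = range (\<lambda>k. translate a k p)"

definition edge_orbit :: "real^3^3 \<Rightarrow> (real^3) set \<Rightarrow> (real^3) set set" where
  "edge_orbit a s = range (\<lambda>k. translate a k ` s)"

definition periodicity_basis :: "real^3^3 \<Rightarrow> net \<Rightarrow> bool" where
  "periodicity_basis a \<N> \<longleftrightarrow>
     basis3 a \<and>
     (\<forall>k. translate a k ` nodes \<N> = nodes \<N>) \<and>
     (\<forall>k. (\<lambda>s. translate a k ` s) ` edges \<N> = edges \<N>) \<and>
     finite (node_orbit a ` nodes \<N>) \<and>
     finite (edge_orbit a ` edges \<N>)"

definition proper_linear_3periodic_net :: "net \<Rightarrow> bool" where
  "proper_linear_3periodic_net \<N> \<longleftrightarrow>
     countable (edges \<N>) \<and>
     (\<forall>s\<in>edges \<N>. \<exists>p q. p \<noteq> q \<and> s = closed_segment p q) \<and>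
     essentially_disjoint (edges \<N>) \<and>
     nodes \<N> = {p. \<exists>s\<in>edges \<N>. is_endpoint p s} \<and>
     (\<exists>a. periodicity_basis a \<N>)"

definition unit_cell :: "real^3^3 \<Rightarrow> (real^3) set" where
  "unit_cell a = {\<Sum>i\<in>UNIV. t $ i *\<^sub>R a $ i | t :: real^3. \<forall>i. 0 \<le> t $ i \<and> t $ i < 1}"

text \<open>
  A labelled quotient graph is a finite multigraph \<open>H\<close>, each edge of which carries a chosen
  direction, together with a label \<open>lam e\<close> for each edge \<open>e\<close>. It is the labelled quotient graph of a
  net up to isomorphism, witnessed by \<open>p\<close> on vertices and \<open>orb\<close> on edges. Segments are undirected,
  so the directed edge \<open>(vw, m)\<close> of \<open>H\<close> may be replaced by \<open>(wv, -m)\<close> without affecting the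
  predicate, which is the required identification.
\<close>

definition has_labelled_quotient_graph ::
    "net \<Rightarrow> real^3^3 \<Rightarrow> ('v, 'e) pre_digraph \<Rightarrow> ('e \<Rightarrow> int^3) \<Rightarrow> bool" where
  "has_labelled_quotient_graph \<N> a H lam \<longleftrightarrow>
     (\<exists>p orb.
        bij_betw p (verts H) (nodes \<N> \<inter> unit_cell a) \<and>
        bij_betw orb (arcs H) (edge_orbit a ` edges \<N>) \<and>
        (\<forall>e\<in>arcs H. \<exists>k l.
           closed_segment (translate a k (p (tail H e))) (translate a l (p (head H e))) \<in> orb e \<and>
           lam e = k - l))"

definition periodically_isotopic :: "net \<Rightarrow> net \<Rightarrow> bool" where
  "periodically_isotopic \<N>0 \<N>1 \<longleftrightarrow>
     (\<exists>(\<N> :: real \<Rightarrow> net) (a :: real \<Rightarrow> real^3^3) (f :: real \<Rightarrow> real^3 \<Rightarrow> real^3).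
        \<N> 0 = \<N>0 \<and> \<N> 1 = \<N>1 \<and>
        (\<forall>t\<in>{0..1}. proper_linear_3periodic_net (\<N> t)) \<and>
        continuous_on {0..1} a \<and>
        (\<forall>t\<in>{0..1}. periodicity_basis (a t) (\<N> t) \<and> right_handed (a t)) \<and>
        (\<forall>t\<in>{0..1}. bij_betw (f t) (body \<N>0) (body (\<N> t)) \<and>
                     f t ` nodes \<N>0 \<subseteq> nodes (\<N> t)) \<and>
        (\<forall>x\<in>body \<N>0. f 0 x = x) \<and>
        (\<forall>p\<in>nodes \<N>0. continuous_on {0..1} (\<lambda>t. f t p)) \<and>
        (\<forall>t\<in>{0..1}. \<forall>p q. p \<noteq> q \<and> closed_segment p q \<in> edges \<N>0 \<longrightarrow>
           closed_segment (f t p) (f t q) \<in> edges (\<N> t) \<and>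
           (\<forall>u\<in>{0..1}. f t ((1 - u) *\<^sub>R p + u *\<^sub>R q) = (1 - u) *\<^sub>R f t p + u *\<^sub>R f t q)))"

definition periodic_isotopy :: "(net \<times> net) set" where
  "periodic_isotopy =
     {(\<N>0, \<N>1). proper_linear_3periodic_net \<N>0 \<and> proper_linear_3periodic_net \<N>1 \<and>
                periodically_isotopic \<N>0 \<N>1}"

end

theory Submission
  imports Defs
begin

text \<open>
  A net with labelled quotient graph \<open>(H, lam)\<close> is determined by a basis \<open>a\<close> together with the
  position \<open>y v\<close>, in coordinates with respect to \<open>a\<close>, of one node for every vertex \<open>v\<close>: its edges
  are the translates of the segments from \<open>y (tail e) + lam e\<close> to \<open>y (head e)\<close>
  (\<open>net_of_quotient_graph\<close>). Conversely such a periodic drawing is a proper net as soon as it is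
  embedded, and this is a condition on \<open>y\<close> alone because invertible linear maps preserve it. Moving
  \<open>a\<close> through invertible matrices and \<open>y\<close> through embedded drawings is a periodic isotopy
  (\<open>periodically_isotopic_of_paths\<close>). Hence it suffices that the invertible matrices, and the
  embedded drawings with coordinates in \<open>[-1, 1]\<close>, meet finitely many path components.

  Both statements come from a fact about a real polynomial \<open>F\<close> in \<open>n\<close> variables: within a cube, the
  complement of \<open>F = 0\<close> has finitely many path components (\<open>finitely_many_path_components\<close>). After
  multiplying \<open>F\<close> by the equations of the faces of the cube, for every vector \<open>b\<close> the function
  \<open>\<bar>F x\<bar> exp (b \<bullet> x)\<close> attains a maximum on each component, and there the partial derivatives satisfy
  \<open>F\<^sub>i x = - b\<^sub>i F x\<close>. A dimension count shows that each coordinate \<open>x\<^sub>k\<close> is algebraic over the \<open>n\<close>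
  functions \<open>- F\<^sub>i / F\<close>; so for a suitable \<open>b\<close> only finitely many points solve these equations
  (\<open>log_gradient_fibre_finite\<close>), and every component contains one of them.

  For the matrices \<open>F\<close> is the determinant. For the drawings, whether two segments cross can be read
  off from the signs of finitely many polynomials in their four end points (\<open>crossing_cong\<close>), and
  with bounded coordinates only finitely many pairs of edges, up to translation, can meet. Let \<open>F\<close> be
  the product of those of the resulting polynomials that do not vanish identically. Along a path in
  the complement of \<open>F = 0\<close> no sign changes, so the drawing stays embedded; and since being embedded is
  stable under small perturbations (\<open>no_cross_stable\<close>), every embedded drawing can be moved into this
  complement.

  Finally, isotopic nets have the same class only because periodic isotopy is symmetric and
  transitive. Two consecutive isotopies may use different periodicity bases of the net in the middle;
  these bases are commensurable, and a sublattice contained in both lattices provides periodicity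
  bases along both isotopies that fit together (\<open>periodically_isotopic_trans\<close>).
\<close>

section \<open>Polynomial functions of several variables\<close>

text \<open>
  The number is an upper bound for the total degree, read off from the way the function is built.
\<close>

inductive pol :: "'i set \<Rightarrow> nat \<Rightarrow> (('i \<Rightarrow> real) \<Rightarrow> real) \<Rightarrow> bool" for I where
  const: "pol I d (\<lambda>x. c)"
| coord: "i \<in> I \<Longrightarrow> pol I (Suc d) (\<lambda>x. x i)"
| add: "pol I d f \<Longrightarrow> pol I d g \<Longrightarrow> pol I d (\<lambda>x. f x + g x)"
| mult: "pol I d f \<Longrightarrow> pol I e g \<Longrightarrow> pol I (d + e) (\<lambda>x. f x * g x)"

lemma pol_mono:
  assumes "pol I d f" "d \<le> e"
  shows "pol I e f"
proof -
  have "pol I (d + (e - d)) (\<lambda>x. f x * 1)"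
    by (intro pol.mult pol.const assms)
  with assms show ?thesis by simp
qed

lemma pol_uminus: "pol I d f \<Longrightarrow> pol I d (\<lambda>x. - f x)"
  using pol.mult[OF pol.const[of I 0 "-1"], of d f] by simp

lemma pol_power: "pol I d f \<Longrightarrow> pol I (d * k) (\<lambda>x. f x ^ k)"
  by (induction k) (auto intro: pol.const pol.mult)

lemma pol_prod:
  assumes "\<And>a. a \<in> A \<Longrightarrow> pol I d (f a)"
  shows "pol I (card A * d) (\<lambda>x. \<Prod>a\<in>A. f a x)"
  using assms
  by (induction A rule: infinite_finite_induct) (auto intro: pol.const pol.mult)

lemma pol_continuous_comp:
  assumes "pol I d f" "\<And>i. continuous_on S (\<lambda>t. \<gamma> t i)"
  shows "continuous_on S (\<lambda>t. f (\<gamma> t))"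
  using assms(1) by induction (auto intro!: continuous_intros assms(2))

lemma pol_tendsto:
  assumes "pol I d f" "\<And>i. i \<in> I \<Longrightarrow> ((\<lambda>y. g y i) \<longlongrightarrow> x i) N"
  shows "((\<lambda>y. f (g y)) \<longlongrightarrow> f x) N"
  using assms(1) by induction (auto intro!: tendsto_intros assms(2))

lemma pol_cong:
  assumes "pol I d f" "\<And>i. i \<in> I \<Longrightarrow> x i = y i"
  shows "f x = f y"
  using assms(1) by induction (auto simp: assms(2))

lemma pol_partial:
  assumes "pol I d f" "i \<in> I"
  shows "\<exists>f'. pol I d f' \<and>
    (\<forall>x. ((\<lambda>t. f (x(i := t))) has_real_derivative f' x) (at (x i)))"
  using assms(1)
proof induction
  case (const d c)
  show ?case by (rule exI[of _ "\<lambda>x. 0"]) (auto intro: pol.const)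
next
  case (coord j d)
  show ?case
    by (rule exI[of _ "\<lambda>x. if j = i then 1 else 0"]) (auto intro: pol.const)
next
  case (add d f g)
  then obtain f' g' where "pol I d f'" "pol I d g'"
    "\<And>x. ((\<lambda>t. f (x(i := t))) has_real_derivative f' x) (at (x i))"
    "\<And>x. ((\<lambda>t. g (x(i := t))) has_real_derivative g' x) (at (x i))" by blast
  then show ?case
    by (intro exI[of _ "\<lambda>x. f' x + g' x"] conjI allI pol.add DERIV_add)
next
  case (mult d f e g)
  then obtain f' g' where fg: "pol I d f'" "pol I e g'"
    "\<And>x. ((\<lambda>t. f (x(i := t))) has_real_derivative f' x) (at (x i))"
    "\<And>x. ((\<lambda>t. g (x(i := t))) has_real_derivative g' x) (at (x i))" by blast
  have "((\<lambda>t. f (x(i := t)) * g (x(i := t))) has_real_derivative f' x * g x + f x * g' x) (at (x i))" for x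
    using DERIV_mult[OF fg(3,4), of x x] by (simp add: algebra_simps)
  moreover have "pol I (d + e) (\<lambda>x. f' x * g x + f x * g' x)"
    using mult(1,2) fg(1,2) by (intro pol.add pol.mult)
  ultimately show ?case by blast
qed

text \<open>
  Restriction to a line reduces questions about zero sets to polynomials in one variable.
\<close>

lemma pol_on_line:
  assumes "pol I d f"
  shows "\<exists>p. \<forall>t. f (\<lambda>i. x i + t * (z i - x i)) = poly p t"
  using assms
proof induction
  case (const d c)
  show ?case by (rule exI[of _ "[:c:]"]) simp
next
  case (coord i d)
  show ?case by (rule exI[of _ "[:x i, z i - x i:]"]) simp
next
  case (add d f g)
  then obtain p q where "\<forall>t. f (\<lambda>i. x i + t * (z i - x i)) = poly p t"
    "\<forall>t. g (\<lambda>i. x i + t * (z i - x i)) = poly q t" by blast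
  then show ?case by (intro exI[of _ "p + q"]) simp
next
  case (mult d f e g)
  then obtain p q where "\<forall>t. f (\<lambda>i. x i + t * (z i - x i)) = poly p t"
    "\<forall>t. g (\<lambda>i. x i + t * (z i - x i)) = poly q t" by blast
  then show ?case by (intro exI[of _ "p * q"]) simp
qed

lemma pol_finite_zeros_on_line:
  assumes "pol I d f" "f (\<lambda>i. x i + s * (z i - x i)) \<noteq> 0"
  shows "finite {t. f (\<lambda>i. x i + t * (z i - x i)) = 0}"
proof -
  obtain p where p: "\<And>t. f (\<lambda>i. x i + t * (z i - x i)) = poly p t"
    using pol_on_line[OF assms(1)] by blast
  with assms(2) have "p \<noteq> 0" by auto
  then show ?thesis unfolding p by (rule poly_roots_finite)
qed

text \<open>
  The polynomial functions have no zero divisors: on the line through a point where \<open>f\<close> does not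
  vanish and a point where the remaining product does not vanish, every factor has finitely many
  zeros.
\<close>

lemma pol_prod_not_identically_zero:
  assumes "finite A" "\<And>f. f \<in> A \<Longrightarrow> \<exists>d. pol I d f" "\<And>f. f \<in> A \<Longrightarrow> \<exists>x. f x \<noteq> 0"
  shows "\<exists>x. (\<Prod>f\<in>A. f x) \<noteq> 0"
  using assms
proof (induction A)
  case empty
  then show ?case by simp
next
  case (insert f A)
  from insert obtain x where x: "f x \<noteq> 0" by blast
  from insert obtain z where z: "(\<Prod>f\<in>A. f z) \<noteq> 0" by blast
  let ?L = "\<lambda>t i. x i + t * (z i - x i)"
  have ex: "\<exists>d. pol I d g" if "g \<in> insert f A" for g
    using insert(4) that by blast
  have "finite {t. g (?L t) = 0}" if g: "g \<in> insert f A" for g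
  proof -
    from ex[OF g] obtain d where d: "pol I d g" by blast
    have "g (?L (if g = f then 0 else 1)) \<noteq> 0"
      using x z g insert(1) by (auto simp: insert(1))
    then show ?thesis by (rule pol_finite_zeros_on_line[OF d])
  qed
  then have "finite (\<Union>g\<in>insert f A. {t. g (?L t) = 0})"
    using insert(1) by blast
  then obtain t where "t \<notin> (\<Union>g\<in>insert f A. {t. g (?L t) = 0})"
    using ex_new_if_finite infinite_UNIV_char_0 by blast
  then have "(\<Prod>g\<in>insert f A. g (?L t)) \<noteq> 0" using insert(1,2) by auto
  then show ?case by blast
qed

definition is_pol :: "'i set \<Rightarrow> (('i \<Rightarrow> real) \<Rightarrow> real) \<Rightarrow> bool" where
  "is_pol I f \<longleftrightarrow> (\<exists>d. pol I d f)"

lemma is_pol_const: "is_pol I (\<lambda>x. c)"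
  and is_pol_coord: "i \<in> I \<Longrightarrow> is_pol I (\<lambda>x. x i)"
  unfolding is_pol_def by (blast intro: pol.intros)+

lemma is_pol_mult: "is_pol I f \<Longrightarrow> is_pol I g \<Longrightarrow> is_pol I (\<lambda>x. f x * g x)"
  unfolding is_pol_def by (blast intro: pol.mult)

lemma is_pol_add:
  assumes "is_pol I f" "is_pol I g"
  shows "is_pol I (\<lambda>x. f x + g x)"
proof -
  obtain d e where "pol I d f" "pol I e g" using assms unfolding is_pol_def by blast
  then have "pol I (max d e) f" "pol I (max d e) g" by (auto intro: pol_mono)
  then show ?thesis unfolding is_pol_def by (blast intro: pol.add)
qed

lemma is_pol_diff:
  assumes "is_pol I f" "is_pol I g"
  shows "is_pol I (\<lambda>x. f x - g x)"
  using is_pol_add[OF assms(1) is_pol_mult[OF is_pol_const[of I "-1"] assms(2)]] by simp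

lemma is_pol_sum: "(\<And>a. a \<in> A \<Longrightarrow> is_pol I (f a)) \<Longrightarrow> is_pol I (\<lambda>x. \<Sum>a\<in>A. f a x)"
  by (induction A rule: infinite_finite_induct) (auto intro: is_pol_const is_pol_add)

lemma is_pol_prod: "(\<And>a. a \<in> A \<Longrightarrow> is_pol I (f a)) \<Longrightarrow> is_pol I (\<lambda>x. \<Prod>a\<in>A. f a x)"
  by (induction A rule: infinite_finite_induct) (auto intro: is_pol_const is_pol_mult)

lemmas is_pol_intros = is_pol_const is_pol_coord is_pol_add is_pol_diff is_pol_mult is_pol_sum

section \<open>Finite fibres of the logarithmic gradient\<close>

text \<open>
  The box contains the exponents of all monomials of total degree at most \<open>d\<close>, and its elements are
  easier to count. Exponents are extensional, so that distinct elements stand for distinct monomials.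
\<close>

definition exps :: "'i set \<Rightarrow> nat \<Rightarrow> ('i \<Rightarrow> nat) set" where
  "exps I d = (\<Pi>\<^sub>E i\<in>I. {..d})"

definition monomial :: "'i set \<Rightarrow> ('i \<Rightarrow> nat) \<Rightarrow> ('i \<Rightarrow> real) \<Rightarrow> real" where
  "monomial I \<alpha> x = (\<Prod>i\<in>I. x i ^ \<alpha> i)"

lemma finite_exps: "finite I \<Longrightarrow> finite (exps I d)"
  by (auto simp: exps_def intro: finite_PiE)

lemma card_exps: "finite I \<Longrightarrow> card (exps I d) = Suc d ^ card I"
  by (simp add: exps_def card_PiE)

lemma pol_expansion:
  assumes I: "finite I" and f: "pol I d f"
  shows "\<exists>c. \<forall>x. f x = (\<Sum>\<alpha>\<in>exps I d. c \<alpha> * monomial I \<alpha> x)"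
proof -
  let ?R = "\<lambda>d f. \<exists>c. \<forall>x. f x = (\<Sum>\<alpha>\<in>exps I d. c \<alpha> * monomial I \<alpha> x)"
  note fin = finite_exps[OF I]
  have R_add: "?R d (\<lambda>x. f x + g x)" if "?R d f" "?R d g" for d f g
  proof -
    from that obtain a b where
      "\<forall>x. f x = (\<Sum>\<alpha>\<in>exps I d. a \<alpha> * monomial I \<alpha> x)"
      "\<forall>x. g x = (\<Sum>\<alpha>\<in>exps I d. b \<alpha> * monomial I \<alpha> x)" by blast
    then show ?thesis
      by (intro exI[of _ "\<lambda>\<alpha>. a \<alpha> + b \<alpha>"]) (simp add: sum.distrib algebra_simps)
  qed
  have R_mono: "?R d (\<lambda>x. c * monomial I \<alpha> x)" if "\<alpha> \<in> exps I d" for d c \<alpha>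
  proof (intro exI allI)
    fix x
    have "(\<Sum>\<beta>\<in>exps I d. (if \<beta> = \<alpha> then c else 0) * monomial I \<beta> x)
        = (\<Sum>\<beta>\<in>exps I d. if \<beta> = \<alpha> then c * monomial I \<alpha> x else 0)"
      by (intro sum.cong) auto
    also have "\<dots> = c * monomial I \<alpha> x" using that fin by (simp add: sum.delta)
    finally show "c * monomial I \<alpha> x = (\<Sum>\<beta>\<in>exps I d. (if \<beta> = \<alpha> then c else 0) * monomial I \<beta> x)" by simp
  qed
  have R_0: "?R d (\<lambda>x. 0)" for d by (rule exI[of _ "\<lambda>_. 0"]) simp
  have R_sum: "?R d (\<lambda>x. \<Sum>a\<in>A. f a x)" if "finite A" "\<And>a. a \<in> A \<Longrightarrow> ?R d (f a)" for d A and f :: "('i \<Rightarrow> nat) \<times> ('i \<Rightarrow> nat) \<Rightarrow> _"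
    using that
  proof (induction A)
    case empty
    then show ?case using R_0 by simp
  next
    case (insert a A)
    then have "?R d (f a)" "?R d (\<lambda>x. \<Sum>a\<in>A. f a x)" by auto
    from R_add[OF this] insert(1,2) show ?case by simp
  qed
  show ?thesis using f
  proof induction
    case (const d c)
    have "(\<lambda>i\<in>I. 0) \<in> exps I d" by (auto simp: exps_def)
    from R_mono[OF this, of c] show ?case by (simp add: monomial_def)
  next
    case (coord i d)
    have *: "(\<lambda>j\<in>I. if j = i then 1 else 0) \<in> exps I (Suc d)" by (auto simp: exps_def)
    have "monomial I (\<lambda>j\<in>I. if j = i then 1 else 0) x = x i" for x
    proof -
      have "monomial I (\<lambda>j\<in>I. if j = i then 1 else 0) x = (\<Prod>j\<in>I. if j = i then x i else 1)"
        unfolding monomial_def by (intro prod.cong) auto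
      then show ?thesis using coord I by (simp add: prod.delta)
    qed
    with R_mono[OF *, of 1] show ?case by simp
  next
    case (add d f g)
    then show ?case using R_add by blast
  next
    case (mult d f e g)
    then obtain a b where ab:
      "\<And>x. f x = (\<Sum>\<alpha>\<in>exps I d. a \<alpha> * monomial I \<alpha> x)"
      "\<And>x. g x = (\<Sum>\<alpha>\<in>exps I e. b \<alpha> * monomial I \<alpha> x)" by blast
    let ?\<gamma> = "\<lambda>(\<alpha>,\<beta>). \<lambda>i\<in>I. \<alpha> i + \<beta> i"
    let ?A = "exps I d \<times> exps I e"
    have "f x * g x = (\<Sum>(\<alpha>,\<beta>)\<in>?A. a \<alpha> * b \<beta> * monomial I (\<lambda>i\<in>I. \<alpha> i + \<beta> i) x)" for x
    proof -
      have "monomial I (\<lambda>i\<in>I. \<alpha> i + \<beta> i) x = monomial I \<alpha> x * monomial I \<beta> x" for \<alpha> \<beta>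
        by (simp add: monomial_def power_add prod.distrib)
      then show ?thesis
        unfolding ab sum_product sum.cartesian_product by (intro sum.cong) auto
    qed
    moreover have "?R (d + e) (\<lambda>x. \<Sum>p\<in>?A. (case p of (\<alpha>,\<beta>) \<Rightarrow> a \<alpha> * b \<beta> * monomial I (\<lambda>i\<in>I. \<alpha> i + \<beta> i) x))"
    proof (rule R_sum)
      show "finite ?A" using fin by blast
    next
      fix p assume "p \<in> ?A"
      then obtain \<alpha> \<beta> where p: "p = (\<alpha>,\<beta>)" "\<alpha> \<in> exps I d" "\<beta> \<in> exps I e" by blast
      then have "(\<lambda>i\<in>I. \<alpha> i + \<beta> i) \<in> exps I (d + e)" by (auto simp: exps_def PiE_iff add_mono)
      from R_mono[OF this] show "?R (d + e) (\<lambda>x. case p of (\<alpha>,\<beta>) \<Rightarrow> a \<alpha> * b \<beta> * monomial I (\<lambda>i\<in>I. \<alpha> i + \<beta> i) x)"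
        by (simp add: p)
    qed
    ultimately show ?case by simp
  qed
qed

text \<open>
  By Gaussian elimination: an unknown that occurs in the equation \<open>b\<close> is expressed by the others and
  eliminated from the remaining equations.
\<close>

lemma nontrivial_kernel:
  fixes M :: "'a \<Rightarrow> 'b \<Rightarrow> real"
  assumes "finite B" "finite A" "card B < card A"
  shows "\<exists>u. (\<exists>a\<in>A. u a \<noteq> 0) \<and> (\<forall>b\<in>B. (\<Sum>a\<in>A. u a * M a b) = 0)"
  using assms
proof (induction B arbitrary: A M)
  case empty
  then have "A \<noteq> {}" by auto
  then show ?case by (intro exI[of _ "\<lambda>_. 1"]) auto
next
  case (insert b B)
  show ?case
  proof (cases "\<forall>a\<in>A. M a b = 0")
    case True
    from insert have "card B < card A" by simp
    from insert(3)[OF \<open>finite A\<close> this, of M] True show ?thesis by auto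
  next
    case False
    then obtain a0 where a0: "a0 \<in> A" "M a0 b \<noteq> 0" by blast
    let ?A = "A - {a0}"
    let ?M = "\<lambda>a b'. M a b' - M a b / M a0 b * M a0 b'"
    have "finite ?A" "card B < card ?A" using insert a0 by auto
    from insert(3)[OF this, of ?M] obtain u where
      u: "\<exists>a\<in>?A. u a \<noteq> 0" "\<forall>b'\<in>B. (\<Sum>a\<in>?A. u a * ?M a b') = 0" by blast
    \<comment> \<open>The value of the eliminated unknown \<open>a0\<close> that satisfies the equation \<open>b\<close>.\<close>
    define s where "s = (\<Sum>a\<in>?A. u a * M a b) / M a0 b"
    define v where "v = u(a0 := - s)"
    have split: "(\<Sum>a\<in>A. v a * M a b') = (\<Sum>a\<in>?A. u a * M a b') - s * M a0 b'" for b'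
    proof -
      have "(\<Sum>a\<in>A. v a * M a b') = v a0 * M a0 b' + (\<Sum>a\<in>?A. v a * M a b')"
        using a0 insert(4) by (simp add: sum.remove)
      moreover have "(\<Sum>a\<in>?A. v a * M a b') = (\<Sum>a\<in>?A. u a * M a b')"
        by (intro sum.cong) (auto simp: v_def)
      ultimately show ?thesis by (simp add: v_def)
    qed
    have "(\<Sum>a\<in>A. v a * M a b) = 0" unfolding split s_def using a0 by simp
    moreover have "(\<Sum>a\<in>A. v a * M a b') = 0" if "b' \<in> B" for b'
    proof -
      have "(\<Sum>a\<in>?A. u a * ?M a b') = (\<Sum>a\<in>?A. u a * M a b') - (\<Sum>a\<in>?A. u a * M a b * (M a0 b' / M a0 b))"
        unfolding sum_subtractf[symmetric] by (intro sum.cong) (auto simp: algebra_simps)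
      also have "(\<Sum>a\<in>?A. u a * M a b * (M a0 b' / M a0 b)) = s * M a0 b'"
        unfolding s_def sum_distrib_right[symmetric] by simp
      finally show ?thesis unfolding split using u(2) that by simp
    qed
    ultimately have "\<forall>b'\<in>insert b B. (\<Sum>a\<in>A. v a * M a b') = 0" by blast
    moreover have "\<exists>a\<in>A. v a \<noteq> 0" using u(1) by (auto simp: v_def)
    ultimately show ?thesis by blast
  qed
qed

text \<open>
  Writing numbers in a mixed radix system: weights that grow fast enough distinguish all exponents of
  bounded size, since the last exponent is recovered by division with remainder.
\<close>

lemma separating_weights:
  assumes "finite I"
  shows "\<exists>w. inj_on (\<lambda>\<alpha>. \<Sum>i\<in>I. \<alpha> i * w i :: nat) (exps I m)"
  using assms
proof induction
  case empty
  then show ?case by (auto simp: exps_def)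
next
  case (insert i I)
  then obtain w where w: "inj_on (\<lambda>\<alpha>. \<Sum>i\<in>I. \<alpha> i * w i) (exps I m)" by blast
  define L where "L = Suc (\<Sum>i\<in>I. m * w i)"
  let ?w = "w(i := L)"
  have split: "(\<Sum>j\<in>insert i I. \<alpha> j * ?w j) = \<alpha> i * L + (\<Sum>j\<in>I. restrict \<alpha> I j * w j)" for \<alpha>
  proof -
    have "(\<Sum>j\<in>I. \<alpha> j * ?w j) = (\<Sum>j\<in>I. restrict \<alpha> I j * w j)"
      using insert(2) by (intro sum.cong) auto
    then show ?thesis using insert(1,2) by simp
  qed
  have small: "(\<Sum>j\<in>I. restrict \<alpha> I j * w j) < L" if "\<alpha> \<in> exps (insert i I) m" for \<alpha>
  proof -
    have "(\<Sum>j\<in>I. restrict \<alpha> I j * w j) \<le> (\<Sum>j\<in>I. m * w j)"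
      using that by (intro sum_mono mult_right_mono) (auto simp: exps_def PiE_iff)
    then show ?thesis by (simp add: L_def)
  qed
  have "inj_on (\<lambda>\<alpha>. \<Sum>j\<in>insert i I. \<alpha> j * ?w j) (exps (insert i I) m)"
  proof (rule inj_onI)
    fix \<alpha> \<beta>
    assume \<alpha>: "\<alpha> \<in> exps (insert i I) m" and \<beta>: "\<beta> \<in> exps (insert i I) m"
      and eq: "(\<Sum>j\<in>insert i I. \<alpha> j * ?w j) = (\<Sum>j\<in>insert i I. \<beta> j * ?w j)"
    let ?a = "\<Sum>j\<in>I. restrict \<alpha> I j * w j" and ?b = "\<Sum>j\<in>I. restrict \<beta> I j * w j"
    have e: "\<alpha> i * L + ?a = \<beta> i * L + ?b" using eq unfolding split .
    have "\<alpha> i = (\<alpha> i * L + ?a) div L" using small[OF \<alpha>] by simp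
    also have "\<dots> = \<beta> i" unfolding e using small[OF \<beta>] by simp
    finally have i: "\<alpha> i = \<beta> i" .
    with e have "?a = ?b" by simp
    moreover have "restrict \<alpha> I \<in> exps I m" "restrict \<beta> I \<in> exps I m"
      using \<alpha> \<beta> by (auto simp: exps_def PiE_iff)
    ultimately have "restrict \<alpha> I = restrict \<beta> I"
      using inj_onD[OF w, of "restrict \<alpha> I" "restrict \<beta> I"] by blast
    then have "\<alpha> j = \<beta> j" if "j \<in> insert i I" for j
      using i that by (metis insertE restrict_apply')
    then show "\<alpha> = \<beta>" using \<alpha> \<beta> unfolding exps_def by (blast intro: PiE_ext)
  qed
  then show ?case by blast
qed

text \<open>
  Kronecker's substitution \<open>b\<^sub>i = s ^ w\<^sub>i\<close> turns each of the given polynomials into a polynomial in the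
  single variable \<open>s\<close>. If the weights separate the exponents, no two terms are merged, so it stays
  nonzero; and finitely many nonzero polynomials in \<open>s\<close> have a common nonzero value.
\<close>

lemma common_nonzero:
  assumes I: "finite I" and K: "finite K" and u: "\<And>k. k \<in> K \<Longrightarrow> \<exists>\<alpha>\<in>exps I m. u k \<alpha> \<noteq> 0"
  shows "\<exists>b. \<forall>k\<in>K. (\<Sum>\<alpha>\<in>exps I m. u k \<alpha> * monomial I \<alpha> b) \<noteq> 0"
proof -
  obtain w where w: "inj_on (\<lambda>\<alpha>. \<Sum>i\<in>I. \<alpha> i * w i :: nat) (exps I m)"
    using separating_weights[OF I] by blast
  let ?w = "\<lambda>\<alpha>. \<Sum>i\<in>I. \<alpha> i * w i"
  let ?p = "\<lambda>k. \<Sum>\<alpha>\<in>exps I m. monom (u k \<alpha>) (?w \<alpha>)"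
  have p0: "?p k \<noteq> 0" if k: "k \<in> K" for k
  proof -
    obtain \<alpha> where \<alpha>: "\<alpha> \<in> exps I m" "u k \<alpha> \<noteq> 0" using u[OF k] by blast
    have "coeff (?p k) (?w \<alpha>) = (\<Sum>\<beta>\<in>exps I m. if \<beta> = \<alpha> then u k \<beta> else 0)"
      unfolding coeff_sum using \<alpha>(1) w by (intro sum.cong) (auto dest: inj_onD)
    also have "\<dots> = u k \<alpha>" using \<alpha>(1) finite_exps[OF I] by (simp add: sum.delta)
    finally have "coeff (?p k) (?w \<alpha>) \<noteq> 0" using \<alpha>(2) by simp
    then show ?thesis by (metis coeff_0)
  qed
  have "finite (\<Union>k\<in>K. {s. poly (?p k) s = 0})"
    using K p0 poly_roots_finite by blast
  then obtain s where s: "s \<notin> (\<Union>k\<in>K. {s. poly (?p k) s = 0})"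
    using ex_new_if_finite infinite_UNIV_char_0 by blast
  have "poly (?p k) s = (\<Sum>\<alpha>\<in>exps I m. u k \<alpha> * monomial I \<alpha> (\<lambda>i. s ^ w i))" for k
    by (simp add: poly_sum poly_monom monomial_def power_sum flip: power_mult)
      (simp add: mult.commute)
  with s show ?thesis by (intro exI[of _ "\<lambda>i. s ^ w i"]) auto
qed

text \<open>
  For every coordinate \<open>k\<close> the products \<open>x\<^sub>k ^ j * (\<Prod>i. (- F' i) ^ \<beta>\<^sub>i * F ^ (J - \<beta>\<^sub>i))\<close>
  with \<open>j, \<beta>\<^sub>i \<le> J\<close> are \<open>(J + 1) ^ (n + 1)\<close> polynomials of degree at most \<open>J + n * d * J\<close>,
  so at most \<open>(1 + J + n * d * J) ^ n\<close> monomials occur in them. For \<open>J = (1 + n * d) ^ n\<close> there are more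
  products than monomials, and therefore a linear relation. At a point where \<open>- F' i = b\<^sub>i * F\<close> and \<open>F \<noteq> 0\<close> the relation becomes an
  equation for \<open>x\<^sub>k\<close> of degree at most \<open>J\<close> whose coefficients are polynomials in \<open>b\<close>; for suitable
  \<open>b\<close> it is nontrivial, for all \<open>k\<close> at once.
\<close>

lemma log_gradient_fibre_finite:
  assumes I: "finite I" and F: "pol I d F" and F': "\<And>i. i \<in> I \<Longrightarrow> pol I d (F' i)"
  shows "\<exists>b Z. finite Z \<and> (\<forall>x. F x \<noteq> 0 \<and> (\<forall>i\<in>I. F' i x = - b i * F x) \<longrightarrow> (\<forall>k\<in>I. x k \<in> Z))"
proof -
  define n where "n = card I"
  define J where "J = (1 + n * d) ^ n"
  define e where "e = J + n * (d * J)"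
  define \<phi> where "\<phi> k = (\<lambda>(j,\<beta>) x. x k ^ j * (\<Prod>i\<in>I. (- F' i x) ^ \<beta> i * F x ^ (J - \<beta> i)))" for k
  let ?A = "{..J} \<times> exps I J"
  have finA: "finite ?A" using finite_exps[OF I] by blast
  have "\<exists>u. (\<exists>a\<in>?A. u a \<noteq> 0) \<and> (\<forall>x. (\<Sum>a\<in>?A. u a * \<phi> k a x) = 0)" if k: "k \<in> I" for k
  proof -
    have "pol I e (\<phi> k a)" if a: "a \<in> ?A" for a
    proof -
      obtain j \<beta> where [simp]: "a = (j,\<beta>)" and j: "j \<le> J" and \<beta>: "\<And>i. i \<in> I \<Longrightarrow> \<beta> i \<le> J"
        using a by (auto simp: exps_def PiE_iff)
      have "pol I (1 * j) (\<lambda>x. x k ^ j)" using pol_power[OF pol.coord[OF k, of 0], of j] by simp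
      then have 1: "pol I J (\<lambda>x. x k ^ j)" by (rule pol_mono) (use j in simp)
      have 2: "pol I (n * (d * J)) (\<lambda>x. \<Prod>i\<in>I. (- F' i x) ^ \<beta> i * F x ^ (J - \<beta> i))"
        unfolding n_def
      proof (rule pol_prod)
        fix i assume i: "i \<in> I"
        have "d * \<beta> i + d * (J - \<beta> i) = d * J" using \<beta>[OF i] by (simp flip: add_mult_distrib2)
        with pol.mult[OF pol_power[OF pol_uminus[OF F'[OF i]], of "\<beta> i"] pol_power[OF F, of "J - \<beta> i"]]
        show "pol I (d * J) (\<lambda>x. (- F' i x) ^ \<beta> i * F x ^ (J - \<beta> i))" by simp
      qed
      show ?thesis using pol.mult[OF 1 2] by (simp add: e_def \<phi>_def)
    qed
    then have "\<forall>a. \<exists>c. a \<in> ?A \<longrightarrow> (\<forall>x. \<phi> k a x = (\<Sum>\<alpha>\<in>exps I e. c \<alpha> * monomial I \<alpha> x))"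
      using pol_expansion[OF I] by blast
    then have "\<exists>M. \<forall>a. a \<in> ?A \<longrightarrow> (\<forall>x. \<phi> k a x = (\<Sum>\<alpha>\<in>exps I e. M a \<alpha> * monomial I \<alpha> x))"
      by (rule choice)
    then obtain M where M: "\<And>a x. a \<in> ?A \<Longrightarrow> \<phi> k a x = (\<Sum>\<alpha>\<in>exps I e. M a \<alpha> * monomial I \<alpha> x)"
      by blast
    have "card (exps I e) = (Suc e) ^ n" using I by (simp add: card_exps n_def)
    also have "\<dots> \<le> ((1 + n * d) * Suc J) ^ n"
      by (intro power_mono) (auto simp: e_def algebra_simps)
    also have "\<dots> = J * Suc J ^ n" by (simp only: power_mult_distrib J_def[symmetric])
    also have "\<dots> < Suc J * Suc J ^ n" by simp
    also have "\<dots> = card ?A" using I by (simp add: card_exps card_cartesian_product n_def)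
    finally obtain u where u: "\<exists>a\<in>?A. u a \<noteq> 0"
      "\<And>\<alpha>. \<alpha> \<in> exps I e \<Longrightarrow> (\<Sum>a\<in>?A. u a * M a \<alpha>) = 0"
      using nontrivial_kernel[OF finite_exps[OF I] finA, of e M] by blast
    have "(\<Sum>a\<in>?A. u a * \<phi> k a x) = 0" for x
    proof -
      have "(\<Sum>a\<in>?A. u a * \<phi> k a x) = (\<Sum>a\<in>?A. \<Sum>\<alpha>\<in>exps I e. u a * M a \<alpha> * monomial I \<alpha> x)"
        by (intro sum.cong) (auto simp: M sum_distrib_left algebra_simps)
      also have "\<dots> = (\<Sum>\<alpha>\<in>exps I e. (\<Sum>a\<in>?A. u a * M a \<alpha>) * monomial I \<alpha> x)"
        by (subst sum.swap) (simp add: sum_distrib_right)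
      also have "\<dots> = 0" using u(2) by (intro sum.neutral) simp
      finally show ?thesis .
    qed
    with u(1) show ?thesis by blast
  qed
  then have "\<exists>u. \<forall>k\<in>I. (\<exists>a\<in>?A. u k a \<noteq> 0) \<and> (\<forall>x. (\<Sum>a\<in>?A. u k a * \<phi> k a x) = 0)"
    by (intro bchoice ballI)
  then obtain u where u: "\<And>k. k \<in> I \<Longrightarrow> \<exists>a\<in>?A. u k a \<noteq> 0"
    "\<And>k x. k \<in> I \<Longrightarrow> (\<Sum>a\<in>?A. u k a * \<phi> k a x) = 0" by blast
  have "\<exists>j. \<exists>\<beta>\<in>exps I J. j \<le> J \<and> u k (j,\<beta>) \<noteq> 0" if "k \<in> I" for k
    using u(1)[OF that] by auto
  then have "\<exists>j0. \<forall>k\<in>I. \<exists>\<beta>\<in>exps I J. j0 k \<le> J \<and> u k (j0 k,\<beta>) \<noteq> 0"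
    by (intro bchoice ballI)
  then obtain j0 where j0: "\<And>k. k \<in> I \<Longrightarrow> \<exists>\<beta>\<in>exps I J. j0 k \<le> J \<and> u k (j0 k,\<beta>) \<noteq> 0" by blast
  obtain b where b: "\<And>k. k \<in> I \<Longrightarrow> (\<Sum>\<beta>\<in>exps I J. u k (j0 k, \<beta>) * monomial I \<beta> b) \<noteq> 0"
    using common_nonzero[OF I I, of J "\<lambda>k \<beta>. u k (j0 k, \<beta>)"] j0 by blast
  define q where "q k = (\<Sum>j\<le>J. monom (\<Sum>\<beta>\<in>exps I J. u k (j, \<beta>) * monomial I \<beta> b) j)" for k
  have q0: "q k \<noteq> 0" if k: "k \<in> I" for k
  proof -
    have "coeff (q k) (j0 k) = (\<Sum>j\<le>J. if j = j0 k then \<Sum>\<beta>\<in>exps I J. u k (j, \<beta>) * monomial I \<beta> b else 0)"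
      unfolding q_def coeff_sum by (intro sum.cong) auto
    also have "\<dots> = (\<Sum>\<beta>\<in>exps I J. u k (j0 k, \<beta>) * monomial I \<beta> b)"
      using j0[OF k] by (auto simp: sum.delta)
    finally have "coeff (q k) (j0 k) \<noteq> 0" using b[OF k] by simp
    then show ?thesis by auto
  qed
  have root: "poly (q k) (x k) = 0"
    if x: "F x \<noteq> 0" "\<forall>i\<in>I. F' i x = - b i * F x" and k: "k \<in> I" for x k
  proof -
    have "\<phi> k (j,\<beta>) x = F x ^ (n * J) * (x k ^ j * monomial I \<beta> b)" if "(j,\<beta>) \<in> ?A" for j \<beta>
    proof -
      have "(\<Prod>i\<in>I. (- F' i x) ^ \<beta> i * F x ^ (J - \<beta> i)) = (\<Prod>i\<in>I. F x ^ J * b i ^ \<beta> i)"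
      proof (rule prod.cong[OF refl])
        fix i assume i: "i \<in> I"
        then have "\<beta> i \<le> J" using that by (auto simp: exps_def PiE_iff)
        then have "F x ^ J = F x ^ \<beta> i * F x ^ (J - \<beta> i)" by (simp flip: power_add)
        then show "(- F' i x) ^ \<beta> i * F x ^ (J - \<beta> i) = F x ^ J * b i ^ \<beta> i"
          using x(2) i by (simp add: power_mult_distrib)
      qed
      also have "\<dots> = F x ^ (n * J) * monomial I \<beta> b"
        by (simp add: prod.distrib monomial_def n_def mult.commute flip: power_mult)
      finally show ?thesis by (simp add: \<phi>_def)
    qed
    then have "(\<Sum>a\<in>?A. u k a * \<phi> k a x) = (\<Sum>(j,\<beta>)\<in>?A. u k (j,\<beta>) * (F x ^ (n * J) * (x k ^ j * monomial I \<beta> b)))"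
      by (intro sum.cong) auto
    also have "\<dots> = F x ^ (n * J) * (\<Sum>j\<le>J. (\<Sum>\<beta>\<in>exps I J. u k (j, \<beta>) * monomial I \<beta> b) * x k ^ j)"
      by (simp add: sum_distrib_left sum_distrib_right ac_simps flip: sum.cartesian_product)
    also have "(\<Sum>j\<le>J. (\<Sum>\<beta>\<in>exps I J. u k (j, \<beta>) * monomial I \<beta> b) * x k ^ j) = poly (q k) (x k)"
      by (simp add: q_def poly_sum poly_monom)
    finally show ?thesis using u(2)[OF k, of x] x(1) by simp
  qed
  have "finite (\<Union>k\<in>I. {t. poly (q k) t = 0})"
    using I q0 poly_roots_finite by blast
  with root show ?thesis
    by (intro exI[of _ b] exI[of _ "\<Union>k\<in>I. {t. poly (q k) t = 0}"]) blast
qed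

section \<open>Components of the complement of a hypersurface\<close>

text \<open>
  Coordinates outside \<open>I\<close> are fixed to be zero, so that the closure of the cube is compact whatever
  the ambient index type is.
\<close>

definition cube :: "'i set \<Rightarrow> real \<Rightarrow> ('i \<Rightarrow> real) set" where
  "cube I R = {x. (\<forall>i\<in>I. \<bar>x i\<bar> < R) \<and> (\<forall>i. i \<notin> I \<longrightarrow> x i = 0)}"

text \<open>
  The neighbourhoods are boxes in the coordinates from \<open>I\<close>. They are convex, so that straight
  segments stay inside them and can serve as paths.
\<close>

lemma pol_nonzero_nearby:
  assumes "pol I d f" "f z \<noteq> 0"
  shows "\<exists>\<delta>>0. \<forall>y. (\<forall>i\<in>I. \<bar>y i - z i\<bar> < \<delta>) \<longrightarrow> f y \<noteq> 0"
proof -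
  let ?B = "\<lambda>\<delta>. {y. \<forall>i\<in>I. \<bar>y i - z i\<bar> < \<delta>}"
  let ?N = "INF \<delta>\<in>{0<..}. principal (?B \<delta>)"
  have ev: "eventually P ?N \<longleftrightarrow> (\<exists>\<delta>\<in>{0<..}. eventually P (principal (?B \<delta>)))" for P
  proof (rule eventually_INF_base)
    show "{0<..} \<noteq> ({} :: real set)" by auto
    fix a b :: real assume "a \<in> {0<..}" "b \<in> {0<..}"
    then show "\<exists>x\<in>{0<..}. principal (?B x) \<le> inf (principal (?B a)) (principal (?B b))"
      by (intro bexI[of _ "min a b"]) auto
  qed
  have "((\<lambda>y. y i) \<longlongrightarrow> z i) ?N" if "i \<in> I" for i
    using that by (auto simp: tendsto_iff ev eventually_principal dist_real_def)
  from pol_tendsto[OF assms(1), where g = "\<lambda>y. y", OF this] have "(f \<longlongrightarrow> f z) ?N" by simp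
  then have "eventually (\<lambda>y. f y \<noteq> 0) ?N" using assms(2) by (rule tendsto_imp_eventually_ne)
  then show ?thesis unfolding ev by (auto simp: eventually_principal)
qed

text \<open>
  \<open>D\<close> vanishes on the faces of the cube in addition to the zeros of \<open>F\<close>, so a maximum of
  \<open>\<bar>D x\<bar> exp (b \<bullet> x)\<close> on the compact closure of a component is attained at a point of the component
  itself. There every partial derivative of this function vanishes. For the \<open>b\<close> provided by
  \<open>log_gradient_fibre_finite\<close> such points form a finite set, which therefore meets all components.
\<close>

theorem finitely_many_path_components:
  assumes I: "finite I" and F: "pol I d F"
  shows "\<exists>T. finite T \<and> (\<forall>x\<in>cube I R. F x \<noteq> 0 \<longrightarrow>
           (\<exists>z\<in>T. path_component {y \<in> cube I R. F y \<noteq> 0} x z))"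
proof -
  define D where "D x = F x * (\<Prod>i\<in>I. (R + x i) * (R + - x i))" for x
  have "pol I (Suc 0 + Suc 0) (\<lambda>x. (R + x i) * (R + - x i))" if "i \<in> I" for i
    using that by (intro pol.mult pol.add pol.const pol_uminus pol.coord)
  from pol_prod[OF this] F have "pol I (d + card I * (Suc 0 + Suc 0)) D"
    unfolding D_def by (intro pol.mult)
  then obtain e where D: "pol I e D" by blast
  have "\<exists>D'. \<forall>i\<in>I. pol I e (D' i) \<and>
      (\<forall>x. ((\<lambda>t. D (x(i := t))) has_real_derivative D' i x) (at (x i)))"
    by (intro bchoice ballI pol_partial[OF D])
  then obtain D' where D': "\<And>i. i \<in> I \<Longrightarrow> pol I e (D' i)"
    "\<And>i x. i \<in> I \<Longrightarrow> ((\<lambda>t. D (x(i := t))) has_real_derivative D' i x) (at (x i))"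
    by blast
  obtain b Z where Z: "finite Z"
    "\<And>x k. D x \<noteq> 0 \<Longrightarrow> (\<forall>i\<in>I. D' i x = - b i * D x) \<Longrightarrow> k \<in> I \<Longrightarrow> x k \<in> Z"
    using log_gradient_fibre_finite[OF I D, of D', OF D'(1)] by metis
  define T where "T = {x. \<forall>i. (i \<in> I \<longrightarrow> x i \<in> Z) \<and> (i \<notin> I \<longrightarrow> x i = 0)}"
  have T: "finite T" unfolding T_def by (rule finite_set_of_finite_funs[OF I Z(1)])
  define W where "W = {y \<in> cube I R. F y \<noteq> 0}"
  have D_on_cube: "D y \<noteq> 0 \<longleftrightarrow> F y \<noteq> 0" if "y \<in> cube I R" for y
  proof -
    have "(R + y i) * (R + - y i) \<noteq> 0" if "i \<in> I" for i
      using \<open>y \<in> cube I R\<close> that by (fastforce simp: cube_def)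
    then show ?thesis by (auto simp: D_def I)
  qed
  define Q where "Q = (\<Pi>\<^sub>E i\<in>UNIV. if i \<in> I then {-R..R} else {0 :: real})"
  have "compactin (product_topology (\<lambda>i::'a. euclidean) UNIV) Q"
    unfolding Q_def compactin_PiE by simp
  then have Q: "compact Q" by (simp add: euclidean_product_topology)
  have closedQ: "closed Q"
  proof -
    have "Q = (\<Inter>i. {y. y i \<in> (if i \<in> I then {-R..R} else {0})})"
      by (auto simp: Q_def PiE_iff)
    moreover have "closed {y. y i \<in> (if i \<in> I then {-R..R} else {0 :: real})}" for i :: 'a
    proof -
      have "closed ((\<lambda>y :: 'a \<Rightarrow> real. y i) -` (if i \<in> I then {-R..R} else {0}))"
        using continuous_on_product_coordinates[of i] by (auto intro: closed_vimage)
      then show ?thesis by (simp add: vimage_def)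
    qed
    ultimately show ?thesis by (auto intro: closed_INT)
  qed
  have "\<exists>z\<in>T. path_component W x z" if x: "x \<in> W" for x
  proof -
    define C where "C = path_component_set W x"
    define E where "E y = D y * exp (\<Sum>j\<in>I. b j * y j)" for y
    have CW: "C \<subseteq> W" by (simp add: C_def path_component_subset)
    have xC: "x \<in> C" using x by (simp add: C_def path_component_refl)
    have "W \<subseteq> Q" by (fastforce simp: W_def cube_def Q_def)
    with CW closedQ have clQ: "closure C \<subseteq> Q" by (meson closure_minimal subset_trans)
    then have cpt: "compact (closure C)" using compact_Int_closed[OF Q closed_closure, of C]
      by (simp add: inf.absorb2)
    have cont: "continuous_on (closure C) (\<lambda>y. (E y)\<^sup>2)"
      unfolding E_def
      by (intro continuous_intros pol_continuous_comp[OF D]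
          continuous_on_subset[OF continuous_on_product_coordinates]) auto
    have "closure C \<noteq> {}" using xC by auto
    from continuous_attains_sup[OF cpt this cont]
    obtain z where z: "z \<in> closure C" "\<And>y. y \<in> closure C \<Longrightarrow> (E y)\<^sup>2 \<le> (E z)\<^sup>2"
      by (elim bexE) simp
    have "E x \<noteq> 0" using x D_on_cube by (auto simp: E_def W_def)
    with z(2)[of x] xC closure_subset have "E z \<noteq> 0" by fastforce
    then have Dz: "D z \<noteq> 0" by (simp add: E_def)
    have zc: "z \<in> cube I R"
    proof -
      have "(R + z i) * (R + - z i) \<noteq> 0" if "i \<in> I" for i
        using Dz that I by (auto simp: D_def)
      then have "\<bar>z i\<bar> \<noteq> R" if "i \<in> I" for i using that by fastforce
      moreover have "z \<in> Q" using z(1) clQ by blast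
      then have "\<bar>z i\<bar> \<le> R" if "i \<in> I" for i using that unfolding Q_def
        by (auto simp: PiE_iff abs_le_iff dest!: spec[of _ i]) 
      moreover have "z i = 0" if "i \<notin> I" for i using that \<open>z \<in> Q\<close> unfolding Q_def
        by (auto simp: PiE_iff dest!: spec[of _ i])
      ultimately show ?thesis by (fastforce simp: cube_def)
    qed
    obtain \<delta> where \<delta>: "\<delta> > 0" "\<And>y. (\<forall>i\<in>I. \<bar>y i - z i\<bar> < \<delta>) \<Longrightarrow> D y \<noteq> 0"
      using pol_nonzero_nearby[OF D Dz] by blast
    have near: "path_component W z y" if y: "y \<in> cube I R" "\<forall>i\<in>I. \<bar>y i - z i\<bar> < \<delta>" for y
    proof -
      define g where "g t i = z i + t * (y i - z i)" for t i
      have "path g" unfolding path_def g_def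
        by (intro continuous_on_coordinatewise_then_product continuous_intros)
      moreover have "g t \<in> W" if t: "t \<in> {0..1}" for t
      proof -
        have "\<bar>g t i\<bar> < R" if i: "i \<in> I" for i
        proof -
          have "g t i = (1 - t) * z i + t * y i" by (simp add: g_def algebra_simps)
          moreover have "- R < z i" "- R < y i" "z i < R" "y i < R"
            using zc y(1) i by (auto simp: cube_def abs_less_iff)
          then have "(1 - t) *\<^sub>R z i + t *\<^sub>R y i \<in> {-R<..<R}"
            using t by (intro convexD_alt) (auto intro: convex_real_interval)
          ultimately show ?thesis by auto
        qed
        then have c: "g t \<in> cube I R" using zc y(1) by (auto simp: cube_def g_def)
        have "\<bar>g t i - z i\<bar> < \<delta>" if "i \<in> I" for i
        proof -
          have "\<bar>g t i - z i\<bar> = t * \<bar>y i - z i\<bar>" using t by (simp add: g_def abs_mult)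
          also have "\<dots> \<le> 1 * \<bar>y i - z i\<bar>" using t by (intro mult_right_mono) auto
          finally show ?thesis using y(2) that by force
        qed
        then have "D (g t) \<noteq> 0" using \<delta>(2) by blast
        with c show ?thesis using D_on_cube by (simp add: W_def)
      qed
      ultimately show ?thesis unfolding path_component_def
        by (intro exI[of _ g]) (auto simp: path_image_def pathstart_def pathfinish_def g_def)
    qed
    \<comment> \<open>The component is relatively closed in \<open>W\<close>.\<close>
    have zC: "z \<in> C"
    proof -
      have "open {f. \<forall>i\<in>I. f (id i) \<in> ball (z i) \<delta>}"
        by (rule product_topology_basis'[OF I]) auto
      with z(1) \<delta>(1) obtain c where c: "c \<in> C" "\<forall>i\<in>I. c i \<in> ball (z i) \<delta>"
        using open_Int_closure_eq_empty by (force simp: closure_iff_nhds_not_empty)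
      have "path_component W z c"
        using c CW by (intro near) (auto simp: W_def dist_real_def abs_minus_commute)
      then show ?thesis using c(1) path_component_sym path_component_trans unfolding C_def by blast
    qed
    have "D' i z = - b i * D z" if i: "i \<in> I" for i
    proof -
      let ?s = "\<Sum>j\<in>I - {i}. b j * z j"
      let ?e = "exp (b i * z i + ?s)"
      have E: "E (z(i := t)) = D (z(i := t)) * exp (b i * t + ?s)" for t
        using I i by (simp add: E_def sum.remove)
      have "((\<lambda>t. (E (z(i := t)))\<^sup>2) has_real_derivative
          2 * E z * (D' i z * ?e + D z * (b i * ?e))) (at (z i))"
        unfolding E using E[of "z i"]
        by (auto intro!: derivative_eq_intros D'(2)[OF i] simp: algebra_simps power2_eq_square)
      moreover have "(E (z(i := t)))\<^sup>2 \<le> (E (z(i := z i)))\<^sup>2"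
        if t: "\<bar>z i - t\<bar> < min \<delta> (R - \<bar>z i\<bar>)" for t
      proof -
        have "path_component W z (z(i := t))"
          using zc t i \<delta>(1) by (intro near) (auto simp: cube_def)
        then have "z(i := t) \<in> C" using zC path_component_trans unfolding C_def by blast
        then show ?thesis using z(2) closure_subset by force
      qed
      moreover have "0 < min \<delta> (R - \<bar>z i\<bar>)" using \<delta>(1) zc i by (auto simp: cube_def)
      ultimately have "2 * E z * (D' i z * ?e + D z * (b i * ?e)) = 0"
        by (intro DERIV_local_max[where d = "min \<delta> (R - \<bar>z i\<bar>)"]) blast+
      with \<open>E z \<noteq> 0\<close> have "D' i z * ?e + D z * (b i * ?e) = 0" by simp
      then have "?e * (D' i z + b i * D z) = 0" by (simp add: algebra_simps)
      then show ?thesis by simp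
    qed
    with Z(2)[OF Dz] zc have "z \<in> T" by (auto simp: T_def cube_def)
    with zC show ?thesis by (auto simp: C_def)
  qed
  with T show ?thesis by (auto simp: W_def)
qed

lemma path_component_continuous_image:
  assumes "path_component S x y" "continuous_on S f" "f ` S \<subseteq> T"
  shows "path_component T (f x) (f y)"
proof -
  obtain g where g: "path g" "path_image g \<subseteq> S" "pathstart g = x" "pathfinish g = y"
    using assms(1) unfolding path_component_def by blast
  then have "path (f \<circ> g)" using assms(2) by (meson continuous_on_subset path_continuous_image)
  then show ?thesis unfolding path_component_def using g assms(3)
    by (intro exI[of _ "f \<circ> g"]) (auto simp: path_image_def pathstart_def pathfinish_def)
qed

lemma det_scaleR3: "det (c *\<^sub>R (a :: real^3^3)) = c ^ 3 * det a"
  by (simp add: det_3 power3_eq_cube algebra_simps)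

text \<open>
  Scaling moves any invertible matrix into the cube without changing the sign of its determinant, so
  the theorem on polynomials applies to the determinant.
\<close>

lemma finitely_many_components_of_bases:
  "\<exists>T. finite T \<and> (\<forall>a :: real^3^3. det a \<noteq> 0 \<longrightarrow> (\<exists>b\<in>T. path_component {a. det a \<noteq> 0} a b))"
proof -
  define m :: "(3 \<times> 3 \<Rightarrow> real) \<Rightarrow> real^3^3" where "m x = (\<chi> i j. x (i, j))" for x
  have "is_pol UNIV (\<lambda>x. det (m x))"
    unfolding det_3 m_def vec_lambda_beta by (intro is_pol_intros UNIV_I)
  then obtain d where "pol UNIV d (\<lambda>x. det (m x))" unfolding is_pol_def by blast
  from finitely_many_path_components[OF _ this, of 1] obtain T where T: "finite T"
    "\<And>x. x \<in> cube UNIV 1 \<Longrightarrow> det (m x) \<noteq> 0 \<Longrightarrow>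
       \<exists>z\<in>T. path_component {y \<in> cube UNIV 1. det (m y) \<noteq> 0} x z" by auto
  have "\<exists>b\<in>m ` T. path_component {a. det a \<noteq> 0} a b" if a: "det a \<noteq> 0" for a
  proof -
    define c where "c = 1 / (1 + (\<Sum>i\<in>UNIV. \<Sum>j\<in>UNIV. \<bar>a $ i $ j\<bar>))"
    have pos: "1 + (\<Sum>i\<in>UNIV. \<Sum>j\<in>UNIV. \<bar>a $ i $ j\<bar>) > 0"
      by (intro add_pos_nonneg sum_nonneg) auto
    then have c: "c > 0" by (simp add: c_def)
    define x where "x = (\<lambda>(i, j). c * a $ i $ j)"
    have mx: "m x = c *\<^sub>R a" by (simp add: m_def x_def vec_eq_iff)
    have "\<bar>x (i, j)\<bar> < 1" for i j
    proof -
      have "\<bar>a $ i $ j\<bar> \<le> (\<Sum>j\<in>UNIV. \<bar>a $ i $ j\<bar>)" by (intro member_le_sum) auto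
      also have "\<dots> \<le> (\<Sum>i\<in>UNIV. \<Sum>j\<in>UNIV. \<bar>a $ i $ j\<bar>)"
        by (intro member_le_sum[of i UNIV "\<lambda>i. \<Sum>j\<in>UNIV. \<bar>a $ i $ j\<bar>"] sum_nonneg) auto
      finally show ?thesis using pos by (simp add: x_def c_def abs_mult)
    qed
    then have "x \<in> cube UNIV 1" by (simp add: cube_def split_paired_All)
    moreover have "det (m x) \<noteq> 0" using a c by (simp add: mx det_scaleR3)
    ultimately obtain z where z: "z \<in> T" "path_component {y \<in> cube UNIV 1. det (m y) \<noteq> 0} x z"
      using T(2) by blast
    have "continuous_on UNIV m" unfolding m_def
      by (intro continuous_on_vec_lambda continuous_on_product_coordinates)
    then have "continuous_on {y \<in> cube UNIV 1. det (m y) \<noteq> 0} m" by (rule continuous_on_subset) simp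
    from path_component_continuous_image[OF z(2) this, of "{a. det a \<noteq> 0}"]
    have 1: "path_component {a. det a \<noteq> 0} (c *\<^sub>R a) (m z)" unfolding mx by blast
    have "closed_segment a (c *\<^sub>R a) \<subseteq> {a. det a \<noteq> 0}"
    proof
      fix b assume "b \<in> closed_segment a (c *\<^sub>R a)"
      then obtain u where u: "0 \<le> u" "u \<le> 1" "b = (1 - u) *\<^sub>R a + u *\<^sub>R (c *\<^sub>R a)"
        by (auto simp: closed_segment_def)
      then have "b = ((1 - u) * 1 + u * c) *\<^sub>R a" by (simp add: algebra_simps)
      moreover have "(1 - u) * 1 + u * c > 0"
        using c u(1,2) by (cases "u = 0") (auto intro!: add_nonneg_pos)
      ultimately show "b \<in> {a. det a \<noteq> 0}" using a by (simp add: det_scaleR3)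
    qed
    then have "path_component {a. det a \<noteq> 0} a (c *\<^sub>R a)" by (rule path_component_linepath)
    with 1 z(1) show ?thesis using path_component_trans by blast
  qed
  with T(1) show ?thesis by (intro exI[of _ "m ` T"]) simp
qed

section \<open>Lattices and periodicity bases\<close>

lemma is_endpoint_closed_segment:
  assumes "a \<noteq> b"
  shows "is_endpoint p (closed_segment a b) \<longleftrightarrow> p = a \<or> p = b"
  using assms by (auto simp: is_endpoint_def doubleton_eq_iff)

definition of_int_vec :: "int^'n \<Rightarrow> real^'n" where
  "of_int_vec k = (\<chi> i. of_int (k $ i))"

definition of_int_mat :: "int^'n^'m \<Rightarrow> real^'n^'m" where
  "of_int_mat M = (\<chi> i. of_int_vec (M $ i))"

lemma of_int_vec_add: "of_int_vec (k + l) = of_int_vec k + of_int_vec l"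
  and of_int_vec_diff: "of_int_vec (k - l) = of_int_vec k - of_int_vec l"
  and of_int_vec_0 [simp]: "of_int_vec 0 = 0"
  by (auto simp: of_int_vec_def vec_eq_iff)

lemma of_int_vec_mult: "of_int_vec (l v* M) = of_int_vec l v* of_int_mat M"
  by (simp add: of_int_vec_def of_int_mat_def vector_matrix_mult_def vec_eq_iff)

lemma translate_eq: "translate a k x = x + of_int_vec k v* a"
  by (simp add: translate_def of_int_vec_def vector_matrix_mult_def vec_eq_iff)

lemma translate_add: "translate a k (translate a l x) = translate a (k + l) x"
  by (simp add: translate_eq of_int_vec_add algebra_simps)

lemma translate_0 [simp]: "translate a 0 = id"
  by (auto simp: translate_eq)

lemma translate_image_add: "translate a k ` translate a l ` s = translate a (k + l) ` s"
  by (simp add: image_image translate_add)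

lemma translate_closed_segment:
  "translate a k ` closed_segment p q = closed_segment (translate a k p) (translate a k q)"
proof -
  have "translate a k = (+) (of_int_vec k v* a)" by (auto simp: translate_eq)
  then show ?thesis by (simp add: closed_segment_translation)
qed

lemma basis3_iff_det: "basis3 a \<longleftrightarrow> det a \<noteq> 0"
proof -
  have r: "rows a = range (($) a)" by (auto simp: rows_def row_def vec_lambda_eta)
  have inv: "det a \<noteq> 0 \<longleftrightarrow> (\<exists>B. B ** a = mat 1)"
    by (metis invertible_det_nz invertible_left_inverse)
  show ?thesis
  proof
    assume "basis3 a"
    then have "span (rows a) = UNIV" by (simp add: basis3_def r)
    then show "det a \<noteq> 0" using inv matrix_left_invertible_span_rows by blast
  next
    assume d: "det a \<noteq> 0"
    have "inj (($) a)"
    proof (rule injI, rule ccontr)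
      fix i j assume "a $ i = a $ j" "i \<noteq> j"
      then have "det a = 0" by (intro det_identical_rows[of i j]) (auto simp: row_def)
      with d show False by simp
    qed
    moreover have "span (rows a) = UNIV" using d inv matrix_left_invertible_span_rows by blast
    moreover have "independent (rows a)" using d det_dependent_rows by (metis dependent_vec_eq)
    ultimately show "basis3 a" by (simp add: basis3_def r)
  qed
qed

lemma node_orbit_translate: "node_orbit a (translate a k p) = node_orbit a p"
proof -
  have "translate a l (translate a k p) = translate a (l + k) p"
    "translate a l p = translate a (l - k) (translate a k p)" for l
    by (simp_all add: translate_add)
  then show ?thesis unfolding node_orbit_def by (metis (no_types, lifting) rangeI subsetI subset_antisym imageE)
qed

lemma edge_orbit_translate: "edge_orbit a (translate a k ` s) = edge_orbit a s"
proof -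
  have "translate a l ` translate a k ` s = translate a (l + k) ` s"
    "translate a l ` s = translate a (l - k) ` translate a k ` s" for l
    by (simp_all add: translate_image_add)
  then show ?thesis unfolding edge_orbit_def by (metis (no_types, lifting) rangeI subsetI subset_antisym imageE)
qed

lemma node_orbit_self: "p \<in> node_orbit a p"
proof -
  have "translate a 0 p \<in> node_orbit a p" unfolding node_orbit_def by (rule rangeI)
  then show ?thesis by simp
qed

lemma edge_orbit_self: "s \<in> edge_orbit a s"
proof -
  have "translate a 0 ` s \<in> edge_orbit a s" unfolding edge_orbit_def by (rule rangeI)
  then show ?thesis by simp
qed

lemma finite_vec_range:
  assumes "finite S"
  shows "finite {v :: 'a^'n. \<forall>j. v $ j \<in> S}"
proof -
  have "finite (\<Pi>\<^sub>E j\<in>(UNIV :: 'n set). S)" using assms by (intro finite_PiE) auto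
  moreover have "{v :: 'a^'n. \<forall>j. v $ j \<in> S} \<subseteq> vec_lambda ` (\<Pi>\<^sub>E j\<in>UNIV. S)"
  proof
    fix v :: "'a^'n" assume "v \<in> {v. \<forall>j. v $ j \<in> S}"
    then have "v = vec_lambda (($) v)" "($) v \<in> (\<Pi>\<^sub>E j\<in>UNIV. S)" by (auto simp: vec_lambda_eta)
    then show "v \<in> vec_lambda ` (\<Pi>\<^sub>E j\<in>UNIV. S)" by blast
  qed
  ultimately show ?thesis using finite_surj by blast
qed

text \<open>
  The sublattice spanned by the rows of \<open>M\<close> has finite index: rounding down the coordinates with
  respect to these rows leaves a remainder in the fundamental parallelepiped, which contains finitely
  many integer points.
\<close>

lemma finite_index_remainders:
  fixes M :: "int^'n^'n"
  assumes "det (of_int_mat M) \<noteq> 0"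
  shows "\<exists>K. finite K \<and> (\<forall>k. \<exists>l. k - l v* M \<in> K)"
proof -
  define B where "B = (\<Sum>i\<in>UNIV. \<Sum>j\<in>UNIV. \<bar>M $ i $ j\<bar>)"
  let ?K = "{k. \<forall>j. k $ j \<in> {-B..B}}"
  obtain M' where M': "M' ** of_int_mat M = mat 1"
    using assms by (metis invertible_det_nz invertible_left_inverse)
  have "\<exists>l. k - l v* M \<in> ?K" for k
  proof
    define c where "c = of_int_vec k v* M'"
    have c: "c v* of_int_mat M = of_int_vec k"
      by (simp add: c_def vector_matrix_mul_assoc M')
    define l :: "int^'n" where "l = (\<chi> i. \<lfloor>c $ i\<rfloor>)"
    have "\<bar>(k - l v* M) $ j\<bar> \<le> B" for j
    proof -
      have "of_int_vec (k - l v* M) = (c - of_int_vec l) v* of_int_mat M"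
        by (simp add: of_int_vec_diff of_int_vec_mult c vector_matrix_mult_diff_distrib)
      then have "real_of_int ((k - l v* M) $ j) = (\<Sum>i\<in>UNIV. (c $ i - of_int \<lfloor>c $ i\<rfloor>) * of_int (M $ i $ j))"
        by (simp add: vec_eq_iff of_int_vec_def of_int_mat_def vector_matrix_mult_def l_def)
      also have "\<bar>\<dots>\<bar> \<le> (\<Sum>i\<in>UNIV. \<bar>(c $ i - of_int \<lfloor>c $ i\<rfloor>) * of_int (M $ i $ j)\<bar>)"
        by (rule sum_abs)
      also have "\<dots> \<le> (\<Sum>i\<in>UNIV. \<bar>of_int (M $ i $ j)\<bar>)"
      proof (rule sum_mono)
        fix i
        have "\<bar>c $ i - of_int \<lfloor>c $ i\<rfloor>\<bar> \<le> 1" by linarith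
        then show "\<bar>(c $ i - of_int \<lfloor>c $ i\<rfloor>) * of_int (M $ i $ j)\<bar> \<le> \<bar>of_int (M $ i $ j) :: real\<bar>"
          by (simp add: abs_mult mult_left_le_one_le)
      qed
      also have "\<dots> \<le> (\<Sum>i\<in>UNIV. \<Sum>j\<in>UNIV. \<bar>of_int (M $ i $ j)\<bar>)"
        by (intro sum_mono member_le_sum) auto
      also have "\<dots> = of_int B" by (simp add: B_def)
      finally show ?thesis by linarith
    qed
    then show "k - l v* M \<in> ?K"
      unfolding mem_Collect_eq atLeastAtMost_iff abs_le_iff by (metis minus_le_iff)
  qed
  moreover have "finite ?K" by (rule finite_vec_range) simp
  ultimately show ?thesis by blast
qed

text \<open>
  Since the sublattice has finite index, every orbit of the full lattice splits into finitely many
  orbits of the sublattice.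
\<close>

lemma periodicity_basis_sublattice:
  assumes a: "periodicity_basis a \<N>" and M: "det (of_int_mat M) \<noteq> 0"
  shows "periodicity_basis (of_int_mat M ** a) \<N>"
proof -
  let ?b = "of_int_mat M ** a"
  have tr: "translate ?b l = translate a (l v* M)" for l
    by (rule ext) (simp add: translate_eq of_int_vec_mult vector_matrix_mul_assoc)
  obtain K where K: "finite K" "\<And>k. \<exists>l. k - l v* M \<in> K"
    using finite_index_remainders[OF M] by blast
  have split: "\<exists>l k'. k' \<in> K \<and> k = l v* M + k'" for k
  proof -
    obtain l where "k - l v* M \<in> K" using K(2) by blast
    then show ?thesis by (intro exI[of _ l] exI[of _ "k - l v* M"]) simp
  qed
  have "finite (node_orbit ?b ` nodes \<N>)"
  proof -
    obtain R where R: "R \<subseteq> nodes \<N>" "finite R" "node_orbit a ` nodes \<N> = node_orbit a ` R"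
      using finite_subset_image[of "node_orbit a ` nodes \<N>" "node_orbit a" "nodes \<N>"] a
      by (auto simp: periodicity_basis_def)
    have "node_orbit ?b ` nodes \<N> \<subseteq> (\<lambda>(r, k). node_orbit ?b (translate a k r)) ` (R \<times> K)"
    proof
      fix X assume "X \<in> node_orbit ?b ` nodes \<N>"
      then obtain p where p: "p \<in> nodes \<N>" "X = node_orbit ?b p" by blast
      with R(3) obtain r where r: "r \<in> R" "node_orbit a p = node_orbit a r" by blast
      then have "p \<in> node_orbit a r" using node_orbit_self by metis
      then obtain k where k: "p = translate a k r" by (auto simp: node_orbit_def)
      obtain l k' where "k' \<in> K" "k = l v* M + k'" using split by blast
      then have "p = translate ?b l (translate a k' r)" by (simp add: k tr translate_add)
      with p(2) have "X = node_orbit ?b (translate a k' r)" by (simp add: node_orbit_translate)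
      with r \<open>k' \<in> K\<close> show "X \<in> (\<lambda>(r, k). node_orbit ?b (translate a k r)) ` (R \<times> K)"
        by (intro image_eqI[of _ _ "(r, k')"]) auto
    qed
    then show ?thesis using R(2) K(1) by (meson finite_SigmaI finite_surj)
  qed
  moreover have "finite (edge_orbit ?b ` edges \<N>)"
  proof -
    obtain R where R: "R \<subseteq> edges \<N>" "finite R" "edge_orbit a ` edges \<N> = edge_orbit a ` R"
      using finite_subset_image[of "edge_orbit a ` edges \<N>" "edge_orbit a" "edges \<N>"] a
      by (auto simp: periodicity_basis_def)
    have "edge_orbit ?b ` edges \<N> \<subseteq> (\<lambda>(r, k). edge_orbit ?b (translate a k ` r)) ` (R \<times> K)"
    proof
      fix X assume "X \<in> edge_orbit ?b ` edges \<N>"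
      then obtain p where p: "p \<in> edges \<N>" "X = edge_orbit ?b p" by blast
      with R(3) obtain r where r: "r \<in> R" "edge_orbit a p = edge_orbit a r" by blast
      then have "p \<in> edge_orbit a r" using edge_orbit_self by metis
      then obtain k where k: "p = translate a k ` r" by (auto simp: edge_orbit_def)
      obtain l k' where "k' \<in> K" "k = l v* M + k'" using split by blast
      then have "p = translate ?b l ` translate a k' ` r" by (simp add: k tr translate_image_add)
      with p(2) have "X = edge_orbit ?b (translate a k' ` r)" by (simp add: edge_orbit_translate)
      with r \<open>k' \<in> K\<close> show "X \<in> (\<lambda>(r, k). edge_orbit ?b (translate a k ` r)) ` (R \<times> K)"
        by (intro image_eqI[of _ _ "(r, k')"]) auto
    qed
    then show ?thesis using R(2) K(1) by (meson finite_SigmaI finite_surj)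
  qed
  ultimately show ?thesis using a M
    by (simp add: periodicity_basis_def basis3_iff_det det_mul tr)
qed

lemma scaleR_eq_of_int_mat_mult:
  "of_int n *\<^sub>R (a :: real^'n^'m) = of_int_mat (mat n) ** a"
proof -
  have "(\<Sum>j\<in>UNIV. real_of_int (if i = j then n else 0) * a $ j $ h)
      = (\<Sum>j\<in>UNIV. if i = j then of_int n * a $ i $ h else 0)" for i h
    by (intro sum.cong) auto
  then show ?thesis
    by (simp add: vec_eq_iff of_int_mat_def of_int_vec_def mat_def matrix_matrix_mult_def sum.delta)
qed

lemma det_of_int_mat_mat: "det (of_int_mat (mat n :: int^3^3)) = of_int n ^ 3"
proof -
  have "of_int_mat (mat n :: int^3^3) = mat (of_int n)"
    by (simp add: vec_eq_iff of_int_mat_def of_int_vec_def mat_def)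
  then show ?thesis by (simp add: det_3 mat_def power3_eq_cube)
qed

text \<open>
  Any node \<open>p\<close> moved by the multiples of \<open>b $ i\<close> stays among the nodes, of which there are finitely
  many classes modulo \<open>a\<close>. By the pigeonhole principle two of these multiples fall into the same
  class, so a positive multiple of \<open>b $ i\<close> lies in the lattice of \<open>a\<close>.
\<close>

lemma commensurable_periodicity_bases:
  assumes a: "periodicity_basis a \<N>" and b: "periodicity_basis b \<N>" and ne: "nodes \<N> \<noteq> {}"
  shows "\<exists>(n :: int) M. n > 0 \<and> of_int n *\<^sub>R b = of_int_mat M ** a"
proof -
  obtain p where p: "p \<in> nodes \<N>" using ne by blast
  have "\<exists>n m. n > 0 \<and> of_int n *\<^sub>R b $ i = of_int_vec m v* a" for i
  proof -
    let ?f = "\<lambda>k :: nat. node_orbit a (translate b (axis i (int k)) p)"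
    have "translate b k ` nodes \<N> = nodes \<N>" for k
      using b by (simp add: periodicity_basis_def)
    then have "translate b k p \<in> nodes \<N>" for k using p by (metis imageI)
    then have "range ?f \<subseteq> node_orbit a ` nodes \<N>" by (intro image_subsetI imageI)
    moreover have "finite (node_orbit a ` nodes \<N>)" using a by (simp add: periodicity_basis_def)
    ultimately have "finite (range ?f)" by (rule finite_subset)
    then have "\<not> inj ?f" using finite_imageD infinite_UNIV_nat by blast
    then obtain k k' where "k \<noteq> k'" "?f k = ?f k'" by (auto simp: inj_def)
    then obtain k k' where k: "k < k'" "?f k = ?f k'" by (metis linorder_neqE_nat)
    then have "translate b (axis i (int k')) p \<in> ?f k" using node_orbit_self by metis
    then obtain m where m: "translate b (axis i (int k')) p = translate a m (translate b (axis i (int k)) p)"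
      by (auto simp: node_orbit_def)
    have ax: "of_int_vec (axis i c) v* b = of_int c *\<^sub>R b $ i" for c
    proof -
      have "(\<Sum>j\<in>UNIV. of_int (axis i c $ j) * b $ j $ h) = (\<Sum>j\<in>UNIV. if j = i then of_int c * b $ i $ h else 0)" for h
        by (intro sum.cong) (auto simp: axis_def)
      then show ?thesis by (simp add: of_int_vec_def vector_matrix_mult_def vec_eq_iff sum.delta)
    qed
    have "of_int (int k' - int k) *\<^sub>R b $ i = of_int_vec m v* a"
      using m by (simp add: translate_eq ax algebra_simps)
    with k(1) show ?thesis by (intro exI[of _ "int k' - int k"] exI[of _ m]) auto
  qed
  then obtain n m where nm: "\<And>i. n i > 0" "\<And>i. of_int (n i) *\<^sub>R b $ i = of_int_vec (m i) v* a"
    by metis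
  \<comment> \<open>The common multiple \<open>\<Prod>j. n j\<close> of the \<open>n i\<close> clears all denominators at once.\<close>
  define c where "c i = (\<Prod>j\<in>UNIV - {i}. n j)" for i
  have c: "(\<Prod>j\<in>UNIV. n j) = c i * n i" for i
    by (simp add: c_def prod.remove[of UNIV i] mult.commute)
  define M :: "int^3^3" where "M = (\<chi> i. \<chi> j. c i * m i $ j)"
  have "(\<Prod>j\<in>UNIV. n j) > 0" using nm(1) by (intro prod_pos) auto
  moreover have "of_int (\<Prod>j\<in>UNIV. n j) *\<^sub>R b = of_int_mat M ** a"
  proof -
    have "of_int (c i * n i) * b $ i $ h = (\<Sum>j\<in>UNIV. of_int (c i * m i $ j) * a $ j $ h)" for i h
    proof -
      have "of_int (n i) * b $ i $ h = (\<Sum>j\<in>UNIV. of_int (m i $ j) * a $ j $ h)"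
        using nm(2)[of i] by (simp add: vec_eq_iff of_int_vec_def vector_matrix_mult_def)
      then have "of_int (c i) * (of_int (n i) * b $ i $ h) = of_int (c i) * (\<Sum>j\<in>UNIV. of_int (m i $ j) * a $ j $ h)"
        by simp
      then show ?thesis by (simp add: sum_distrib_left mult.assoc)
    qed
    moreover have "of_int (\<Prod>j\<in>UNIV. n j) * b $ i $ h = of_int (c i * n i) * b $ i $ h" for i h
      unfolding c[of i] ..
    ultimately show ?thesis
      by (simp add: vec_eq_iff of_int_mat_def of_int_vec_def M_def matrix_matrix_mult_def)
  qed
  ultimately show ?thesis by blast
qed

section \<open>Periodic isotopy is symmetric and transitive\<close>

text \<open>
  The condition that periodic isotopy imposes on the map at a single time.
\<close>

definition net_map :: "(real^3 \<Rightarrow> real^3) \<Rightarrow> net \<Rightarrow> net \<Rightarrow> bool" where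
  "net_map f \<M> \<N> \<longleftrightarrow> bij_betw f (body \<M>) (body \<N>) \<and> f ` nodes \<M> \<subseteq> nodes \<N> \<and>
     (\<forall>p q. p \<noteq> q \<and> closed_segment p q \<in> edges \<M> \<longrightarrow>
        closed_segment (f p) (f q) \<in> edges \<N> \<and>
        (\<forall>u\<in>{0..1}. f ((1 - u) *\<^sub>R p + u *\<^sub>R q) = (1 - u) *\<^sub>R f p + u *\<^sub>R f q))"

lemma periodically_isotopic_iff:
  "periodically_isotopic \<N>0 \<N>1 \<longleftrightarrow>
     (\<exists>(\<N> :: real \<Rightarrow> net) (a :: real \<Rightarrow> real^3^3) (f :: real \<Rightarrow> real^3 \<Rightarrow> real^3).
        \<N> 0 = \<N>0 \<and> \<N> 1 = \<N>1 \<and>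
        (\<forall>t\<in>{0..1}. proper_linear_3periodic_net (\<N> t) \<and> periodicity_basis (a t) (\<N> t) \<and>
           det (a t) > 0 \<and> net_map (f t) \<N>0 (\<N> t)) \<and>
        continuous_on {0..1} a \<and>
        (\<forall>x\<in>body \<N>0. f 0 x = x) \<and>
        (\<forall>p\<in>nodes \<N>0. continuous_on {0..1} (\<lambda>t. f t p)))"
  unfolding periodically_isotopic_def net_map_def right_handed_def
  by (intro ex_cong1) blast

lemma node_in_edge:
  assumes "proper_linear_3periodic_net \<N>" "p \<in> nodes \<N>"
  shows "\<exists>q. p \<noteq> q \<and> closed_segment p q \<in> edges \<N>"
  using assms by (auto simp: proper_linear_3periodic_net_def is_endpoint_def)

lemma edge_ends:
  assumes "proper_linear_3periodic_net \<N>" "s \<in> edges \<N>"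
  shows "\<exists>p q. p \<noteq> q \<and> s = closed_segment p q"
  using assms by (auto simp: proper_linear_3periodic_net_def)

lemma edge_end_node:
  assumes "proper_linear_3periodic_net \<N>" "closed_segment p q \<in> edges \<N>" "p \<noteq> q"
  shows "p \<in> nodes \<N>" "q \<in> nodes \<N>"
proof -
  have "nodes \<N> = {p. \<exists>s\<in>edges \<N>. is_endpoint p s}"
    using assms(1) by (simp add: proper_linear_3periodic_net_def)
  then show "p \<in> nodes \<N>" "q \<in> nodes \<N>"
    using assms(2,3) is_endpoint_closed_segment[OF assms(3)] by blast+
qed

lemma edge_in_body: "closed_segment p q \<in> edges \<N> \<Longrightarrow> x \<in> closed_segment p q \<Longrightarrow> x \<in> body \<N>"
  by (auto simp: body_def)

lemma edges_meet_in_endpoint: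
  assumes N: "proper_linear_3periodic_net \<N>" and s: "s \<in> edges \<N>" "s' \<in> edges \<N>" "s \<noteq> s'"
    and x: "x \<in> s" "x \<in> s'"
  shows "is_endpoint x s'"
proof -
  have "essentially_disjoint (edges \<N>)" using N by (simp add: proper_linear_3periodic_net_def)
  then have "s \<inter> s' = {} \<or> (\<exists>p. s \<inter> s' = {p} \<and> is_endpoint p s \<and> is_endpoint p s')"
    using s unfolding essentially_disjoint_def by simp
  then obtain p where p: "s \<inter> s' = {p}" "is_endpoint p s'" using x by auto
  then have "x = p" using x by blast
  with p show ?thesis by simp
qed

lemma net_mapD:
  assumes "net_map f \<M> \<N>"
  shows "bij_betw f (body \<M>) (body \<N>)" "\<And>p. p \<in> nodes \<M> \<Longrightarrow> f p \<in> nodes \<N>"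
    "\<And>p q. closed_segment p q \<in> edges \<M> \<Longrightarrow> p \<noteq> q \<Longrightarrow> closed_segment (f p) (f q) \<in> edges \<N>"
    "\<And>p q u. closed_segment p q \<in> edges \<M> \<Longrightarrow> p \<noteq> q \<Longrightarrow> u \<in> {0..1} \<Longrightarrow>
       f ((1 - u) *\<^sub>R p + u *\<^sub>R q) = (1 - u) *\<^sub>R f p + u *\<^sub>R f q"
  using assms by (auto simp: net_map_def)

lemma net_map_ends_distinct:
  assumes "net_map f \<M> \<N>" "closed_segment p q \<in> edges \<M>" "p \<noteq> q"
  shows "f p \<noteq> f q"
proof -
  have "p \<in> body \<M>" "q \<in> body \<M>" by (auto intro: edge_in_body[OF assms(2)])
  moreover have "inj_on f (body \<M>)" using net_mapD(1)[OF assms(1)] by (rule bij_betw_imp_inj_on)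
  ultimately show ?thesis using assms(3) by (simp add: inj_on_eq_iff)
qed

lemma net_map_comp:
  assumes f: "net_map f \<M> \<N>" and g: "net_map g \<N> \<K>"
  shows "net_map (g \<circ> f) \<M> \<K>"
  unfolding net_map_def
proof (intro conjI allI impI)
  show "bij_betw (g \<circ> f) (body \<M>) (body \<K>)"
    by (rule bij_betw_trans[OF net_mapD(1)[OF f] net_mapD(1)[OF g]])
  show "(g \<circ> f) ` nodes \<M> \<subseteq> nodes \<K>" by (auto intro: net_mapD(2)[OF f] net_mapD(2)[OF g])
next
  fix p q assume "p \<noteq> q \<and> closed_segment p q \<in> edges \<M>"
  then have pq: "closed_segment p q \<in> edges \<M>" "p \<noteq> q" by simp_all
  note fpq = net_mapD(3)[OF f pq] net_map_ends_distinct[OF f pq]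
  show "closed_segment ((g \<circ> f) p) ((g \<circ> f) q) \<in> edges \<K>"
    using net_mapD(3)[OF g fpq] by simp
  show "\<forall>u\<in>{0..1}. (g \<circ> f) ((1 - u) *\<^sub>R p + u *\<^sub>R q) = (1 - u) *\<^sub>R (g \<circ> f) p + u *\<^sub>R (g \<circ> f) q"
    using net_mapD(4)[OF f pq] net_mapD(4)[OF g fpq] by simp
qed

text \<open>
  The midpoint of an edge of \<open>\<N>\<close> is the image of a point on some edge of \<open>\<M>\<close>. The image of that edge
  meets the given edge in an interior point, so by essential disjointness it is the given edge.
\<close>

lemma net_map_edge_surj:
  assumes f: "net_map f \<M> \<N>" and M: "proper_linear_3periodic_net \<M>" and N: "proper_linear_3periodic_net \<N>"
    and e: "closed_segment p' q' \<in> edges \<N>" "p' \<noteq> q'"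
  shows "\<exists>p q. p \<noteq> q \<and> closed_segment p q \<in> edges \<M> \<and> f p = p' \<and> f q = q'"
proof -
  let ?m = "midpoint p' q'"
  have "?m \<in> body \<N>" using e(1) by (intro edge_in_body[OF e(1)]) simp
  then obtain m where m: "m \<in> body \<M>" "f m = ?m"
    using bij_betw_imp_surj_on[OF net_mapD(1)[OF f]] by (metis imageE)
  then obtain s where s: "s \<in> edges \<M>" "m \<in> s" by (auto simp: body_def)
  then obtain p q where pq: "p \<noteq> q" "s = closed_segment p q" using edge_ends[OF M] by blast
  with s obtain u where u: "u \<in> {0..1}" "m = (1 - u) *\<^sub>R p + u *\<^sub>R q"
    by (auto simp: closed_segment_def)
  have e': "closed_segment (f p) (f q) \<in> edges \<N>" and "f m = (1 - u) *\<^sub>R f p + u *\<^sub>R f q"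
    using net_mapD(3,4)[OF f] pq s(1) u by simp_all
  then have m': "?m \<in> closed_segment (f p) (f q)" using u(1) m(2) by (auto simp: closed_segment_def)
  have "closed_segment (f p) (f q) = closed_segment p' q'"
  proof (rule ccontr)
    assume "closed_segment (f p) (f q) \<noteq> closed_segment p' q'"
    from edges_meet_in_endpoint[OF N e' e(1) this m'] have "is_endpoint ?m (closed_segment p' q')" by simp
    then show False using e(2) by (simp add: is_endpoint_closed_segment)
  qed
  then consider "f p = p'" "f q = q'" | "f p = q'" "f q = p'"
    by (auto simp: doubleton_eq_iff)
  then show ?thesis
  proof cases
    case 1
    with pq s(1) show ?thesis by (intro exI[of _ p] exI[of _ q]) simp
  next
    case 2
    with pq s(1) show ?thesis by (intro exI[of _ q] exI[of _ p]) (simp add: closed_segment_commute)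
  qed
qed

lemma net_map_inv:
  assumes f: "net_map f \<M> \<N>" and M: "proper_linear_3periodic_net \<M>" and N: "proper_linear_3periodic_net \<N>"
  shows "net_map (inv_into (body \<M>) f) \<N> \<M>"
proof -
  let ?g = "inv_into (body \<M>) f"
  have inj: "inj_on f (body \<M>)" by (rule bij_betw_imp_inj_on[OF net_mapD(1)[OF f]])
  have gf: "?g (f x) = x" if "x \<in> body \<M>" for x using inj that by (rule inv_into_f_f)
  have edge: "\<exists>p q. p \<noteq> q \<and> closed_segment p q \<in> edges \<M> \<and> f p = p' \<and> f q = q' \<and> ?g p' = p \<and> ?g q' = q"
    if e: "closed_segment p' q' \<in> edges \<N>" "p' \<noteq> q'" for p' q'
  proof -
    obtain p q where pq: "p \<noteq> q" "closed_segment p q \<in> edges \<M>" "f p = p'" "f q = q'"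
      using net_map_edge_surj[OF f M N e] by blast
    then have "p \<in> body \<M>" "q \<in> body \<M>" by (auto intro: edge_in_body)
    then have "?g p' = p" "?g q' = q" using gf pq(3,4) by auto
    with pq show ?thesis by blast
  qed
  show ?thesis unfolding net_map_def
  proof (intro conjI allI impI subsetI)
    show "bij_betw ?g (body \<N>) (body \<M>)"
      by (rule bij_betw_inv_into[OF net_mapD(1)[OF f]])
  next
    fix x assume "x \<in> ?g ` nodes \<N>"
    then obtain p' where p': "p' \<in> nodes \<N>" "x = ?g p'" by blast
    then obtain q' where "p' \<noteq> q'" "closed_segment p' q' \<in> edges \<N>" using node_in_edge[OF N] by blast
    then obtain p q where "p \<noteq> q" "closed_segment p q \<in> edges \<M>" "?g p' = p" using edge by blast
    then show "x \<in> nodes \<M>" using edge_end_node[OF M] p'(2) by blast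
  next
    fix p' q' assume e: "p' \<noteq> q' \<and> closed_segment p' q' \<in> edges \<N>"
    then obtain p q where pq: "p \<noteq> q" "closed_segment p q \<in> edges \<M>" "f p = p'" "f q = q'" "?g p' = p" "?g q' = q"
      using edge by blast
    then show "closed_segment (?g p') (?g q') \<in> edges \<M>" by simp
    show "\<forall>u\<in>{0..1}. ?g ((1 - u) *\<^sub>R p' + u *\<^sub>R q') = (1 - u) *\<^sub>R ?g p' + u *\<^sub>R ?g q'"
    proof
      fix u :: real assume u: "u \<in> {0..1}"
      let ?x = "(1 - u) *\<^sub>R p + u *\<^sub>R q"
      have "f ?x = (1 - u) *\<^sub>R p' + u *\<^sub>R q'"
        using net_mapD(4)[OF f pq(2,1) u] pq(3,4) by simp
      moreover have "?x \<in> body \<M>"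
        using u by (intro edge_in_body[OF pq(2)]) (auto simp: closed_segment_def)
      ultimately show "?g ((1 - u) *\<^sub>R p' + u *\<^sub>R q') = (1 - u) *\<^sub>R ?g p' + u *\<^sub>R ?g q'"
        using gf[of ?x] pq by simp
    qed
  qed
qed

text \<open>
  Run the isotopy backwards, precomposed with the inverse of its final map.
\<close>

lemma periodically_isotopic_sym:
  assumes iso: "periodically_isotopic \<N>0 \<N>1"
    and N0: "proper_linear_3periodic_net \<N>0" and N1: "proper_linear_3periodic_net \<N>1"
  shows "periodically_isotopic \<N>1 \<N>0"
proof -
  obtain \<N> a f where *: "\<N> 0 = \<N>0" "\<N> 1 = \<N>1"
    "\<And>t. t \<in> {0..1::real} \<Longrightarrow> proper_linear_3periodic_net (\<N> t) \<and> periodicity_basis (a t) (\<N> t) \<and>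
           det (a t) > 0 \<and> net_map (f t) \<N>0 (\<N> t)"
    "continuous_on {0..1} a" "\<And>x. x \<in> body \<N>0 \<Longrightarrow> f 0 x = x"
    "\<And>p. p \<in> nodes \<N>0 \<Longrightarrow> continuous_on {0..1} (\<lambda>t. f t p)"
    using iso unfolding periodically_isotopic_iff by metis
  let ?g = "inv_into (body \<N>0) (f 1)"
  have f1: "net_map (f 1) \<N>0 \<N>1" using *(2,3) by force
  have g: "net_map ?g \<N>1 \<N>0" by (rule net_map_inv[OF f1 N0 N1])
  show ?thesis unfolding periodically_isotopic_iff
  proof (intro exI conjI ballI)
    show "(\<lambda>t. \<N> (1 - t)) 0 = \<N>1" "(\<lambda>t. \<N> (1 - t)) 1 = \<N>0" using *(1,2) by simp_all
    fix t :: real assume t: "t \<in> {0..1}"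
    then have "1 - t \<in> {0..1}" by simp
    from *(3)[OF this] show "proper_linear_3periodic_net (\<N> (1 - t))"
      "periodicity_basis (a (1 - t)) (\<N> (1 - t))" "det (a (1 - t)) > 0" by simp_all
    show "net_map ((\<lambda>t. f (1 - t) \<circ> ?g) t) \<N>1 (\<N> (1 - t))"
      using *(3)[OF \<open>1 - t \<in> {0..1}\<close>] net_map_comp[OF g] by simp
  next
    show "continuous_on {0..1} (\<lambda>t. a (1 - t))"
      by (rule continuous_on_compose2[OF *(4)]) (auto intro!: continuous_intros)
  next
    fix x assume "x \<in> body \<N>1"
    then show "((\<lambda>t. f (1 - t) \<circ> ?g) 0) x = x"
      using f1 by (auto simp: net_map_def bij_betw_def f_inv_into_f)
  next
    fix p assume "p \<in> nodes \<N>1"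
    then have "?g p \<in> nodes \<N>0" using g by (auto simp: net_map_def)
    from *(6)[OF this] show "continuous_on {0..1} (\<lambda>t. (\<lambda>t. f (1 - t) \<circ> ?g) t p)"
      unfolding comp_def by (rule continuous_on_compose2) (auto intro!: continuous_intros)
  qed
qed

text \<open>
  The first isotopy ends with a basis \<open>a 1\<close> and the second starts with a basis \<open>b 0\<close> of the same
  net. If \<open>n b 0 = M a 1\<close> with an integer matrix \<open>M\<close>, then \<open>M a t\<close> and \<open>n b t\<close> are periodicity bases
  along the two isotopies and form a continuous path. They are right-handed because \<open>M\<close> has positive
  determinant, as both \<open>a 1\<close> and \<open>b 0\<close> have. Commensurability requires a node; without nodes all the
  nets are empty.
\<close>

lemma periodically_isotopic_trans:
  assumes iso: "periodically_isotopic \<N>0 \<N>1" "periodically_isotopic \<N>1 \<N>2"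
    and N0: "proper_linear_3periodic_net \<N>0" and N1: "proper_linear_3periodic_net \<N>1"
    and N2: "proper_linear_3periodic_net \<N>2"
  shows "periodically_isotopic \<N>0 \<N>2"
proof -
  obtain \<N> a f where *: "\<N> 0 = \<N>0" "\<N> 1 = \<N>1"
    "\<And>t. t \<in> {0..1::real} \<Longrightarrow> proper_linear_3periodic_net (\<N> t) \<and> periodicity_basis (a t) (\<N> t) \<and>
           det (a t) > 0 \<and> net_map (f t) \<N>0 (\<N> t)"
    "continuous_on {0..1} a" "\<And>x. x \<in> body \<N>0 \<Longrightarrow> f 0 x = x"
    "\<And>p. p \<in> nodes \<N>0 \<Longrightarrow> continuous_on {0..1} (\<lambda>t. f t p)"
    using iso(1) unfolding periodically_isotopic_iff by metis
  obtain \<M> b g where **: "\<M> 0 = \<N>1" "\<M> 1 = \<N>2"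
    "\<And>t. t \<in> {0..1::real} \<Longrightarrow> proper_linear_3periodic_net (\<M> t) \<and> periodicity_basis (b t) (\<M> t) \<and>
           det (b t) > 0 \<and> net_map (g t) \<N>1 (\<M> t)"
    "continuous_on {0..1} b" "\<And>x. x \<in> body \<N>1 \<Longrightarrow> g 0 x = x"
    "\<And>p. p \<in> nodes \<N>1 \<Longrightarrow> continuous_on {0..1} (\<lambda>t. g t p)"
    using iso(2) unfolding periodically_isotopic_iff by metis
  have f1: "net_map (f 1) \<N>0 \<N>1" and g1: "net_map (g 1) \<N>1 \<N>2" using * ** by force+
  show ?thesis
  proof (cases "nodes \<N>1 = {}")
    case True
    have empty: "\<M> = ({}, {})" if M: "proper_linear_3periodic_net \<M>" and e: "body \<M> = {}" for \<M>
    proof -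
      have "edges \<M> = {}"
      proof (rule ccontr)
        assume "edges \<M> \<noteq> {}"
        then obtain s where s: "s \<in> edges \<M>" by blast
        then have "s = {}" using e by (auto simp: body_def)
        then show False using edge_ends[OF M s] by auto
      qed
      moreover from this have "nodes \<M> = {}" using M by (auto simp: proper_linear_3periodic_net_def)
      ultimately show ?thesis by (simp add: prod_eq_iff)
    qed
    have "body \<N>1 = {}"
    proof (rule ccontr)
      assume "body \<N>1 \<noteq> {}"
      then obtain s where "s \<in> edges \<N>1" by (auto simp: body_def)
      then show False using edge_ends[OF N1] edge_end_node[OF N1] True by blast
    qed
    moreover from this have "body \<N>0 = {}" using f1 by (auto simp: net_map_def bij_betw_def)
    ultimately have "\<N>0 = \<N>1" using empty N0 N1 by metis
    with iso(2) show ?thesis by simp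
  next
    case False
    have a1: "periodicity_basis (a 1) \<N>1" "det (a 1) > 0" using *(2) *(3)[of 1] by auto
    have b0: "periodicity_basis (b 0) \<N>1" "det (b 0) > 0" using **(1) **(3)[of 0] by auto
    obtain n :: int and M where n: "n > 0" and M: "of_int n *\<^sub>R b 0 = of_int_mat M ** a 1"
      using commensurable_periodicity_bases[OF a1(1) b0(1) False] by blast
    have detn: "det (of_int_mat (mat n :: int^3^3)) > 0" using n by (simp add: det_of_int_mat_mat)
    have detM: "det (of_int_mat M) > 0"
    proof -
      have "det (of_int_mat M) * det (a 1) = det (of_int_mat (mat n :: int^3^3)) * det (b 0)"
        using M unfolding scaleR_eq_of_int_mat_mult by (metis det_mul)
      then show ?thesis using a1(2) b0(2) detn by (metis mult_pos_pos zero_less_mult_pos2)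
    qed
    define c where "c = (\<lambda>t. of_int_mat M ** a t) +++ (\<lambda>t. of_int n *\<^sub>R b t)"
    define \<K> where "\<K> t = (if t \<le> 1/2 then \<N> (2 * t) else \<M> (2 * t - 1))" for t
    define h where "h t = (if t \<le> 1/2 then f (2 * t) else g (2 * t - 1) \<circ> f 1)" for t
    show ?thesis unfolding periodically_isotopic_iff
    proof (intro exI conjI ballI)
      show "\<K> 0 = \<N>0" "\<K> 1 = \<N>2" using *(1) **(2) by (simp_all add: \<K>_def)
      fix t :: real assume t: "t \<in> {0..1}"
      have "proper_linear_3periodic_net (\<K> t) \<and> periodicity_basis (c t) (\<K> t) \<and> det (c t) > 0 \<and> net_map (h t) \<N>0 (\<K> t)"
      proof (cases "t \<le> 1/2")
        case True
        then have "2 * t \<in> {0..1}" using t by simp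
        from *(3)[OF this] show ?thesis using True detM
          by (auto simp: \<K>_def c_def h_def joinpaths_def det_mul intro!: periodicity_basis_sublattice)
      next
        case False
        then have "2 * t - 1 \<in> {0..1}" using t by simp
        from **(3)[OF this] show ?thesis using False detn
          by (auto simp: \<K>_def c_def h_def joinpaths_def det_mul scaleR_eq_of_int_mat_mult
              intro!: periodicity_basis_sublattice net_map_comp[OF f1])
      qed
      then show "proper_linear_3periodic_net (\<K> t)" "periodicity_basis (c t) (\<K> t)" "det (c t) > 0"
        "net_map (h t) \<N>0 (\<K> t)" by auto
    next
      have "path (\<lambda>t. of_int_mat M ** a t)" "path (\<lambda>t. of_int n *\<^sub>R b t)"
        using *(4) **(4) unfolding path_def matrix_matrix_mult_def
        by (auto intro!: continuous_intros)
      then have "path c" unfolding c_def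
        by (simp add: pathstart_def pathfinish_def M)
      then show "continuous_on {0..1} c" by (simp add: path_def)
    next
      fix x assume "x \<in> body \<N>0"
      then show "h 0 x = x" using *(5) by (simp add: h_def)
    next
      fix p assume p: "p \<in> nodes \<N>0"
      then have p1: "f 1 p \<in> nodes \<N>1" using f1 by (auto simp: net_map_def)
      then have "f 1 p \<in> body \<N>1"
        using node_in_edge[OF N1] edge_in_body ends_in_segment(1) by blast
      then have "g 0 (f 1 p) = f 1 p" by (rule **(5))
      with *(6)[OF p] **(6)[OF p1] have "path ((\<lambda>t. f t p) +++ (\<lambda>t. g t (f 1 p)))"
        by (simp add: path_def[symmetric] pathstart_def pathfinish_def)
      moreover have "(\<lambda>t. h t p) = (\<lambda>t. f t p) +++ (\<lambda>t. g t (f 1 p))"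
        by (auto simp: h_def joinpaths_def)
      ultimately show "continuous_on {0..1} (\<lambda>t. h t p)" by (simp only: path_def)
    qed
  qed
qed

lemma periodic_isotopy_class_eq:
  assumes "(\<N>, \<M>) \<in> periodic_isotopy"
  shows "periodic_isotopy `` {\<N>} = periodic_isotopy `` {\<M>}"
  using assms periodically_isotopic_sym periodically_isotopic_trans
  unfolding periodic_isotopy_def by blast

section \<open>Straight-line drawings of a graph\<close>

text \<open>
  A graph given by the two ends of its edges. A drawing assigns points to the vertices; the edges are
  drawn as segments. Periodic nets arise from an infinite graph whose vertices are pairs of a vertex
  of the quotient graph and a translation.
\<close>

locale drawn_graph =
  fixes G :: "'g set" and src dst :: "'g \<Rightarrow> 'w"
begin

definition ends :: "'g \<Rightarrow> 'w set" where
  "ends g = {src g, dst g}"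

definition seg :: "('w \<Rightarrow> real^3) \<Rightarrow> 'g \<Rightarrow> (real^3) set" where
  "seg X g = closed_segment (X (src g)) (X (dst g))"

definition point :: "('w \<Rightarrow> real^3) \<Rightarrow> 'g \<Rightarrow> real \<Rightarrow> real^3" where
  "point X g u = (1 - u) *\<^sub>R X (src g) + u *\<^sub>R X (dst g)"

definition net :: "('w \<Rightarrow> real^3) \<Rightarrow> net" where
  "net X = (X ` (\<Union>g\<in>G. ends g), seg X ` G)"

text \<open>
  Distinct edges meet only in images of vertices that they share in the abstract graph. This implies
  that the drawing is injective on the ends of edges, and that edges with the same two ends cannot
  occur.
\<close>

definition embedded :: "('w \<Rightarrow> real^3) \<Rightarrow> bool" where
  "embedded X \<longleftrightarrow> (\<forall>g\<in>G. X (src g) \<noteq> X (dst g)) \<and>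
     (\<forall>g\<in>G. \<forall>h\<in>G. g \<noteq> h \<longrightarrow> seg X g \<inter> seg X h \<subseteq> X ` (ends g \<inter> ends h))"

lemma embeddedD:
  assumes "embedded X"
  shows "g \<in> G \<Longrightarrow> X (src g) \<noteq> X (dst g)"
    "g \<in> G \<Longrightarrow> h \<in> G \<Longrightarrow> g \<noteq> h \<Longrightarrow> x \<in> seg X g \<Longrightarrow> x \<in> seg X h \<Longrightarrow> \<exists>v\<in>ends g \<inter> ends h. x = X v"
proof -
  show "g \<in> G \<Longrightarrow> X (src g) \<noteq> X (dst g)" using assms by (simp add: embedded_def)
  assume "g \<in> G" "h \<in> G" "g \<noteq> h" "x \<in> seg X g" "x \<in> seg X h"
  moreover from this have "seg X g \<inter> seg X h \<subseteq> X ` (ends g \<inter> ends h)"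
    using assms by (simp add: embedded_def)
  ultimately have "x \<in> X ` (ends g \<inter> ends h)" by blast
  then show "\<exists>v\<in>ends g \<inter> ends h. x = X v" by blast
qed

lemma seg_eq_points: "seg X g = point X g ` {0..1}"
  by (auto simp: seg_def point_def closed_segment_def)

lemma ends_in_seg: "v \<in> ends g \<Longrightarrow> X v \<in> seg X g"
  by (auto simp: ends_def seg_def)

lemma midpoint_on_seg:
  assumes X: "embedded X" and g: "g \<in> G" "h \<in> G"
    and m: "midpoint (X (src g)) (X (dst g)) \<in> seg X h"
  shows "g = h"
proof (rule ccontr)
  let ?m = "midpoint (X (src g)) (X (dst g))"
  assume "g \<noteq> h"
  moreover have "?m \<in> seg X g" by (simp add: seg_def)
  ultimately obtain v where "v \<in> ends g" "?m = X v"
    using embeddedD(2)[OF X g _ _ m] by blast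
  then show False using embeddedD(1)[OF X g(1)] by (auto simp: ends_def)
qed

lemma edges_net [simp]: "edges (net X) = seg X ` G"
  and nodes_net [simp]: "nodes (net X) = X ` (\<Union>g\<in>G. ends g)"
  by (simp_all add: net_def)

text \<open>
  Two common points of distinct edges would be the images of two shared vertices, so the edges would
  have the same ends and hence be the same segment.
\<close>

lemma net_essentially_disjoint:
  assumes X: "embedded X"
  shows "essentially_disjoint (edges (net X))"
  unfolding essentially_disjoint_def edges_net
proof (intro ballI impI)
  fix s s' assume "s \<in> seg X ` G" "s' \<in> seg X ` G" "s \<noteq> s'"
  then obtain g h where gh: "g \<in> G" "h \<in> G" "s = seg X g" "s' = seg X h" "g \<noteq> h" by blast
  show "s \<inter> s' = {} \<or> (\<exists>p. s \<inter> s' = {p} \<and> is_endpoint p s \<and> is_endpoint p s')"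
  proof (cases "s \<inter> s' = {}")
    case False
    then obtain x where x: "x \<in> s" "x \<in> s'" by blast
    then obtain v where v: "v \<in> ends g" "v \<in> ends h" "x = X v"
      using embeddedD(2)[OF X gh(1,2,5)] gh(3,4) by blast
    have "y = x" if y: "y \<in> s" "y \<in> s'" for y
    proof (rule ccontr)
      assume "y \<noteq> x"
      obtain w where w: "w \<in> ends g" "w \<in> ends h" "y = X w"
        using embeddedD(2)[OF X gh(1,2,5)] gh(3,4) y by blast
      with v \<open>y \<noteq> x\<close> have "{src g, dst g} = {src h, dst h}" by (auto simp: ends_def)
      then have "s = s'" by (auto simp: gh seg_def doubleton_eq_iff closed_segment_commute)
      with \<open>s \<noteq> s'\<close> show False by blast
    qed
    with x have "s \<inter> s' = {x}" by blast
    moreover have "is_endpoint x s" "is_endpoint x s'"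
      using v gh embeddedD(1)[OF X] by (auto simp: seg_def is_endpoint_closed_segment ends_def)
    ultimately show ?thesis by blast
  qed simp
qed

lemma net_proper:
  assumes X: "embedded X" and "countable G" and a: "periodicity_basis a (net X)"
  shows "proper_linear_3periodic_net (net X)"
  unfolding proper_linear_3periodic_net_def
proof (intro conjI)
  show "countable (edges (net X))" using assms(2) by simp
  show "\<forall>s\<in>edges (net X). \<exists>p q. p \<noteq> q \<and> s = closed_segment p q"
    using embeddedD(1)[OF X] by (fastforce simp: seg_def)
  show "essentially_disjoint (edges (net X))" by (rule net_essentially_disjoint[OF X])
  have "is_endpoint p (seg X g) \<longleftrightarrow> p \<in> X ` ends g" if "g \<in> G" for p g
    using embeddedD(1)[OF X that] by (auto simp: seg_def is_endpoint_closed_segment ends_def)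
  then show "nodes (net X) = {p. \<exists>s\<in>edges (net X). is_endpoint p s}" by auto
  show "\<exists>a. periodicity_basis a (net X)" using a by blast
qed

lemma body_net: "body (net X) = {point X g u | g u. g \<in> G \<and> u \<in> {0..1}}"
  unfolding body_def edges_net seg_eq_points by blast

lemma point_at_vertex:
  assumes X: "embedded X" and g: "g \<in> G" and v: "v \<in> ends g" and eq: "point X g u = X v"
  shows "point Y g u = Y v"
proof -
  have ne: "X (dst g) - X (src g) \<noteq> 0" using embeddedD(1)[OF X g] by simp
  consider "v = src g" | "v = dst g" using v by (auto simp: ends_def)
  then show ?thesis
  proof cases
    case 1
    then have "u *\<^sub>R (X (dst g) - X (src g)) = 0"
      using eq by (simp add: point_def algebra_simps)
    with ne have "u = 0" by simp
    then show ?thesis using 1 by (simp add: point_def)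
  next
    case 2
    have "(1 - u) *\<^sub>R (X (dst g) - X (src g)) = X (dst g) - point X g u"
      by (simp add: point_def algebra_simps)
    also have "\<dots> = 0" using eq 2 by simp
    finally have "(1 - u) *\<^sub>R (X (dst g) - X (src g)) = 0" .
    with ne have "u = 1" by simp
    then show ?thesis using 2 by (simp add: point_def)
  qed
qed

text \<open>
  Points of a drawing coincide only if they are the same point of the same edge or the same vertex of
  the graph, and this does not depend on the drawing. Therefore a map between the bodies of two
  embedded drawings of the same graph can be defined edge by edge.
\<close>

lemma point_eq_transfer:
  assumes X: "embedded X" and g: "g \<in> G" "h \<in> G" and u: "u \<in> {0..1}" "u' \<in> {0..1}"
    and eq: "point X g u = point X h u'"
  shows "point Y g u = point Y h u'"
proof (cases "g = h")
  case True
  have ne: "X (dst g) - X (src g) \<noteq> 0" using embeddedD(1)[OF X g(1)] by simp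
  have "(u - u') *\<^sub>R (X (dst g) - X (src g)) = 0"
    using eq True by (simp add: point_def algebra_simps)
  with ne have "u = u'" by simp
  with True show ?thesis by simp
next
  case False
  have "point X g u \<in> seg X g" unfolding seg_eq_points using u(1) by (rule imageI)
  moreover have "point X g u \<in> seg X h" unfolding eq seg_eq_points using u(2) by (rule imageI)
  ultimately obtain v where v: "v \<in> ends g" "v \<in> ends h" "point X g u = X v"
    using embeddedD(2)[OF X g False] by blast
  with eq have "point X h u' = X v" by simp
  from point_at_vertex[OF X g(2) v(2) this] point_at_vertex[OF X g(1) v(1,3)]
  show ?thesis by simp
qed

text \<open>
  The affine extension, along the edges, of the map that sends each vertex of the drawing \<open>X\<close> to its
  position in the drawing \<open>Y\<close>. By \<open>point_eq_transfer\<close> all representations \<open>(g, u)\<close> of a point of an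
  embedded drawing give the same value.
\<close>

definition redraw :: "('w \<Rightarrow> real^3) \<Rightarrow> ('w \<Rightarrow> real^3) \<Rightarrow> real^3 \<Rightarrow> real^3" where
  "redraw X Y x = (case SOME (g, u). g \<in> G \<and> u \<in> {0..1} \<and> x = point X g u of (g, u) \<Rightarrow> point Y g u)"

lemma redraw_point:
  assumes X: "embedded X" and g: "g \<in> G" and u: "u \<in> {0..1}"
  shows "redraw X Y (point X g u) = point Y g u"
proof -
  let ?P = "\<lambda>(h, u'). h \<in> G \<and> u' \<in> {0..1} \<and> point X g u = point X h u'"
  obtain h u' where hu: "(SOME p. ?P p) = (h, u')" by (cases "SOME p. ?P p")
  have "?P (g, u)" using g u by simp
  then have "?P (SOME p. ?P p)" by (rule someI)
  then have "?P (h, u')" unfolding hu .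
  then have "h \<in> G" "u' \<in> {0..1}" "point X g u = point X h u'" by simp_all
  from point_eq_transfer[OF X g this(1) u this(2,3), of Y] hu
  show ?thesis by (simp add: redraw_def)
qed

lemma redraw_vertex:
  assumes X: "embedded X" and g: "g \<in> G" and v: "v \<in> ends g"
  shows "redraw X Y (X v) = Y v"
proof -
  have "X v = point X g (if v = src g then 0 else 1)" using v by (auto simp: point_def ends_def)
  moreover have "Y v = point Y g (if v = src g then 0 else 1)" using v by (auto simp: point_def ends_def)
  ultimately show ?thesis using redraw_point[OF X g] by simp
qed

lemma redraw_self:
  assumes X: "embedded X" and x: "x \<in> body (net X)"
  shows "redraw X X x = x"
  using x redraw_point[OF X, of _ _ X] unfolding body_net by blast

lemma net_map_redraw:
  assumes X: "embedded X" and Y: "embedded Y"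
  shows "net_map (redraw X Y) (net X) (net Y)"
  unfolding net_map_def
proof (intro conjI allI impI)
  have XY: "redraw Y X (redraw X Y x) = x \<and> redraw X Y x \<in> body (net Y)"
    if X: "embedded X" and Y: "embedded Y" and x: "x \<in> body (net X)" for X Y x
  proof -
    obtain g u where gu: "g \<in> G" "u \<in> {0..1}" "x = point X g u" using x by (auto simp: body_net)
    then have "redraw X Y x = point Y g u" using redraw_point[OF X] by simp
    moreover have "redraw Y X (point Y g u) = x" using redraw_point[OF Y] gu by simp
    ultimately show ?thesis using gu(1,2) by (auto simp: body_net)
  qed
  show "bij_betw (redraw X Y) (body (net X)) (body (net Y))"
    using XY[OF X Y] XY[OF Y X] by (intro bij_betw_byWitness[of _ "redraw Y X"]) auto
  show "redraw X Y ` nodes (net X) \<subseteq> nodes (net Y)"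
    using redraw_vertex[OF X, of _ _ Y] by auto
next
  fix p q assume "p \<noteq> q \<and> closed_segment p q \<in> edges (net X)"
  then obtain g where g: "g \<in> G" "closed_segment p q = seg X g" by auto
  have ends: "redraw X Y (X (src g)) = Y (src g)" "redraw X Y (X (dst g)) = Y (dst g)"
    using redraw_vertex[OF X g(1), of _ Y] by (simp_all add: ends_def)
  have pt: "redraw X Y ((1 - u) *\<^sub>R X (src g) + u *\<^sub>R X (dst g)) = (1 - u) *\<^sub>R Y (src g) + u *\<^sub>R Y (dst g)"
    if "u \<in> {0..1}" for u
    using redraw_point[OF X g(1) that, of Y] by (simp add: point_def)
  consider "p = X (src g)" "q = X (dst g)" | "p = X (dst g)" "q = X (src g)"
    using g(2) by (auto simp: seg_def doubleton_eq_iff)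
  then show "closed_segment (redraw X Y p) (redraw X Y q) \<in> edges (net Y)"
    and "\<forall>u\<in>{0..1}. redraw X Y ((1 - u) *\<^sub>R p + u *\<^sub>R q) = (1 - u) *\<^sub>R redraw X Y p + u *\<^sub>R redraw X Y q"
  proof (atomize(full), cases)
    case 1
    have "closed_segment (Y (src g)) (Y (dst g)) \<in> seg Y ` G"
      using g(1) by (auto simp: seg_def)
    with pt show "closed_segment (redraw X Y p) (redraw X Y q) \<in> edges (net Y) \<and>
      (\<forall>u\<in>{0..1}. redraw X Y ((1 - u) *\<^sub>R p + u *\<^sub>R q) = (1 - u) *\<^sub>R redraw X Y p + u *\<^sub>R redraw X Y q)"
      unfolding 1 ends by simp
  next
    case 2
    have "closed_segment (Y (dst g)) (Y (src g)) \<in> seg Y ` G"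
      using g(1) by (auto simp: seg_def closed_segment_commute)
    moreover have "redraw X Y ((1 - u) *\<^sub>R X (dst g) + u *\<^sub>R X (src g)) = (1 - u) *\<^sub>R Y (dst g) + u *\<^sub>R Y (src g)"
      if "u \<in> {0..1}" for u
      using pt[of "1 - u"] that by (simp add: add.commute)
    ultimately show "closed_segment (redraw X Y p) (redraw X Y q) \<in> edges (net Y) \<and>
      (\<forall>u\<in>{0..1}. redraw X Y ((1 - u) *\<^sub>R p + u *\<^sub>R q) = (1 - u) *\<^sub>R redraw X Y p + u *\<^sub>R redraw X Y q)"
      unfolding 2 ends by simp
  qed
qed

lemma embedded_linear_image:
  assumes f: "linear f" "inj f"
  shows "embedded (\<lambda>w. f (X w)) \<longleftrightarrow> embedded X"
proof -
  have seg: "seg (\<lambda>w. f (X w)) g = f ` seg X g" for g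
    by (simp add: seg_def closed_segment_linear_image[OF f(1)])
  have "(\<lambda>w. f (X w)) ` A = f ` (X ` A)" for A by (simp add: image_image)
  then have "seg (\<lambda>w. f (X w)) g \<inter> seg (\<lambda>w. f (X w)) h \<subseteq> (\<lambda>w. f (X w)) ` A \<longleftrightarrow>
      seg X g \<inter> seg X h \<subseteq> X ` A" for g h A
    unfolding seg image_Int[OF f(2), symmetric] by (simp add: inj_image_subset_iff[OF f(2)])
  then show ?thesis using f(2) by (simp add: embedded_def inj_eq)
qed

end

section \<open>Periodic drawings of a labelled graph\<close>

lemma continuous_nonzero_sgn:
  fixes f :: "real \<Rightarrow> real"
  assumes f: "continuous_on {0..1} f" "\<And>t. t \<in> {0..1} \<Longrightarrow> f t \<noteq> 0" and t: "t \<in> {0..1}"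
  shows "sgn (f t) = sgn (f 0)"
proof (rule ccontr)
  assume ne: "sgn (f t) \<noteq> sgn (f 0)"
  have conn: "connected (f ` {0..1})" by (rule connected_continuous_image[OF f(1)]) simp
  have mem: "f t \<in> f ` {0..1}" "f 0 \<in> f ` {0..1}" using t by auto
  have "{f t..f 0} \<subseteq> f ` {0..1}" "{f 0..f t} \<subseteq> f ` {0..1}"
    using connected_contains_Icc[OF conn mem] connected_contains_Icc[OF conn mem(2,1)] by auto
  moreover have "f t < 0 \<and> 0 < f 0 \<or> f 0 < 0 \<and> 0 < f t"
    using ne f(2)[OF t] f(2)[of 0] by (auto simp: sgn_if split: if_splits)
  ultimately have "0 \<in> f ` {0..1}" by force
  with f(2) show False by auto
qed

text \<open>
  The periodic cover of the labelled graph has an edge from \<open>(tl e, lam e + k)\<close> to \<open>(hd e, k)\<close> for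
  every arc \<open>e\<close> and every translation \<open>k\<close>: the difference of the two translations is the label.
\<close>

locale labelled_graph =
  fixes E :: "'e set" and tl hd :: "'e \<Rightarrow> 'v" and lam :: "'e \<Rightarrow> int^3"
  assumes finite_E: "finite E"
begin

sublocale drawn_graph "E \<times> UNIV" "\<lambda>(e, k). (tl e, lam e + k)" "\<lambda>(e, k). (hd e, k)" .

definition placement :: "real^3^3 \<Rightarrow> ('v \<Rightarrow> real^3) \<Rightarrow> 'v \<times> (int^3) \<Rightarrow> real^3" where
  "placement a y = (\<lambda>(v, k). (y v + of_int_vec k) v* a)"

text \<open>
  Embeddedness in coordinates, that is, with the standard basis for the lattice.
\<close>

definition admissible :: "('v \<Rightarrow> real^3) \<Rightarrow> bool" where
  "admissible y \<longleftrightarrow> embedded (placement (mat 1) y)"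

lemma embedded_placement:
  assumes "det a \<noteq> 0"
  shows "embedded (placement a y) \<longleftrightarrow> admissible y"
proof -
  obtain a' where a': "a ** a' = mat 1"
    using assms by (metis invertible_det_nz invertible_right_inverse)
  have "linear (\<lambda>x. x v* a)"
    by (rule linearI) (simp_all add: algebra_simps scaleR_vector_matrix_assoc)
  moreover have "inj (\<lambda>x. x v* a)"
  proof (rule injI)
    fix x y assume "x v* a = y v* a"
    then have "(x v* a) v* a' = (y v* a) v* a'" by simp
    then show "x = y" by (simp add: vector_matrix_mul_assoc a')
  qed
  moreover have "placement a y = (\<lambda>w. placement (mat 1) y w v* a)"
    by (auto simp: placement_def)
  ultimately show ?thesis
    using embedded_linear_image[of "\<lambda>x. x v* a" "placement (mat 1) y"] by (simp add: admissible_def)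
qed

lemma translate_placement: "translate a k (placement a y (v, l)) = placement a y (v, k + l)"
  by (simp add: translate_eq placement_def of_int_vec_add algebra_simps)

lemma translate_seg: "translate a k ` seg (placement a y) (e, l) = seg (placement a y) (e, k + l)"
  by (simp add: seg_def translate_closed_segment translate_placement add.left_commute)

lemma vertices_eq: "(\<Union>g\<in>E \<times> UNIV. ends g) = (tl ` E \<union> hd ` E) \<times> UNIV"
proof -
  have "(tl e, k) \<in> ends (e, k - lam e)" "(hd e, k) \<in> ends (e, k)" for e k
    by (simp_all add: ends_def)
  then have "(tl ` E \<union> hd ` E) \<times> UNIV \<subseteq> (\<Union>g\<in>E \<times> UNIV. ends g)" by blast
  moreover have "(\<Union>g\<in>E \<times> UNIV. ends g) \<subseteq> (tl ` E \<union> hd ` E) \<times> UNIV"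
    by (auto simp: ends_def)
  ultimately show ?thesis by blast
qed

lemma net_periodicity_basis:
  assumes "det a \<noteq> 0"
  shows "periodicity_basis a (net (placement a y))"
  unfolding periodicity_basis_def
proof (intro conjI allI)
  let ?X = "placement a y"
  let ?V = "tl ` E \<union> hd ` E"
  show "basis3 a" using assms by (simp add: basis3_iff_det)
  have nodes: "nodes (net ?X) = ?X ` (?V \<times> UNIV)" by (simp add: vertices_eq)
  fix k
  have "translate a k ` nodes (net ?X) \<subseteq> nodes (net ?X)" for k
    unfolding nodes by (auto simp: translate_placement)
  moreover have "nodes (net ?X) \<subseteq> translate a k ` nodes (net ?X)"
  proof
    fix p assume "p \<in> nodes (net ?X)"
    then obtain v l where v: "v \<in> ?V" "p = ?X (v, l)" unfolding nodes by blast
    then have "p = translate a k (?X (v, l - k))" by (simp add: translate_placement)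
    then show "p \<in> translate a k ` nodes (net ?X)" unfolding nodes using v(1) by blast
  qed
  ultimately show "translate a k ` nodes (net ?X) = nodes (net ?X)" by blast
  show "(\<lambda>s. translate a k ` s) ` edges (net ?X) = edges (net ?X)"
  proof -
    have "(\<lambda>s. translate a k ` s) ` edges (net ?X) \<subseteq> edges (net ?X)"
      by (auto simp: translate_seg)
    moreover have "edges (net ?X) \<subseteq> (\<lambda>s. translate a k ` s) ` edges (net ?X)"
    proof
      fix s assume "s \<in> edges (net ?X)"
      then obtain e l where e: "e \<in> E" "s = seg ?X (e, l)" by auto
      then have "s = translate a k ` seg ?X (e, l - k)" by (simp add: translate_seg)
      then show "s \<in> (\<lambda>s. translate a k ` s) ` edges (net ?X)" using e(1) by auto
    qed
    ultimately show ?thesis by blast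
  qed
next
  let ?X = "placement a y"
  let ?V = "tl ` E \<union> hd ` E"
  have "node_orbit a ` nodes (net ?X) \<subseteq> (\<lambda>v. node_orbit a (?X (v, 0))) ` ?V"
  proof
    fix s assume "s \<in> node_orbit a ` nodes (net ?X)"
    then obtain v k where v: "v \<in> ?V" "s = node_orbit a (?X (v, k))"
      by (auto simp: vertices_eq)
    have "?X (v, k) = translate a k (?X (v, 0))" by (simp add: translate_placement)
    with v show "s \<in> (\<lambda>v. node_orbit a (?X (v, 0))) ` ?V" by (simp add: node_orbit_translate)
  qed
  then show "finite (node_orbit a ` nodes (net ?X))" by (rule finite_surj[rotated]) (simp add: finite_E)
  have "edge_orbit a ` edges (net ?X) \<subseteq> (\<lambda>e. edge_orbit a (seg ?X (e, 0))) ` E"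
  proof
    fix s assume "s \<in> edge_orbit a ` edges (net ?X)"
    then obtain g where "g \<in> E \<times> UNIV" "s = edge_orbit a (seg ?X g)" unfolding edges_net by blast
    then obtain e k where e: "e \<in> E" "s = edge_orbit a (seg ?X (e, k))" by blast
    have "seg ?X (e, k) = translate a k ` seg ?X (e, 0)" by (simp add: translate_seg)
    with e show "s \<in> (\<lambda>e. edge_orbit a (seg ?X (e, 0))) ` E" by (simp add: edge_orbit_translate)
  qed
  then show "finite (edge_orbit a ` edges (net ?X))" by (rule finite_surj[rotated]) (simp add: finite_E)
qed

lemma countable_edges: "countable (E \<times> (UNIV :: (int^3) set))"
proof -
  have "inj (\<lambda>k :: int^3. (k $ 1, k $ 2, k $ 3))"
    by (rule injI) (simp add: vec_eq_iff forall_3)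
  then have "countable (UNIV :: (int^3) set)"
    by (metis countableI_type countable_image_inj_eq)
  with finite_E show ?thesis by (simp add: uncountable_infinite countable_finite)
qed

lemma net_placement_proper:
  assumes "det a \<noteq> 0" "admissible y"
  shows "proper_linear_3periodic_net (net (placement a y))"
  using assms net_proper[OF _ countable_edges net_periodicity_basis] by (simp add: embedded_placement)

text \<open>
  The determinant does not change sign along the path of bases. Where it is negative, the negated
  basis is right-handed and generates the same lattice, so it serves as the periodicity basis of the
  isotopy.
\<close>

lemma periodically_isotopic_of_paths:
  assumes "path_component {a. det a \<noteq> 0} a0 a1" and "path_component {y. admissible y} y0 y1"
  shows "periodically_isotopic (net (placement a0 y0)) (net (placement a1 y1))"
proof -
  obtain \<alpha> where \<alpha>: "continuous_on {0..1} \<alpha>" "\<And>t. t \<in> {0..1::real} \<Longrightarrow> det (\<alpha> t) \<noteq> 0" "\<alpha> 0 = a0" "\<alpha> 1 = a1"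
    using assms(1) unfolding path_component_def path_def path_image_def pathstart_def pathfinish_def by blast
  obtain \<eta> where \<eta>: "continuous_on {0..1} \<eta>" "\<And>t. t \<in> {0..1::real} \<Longrightarrow> admissible (\<eta> t)" "\<eta> 0 = y0" "\<eta> 1 = y1"
    using assms(2) unfolding path_component_def path_def path_image_def pathstart_def pathfinish_def by blast
  define X where "X t = placement (\<alpha> t) (\<eta> t)" for t
  have X: "embedded (X t)" if "t \<in> {0..1}" for t
    using \<alpha>(2) \<eta>(2) that by (simp add: X_def embedded_placement)
  have X0: "embedded (X 0)" using X by simp
  \<comment> \<open>\<open>s\<close> is the sign that makes the bases right-handed.\<close>
  define s :: int where "s = (if det a0 > 0 then 1 else - 1)"
  have det: "of_int s * det (\<alpha> t) > 0" if t: "t \<in> {0..1}" for t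
  proof -
    have "continuous_on {0..1} (\<lambda>t. det (\<alpha> t))"
      unfolding det_3 by (intro continuous_intros \<alpha>(1))
    from continuous_nonzero_sgn[OF this \<alpha>(2) t] have "sgn (det (\<alpha> t)) = sgn (det a0)"
      by (simp add: \<alpha>(3))
    then show ?thesis using \<alpha>(2)[OF t] by (auto simp: s_def sgn_if split: if_splits)
  qed
  have s3: "s ^ 3 = s" "s \<noteq> 0" by (auto simp: s_def)
  show ?thesis unfolding periodically_isotopic_iff
  proof (intro exI conjI ballI)
    show "(\<lambda>t. net (X t)) 0 = net (placement a0 y0)" "(\<lambda>t. net (X t)) 1 = net (placement a1 y1)"
      by (simp_all add: X_def \<alpha> \<eta>)
    fix t :: real assume t: "t \<in> {0..1}"
    show "proper_linear_3periodic_net (net (X t))"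
      unfolding X_def by (intro net_placement_proper \<alpha>(2) \<eta>(2) t)
    have dets: "det (of_int_mat (mat s :: int^3^3)) = of_int s"
      unfolding det_of_int_mat_mat using s3 by (metis of_int_power)
    show "periodicity_basis (of_int s *\<^sub>R \<alpha> t) (net (X t))"
      unfolding scaleR_eq_of_int_mat_mult X_def
      by (intro periodicity_basis_sublattice net_periodicity_basis \<alpha>(2) t) (simp add: dets s3)
    show "det (of_int s *\<^sub>R \<alpha> t) > 0"
      unfolding scaleR_eq_of_int_mat_mult det_mul dets by (rule det[OF t])
    show "net_map (redraw (X 0) (X t)) (net (placement a0 y0)) (net (X t))"
      using net_map_redraw[OF X0 X[OF t]] by (simp add: X_def \<alpha> \<eta>)
  next
    show "continuous_on {0..1} (\<lambda>t. of_int s *\<^sub>R \<alpha> t)" by (intro continuous_intros \<alpha>(1))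
  next
    fix x assume "x \<in> body (net (placement a0 y0))"
    then show "redraw (X 0) (X 0) x = x" using redraw_self[OF X0] by (simp add: X_def \<alpha> \<eta>)
  next
    fix p assume "p \<in> nodes (net (placement a0 y0))"
    then obtain g v k where g: "g \<in> E \<times> UNIV" "(v, k) \<in> ends g" "p = X 0 (v, k)"
      by (fastforce simp: X_def \<alpha> \<eta>)
    have "redraw (X 0) (X t) p = X t (v, k)" for t
      unfolding g(3) by (rule redraw_vertex[OF X0 g(1,2)])
    moreover have "continuous_on {0..1} (\<lambda>t. X t (v, k))"
      unfolding X_def placement_def vector_matrix_mult_def
      using continuous_on_product_then_coordinatewise[OF \<eta>(1), of v] \<alpha>(1)
      by (auto intro!: continuous_intros)
    ultimately show "continuous_on {0..1} (\<lambda>t. redraw (X 0) (X t) p)" by simp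
  qed
qed

end

section \<open>Crossing segments\<close>

text \<open>
  The segments from \<open>P\<close> to \<open>Q\<close> and from \<open>R\<close> to \<open>S\<close> have a common point, whose parameter on the
  first segment is not \<open>0\<close> if \<open>\<alpha>\<close> holds and not \<open>1\<close> if \<open>\<beta>\<close> holds. The flags record which ends of the first edge also belong to the second
  edge, where a common point is allowed.
\<close>

definition crossing :: "bool \<Rightarrow> bool \<Rightarrow> 'a::real_inner \<Rightarrow> 'a \<Rightarrow> 'a \<Rightarrow> 'a \<Rightarrow> bool" where
  "crossing \<alpha> \<beta> P Q R S \<longleftrightarrow> (\<exists>s\<in>{0..1}. \<exists>t\<in>{0..1}.
     P + s *\<^sub>R (Q - P) = R + t *\<^sub>R (S - R) \<and> \<not> (s = 0 \<and> \<alpha>) \<and> \<not> (s = 1 \<and> \<beta>))"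

text \<open>
  Put \<open>d = Q - P\<close>, \<open>e = S - R\<close>, \<open>c = R - P\<close>, so that a common point means \<open>s d - t e = c\<close> with
  \<open>s, t \<in> [0, 1]\<close>. Taking inner products with \<open>d\<close> and \<open>e\<close> gives a linear system for \<open>s\<close> and \<open>t\<close> with Gram
  determinant \<open>D\<close>, whose solution by Cramer's rule is \<open>s = m / D\<close>, \<open>t = n / D\<close>; it solves the original
  equation if and only if \<open>v = 0\<close>. If \<open>D = 0\<close> the segments are parallel, \<open>w = 0\<close> means that they lie on
  the same line, and \<open>f / A\<close>, \<open>(f + B) / A\<close> are the positions of \<open>R\<close> and \<open>S\<close> on it, with \<open>P\<close> at \<open>0\<close> and \<open>Q\<close>
  at \<open>1\<close>.
\<close>

definition probes :: "('a::real_inner \<Rightarrow> 'a \<Rightarrow> 'a \<Rightarrow> 'a \<Rightarrow> real) list" where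
  "probes = 
    (let A = \<lambda>P Q R S. (Q - P) \<bullet> (Q - P); B = \<lambda>P Q R S. (Q - P) \<bullet> (S - R); C = \<lambda>P Q R S. (S - R) \<bullet> (S - R);
         f = \<lambda>P Q R S. (R - P) \<bullet> (Q - P); g = \<lambda>P Q R S. (R - P) \<bullet> (S - R);
         D = \<lambda>P Q R S. A P Q R S * C P Q R S - B P Q R S * B P Q R S;
         m = \<lambda>P Q R S. f P Q R S * C P Q R S - g P Q R S * B P Q R S;
         n = \<lambda>P Q R S. f P Q R S * B P Q R S - g P Q R S * A P Q R S;
         v = \<lambda>P Q R S. D P Q R S *\<^sub>R (R - P) - m P Q R S *\<^sub>R (Q - P) + n P Q R S *\<^sub>R (S - R);
         w = \<lambda>P Q R S. A P Q R S *\<^sub>R (R - P) - f P Q R S *\<^sub>R (Q - P)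
     in [A, C, D, m, \<lambda>P Q R S. m P Q R S - D P Q R S, n, \<lambda>P Q R S. n P Q R S - D P Q R S,
         \<lambda>P Q R S. v P Q R S \<bullet> v P Q R S, \<lambda>P Q R S. w P Q R S \<bullet> w P Q R S,
         f, \<lambda>P Q R S. f P Q R S - A P Q R S,
         \<lambda>P Q R S. f P Q R S + B P Q R S, \<lambda>P Q R S. f P Q R S + B P Q R S - A P Q R S])"

lemma sgn_eqD:
  fixes x y :: real
  assumes "sgn x = sgn y"
  shows "x > 0 \<longleftrightarrow> y > 0" "x < 0 \<longleftrightarrow> y < 0" "x = 0 \<longleftrightarrow> y = 0" "x \<ge> 0 \<longleftrightarrow> y \<ge> 0" "x \<le> 0 \<longleftrightarrow> y \<le> 0"
  using assms by (auto simp: sgn_if split: if_splits)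

text \<open>
  The case of segments on a common line. If an interval with distinct ends meets \<open>[0, 1]\<close>,
  then it contains interior points of \<open>[0, 1]\<close>, or it meets \<open>[0, 1]\<close> only in \<open>1\<close> or only in \<open>0\<close>. The
  comparison of its ends with \<open>0\<close> and \<open>1\<close> decides which case occurs.
\<close>

lemma interval_crossing_cong:
  fixes r q r' q' :: real
  assumes ne: "r \<noteq> q" "r' \<noteq> q'"
    and sg: "sgn r = sgn r'" "sgn (r - 1) = sgn (r' - 1)" "sgn q = sgn q'" "sgn (q - 1) = sgn (q' - 1)"
    and st: "s \<in> {0..1}" "t \<in> {0..1}" "s = (1 - t) * r + t * q" "\<not> (s = 0 \<and> \<alpha>)" "\<not> (s = 1 \<and> \<beta>)"
  shows "\<exists>s\<in>{0..1}. \<exists>t\<in>{0..1}. s = (1 - t) * r' + t * q' \<and> \<not> (s = 0 \<and> \<alpha>) \<and> \<not> (s = 1 \<and> \<beta>)"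
proof -
  have between: "\<exists>t\<in>{0..1}. x = (1 - t) * r' + t * q'" if "min r' q' \<le> x" "x \<le> max r' q'" for x
  proof -
    have "x \<in> closed_segment r' q'" using that by (auto simp: closed_segment_eq_real_ivl min_def max_def split: if_splits)
    then show ?thesis by (auto simp: closed_segment_def)
  qed
  have "s \<in> closed_segment r q" using st by (auto simp: closed_segment_def)
  then have s: "min r q \<le> s" "s \<le> max r q"
    by (auto simp: closed_segment_eq_real_ivl min_def max_def split: if_splits)
  have sgs: "r < 1 \<longleftrightarrow> r' < 1" "q < 1 \<longleftrightarrow> q' < 1" "r > 0 \<longleftrightarrow> r' > 0" "q > 0 \<longleftrightarrow> q' > 0"
    "r = 0 \<longleftrightarrow> r' = 0" "q = 0 \<longleftrightarrow> q' = 0" "r = 1 \<longleftrightarrow> r' = 1" "q = 1 \<longleftrightarrow> q' = 1"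
    using sgn_eqD[OF sg(1)] sgn_eqD[OF sg(2)] sgn_eqD[OF sg(3)] sgn_eqD[OF sg(4)] by simp_all
  consider "min r q < 1" "max r q > 0" | "min r q \<ge> 1" | "max r q \<le> 0" by linarith
  then show ?thesis
  proof cases
    case 1
    then have 1: "min r' q' < 1" "max r' q' > 0" using sgs by (auto simp: min_less_iff_disj less_max_iff_disj)
    define lo hi where "lo = min r' q'" "hi = max r' q'"
    have "lo < hi" using ne(2) by (auto simp: lo_hi_def min_def max_def)
    \<comment> \<open>The midpoint of the intersection of \<open>(lo, hi)\<close> and \<open>(0, 1)\<close>.\<close>
    define x where "x = (max lo 0 + min hi 1) / 2"
    have x: "lo \<le> x" "x \<le> hi" "0 < x" "x < 1"
      using 1 \<open>lo < hi\<close> unfolding lo_hi_def[symmetric] x_def by (auto simp: max_def min_def)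
    obtain t where "t \<in> {0..1}" "x = (1 - t) * r' + t * q'"
      using between[OF x(1,2)[unfolded lo_hi_def]] by blast
    with x(3,4) show ?thesis by (intro bexI[of _ x] bexI[of _ t]) auto
  next
    case 2
    with s st(1) have "s = 1" "min r q = 1" by auto
    with st(5) ne(1) sgs have "\<not> \<beta>" "min r' q' = 1" by (auto simp: min_def split: if_splits)
    moreover from this have "min r' q' \<le> 1" "1 \<le> max r' q'" by (auto simp: min_def max_def)
    then obtain t where "t \<in> {0..1}" "1 = (1 - t) * r' + t * q'" using between by blast
    ultimately show ?thesis by (intro bexI[of _ 1] bexI[of _ t]) auto
  next
    case 3
    with s st(1) have "s = 0" "max r q = 0" by auto
    with st(4) ne(1) sgs have "\<not> \<alpha>" "max r' q' = 0" by (auto simp: max_def split: if_splits)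
    moreover from this have "min r' q' \<le> 0" "0 \<le> max r' q'" by (auto simp: min_def max_def)
    then obtain t where "t \<in> {0..1}" "0 = (1 - t) * r' + t * q'" using between by blast
    ultimately show ?thesis by (intro bexI[of _ 0] bexI[of _ t]) auto
  qed
qed

text \<open>
  In the primed configuration the parameters computed from the probes, as ratios, satisfy the same
  equations and inequalities as those of the given crossing.
\<close>

lemma crossing_cong:
  fixes P Q R S P' Q' R' S' :: "'a::real_inner"
  assumes ne: "P \<noteq> Q" "R \<noteq> S"
    and sg: "\<And>p. p \<in> set probes \<Longrightarrow> sgn (p P Q R S) = sgn (p P' Q' R' S')"
    and cr: "crossing \<alpha> \<beta> P Q R S"
  shows "crossing \<alpha> \<beta> P' Q' R' S'"
proof -
  define d e c where dec: "d = Q - P" "e = S - R" "c = R - P"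
  define d' e' c' where dec': "d' = Q' - P'" "e' = S' - R'" "c' = R' - P'"
  define A B C f g where AB: "A = d \<bullet> d" "B = d \<bullet> e" "C = e \<bullet> e" "f = c \<bullet> d" "g = c \<bullet> e"
  define A' B' C' f' g' where AB': "A' = d' \<bullet> d'" "B' = d' \<bullet> e'" "C' = e' \<bullet> e'" "f' = c' \<bullet> d'" "g' = c' \<bullet> e'"
  define D m n where Dmn: "D = A * C - B * B" "m = f * C - g * B" "n = f * B - g * A"
  define D' m' n' where Dmn': "D' = A' * C' - B' * B'" "m' = f' * C' - g' * B'" "n' = f' * B' - g' * A'"
  define v w where vw: "v = D *\<^sub>R c - m *\<^sub>R d + n *\<^sub>R e" "w = A *\<^sub>R c - f *\<^sub>R d"
  define v' w' where vw': "v' = D' *\<^sub>R c' - m' *\<^sub>R d' + n' *\<^sub>R e'" "w' = A' *\<^sub>R c' - f' *\<^sub>R d'"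
  have sgns: "sgn A = sgn A'" "sgn C = sgn C'" "sgn D = sgn D'" "sgn m = sgn m'" "sgn (m - D) = sgn (m' - D')"
    "sgn n = sgn n'" "sgn (n - D) = sgn (n' - D')" "sgn (v \<bullet> v) = sgn (v' \<bullet> v')" "sgn (w \<bullet> w) = sgn (w' \<bullet> w')"
    "sgn f = sgn f'" "sgn (f - A) = sgn (f' - A')" "sgn (f + B) = sgn (f' + B')" "sgn (f + B - A) = sgn (f' + B' - A')"
    unfolding vw vw' Dmn Dmn' AB AB' dec dec'
    by (rule sg[unfolded probes_def Let_def, simplified]; simp)+
  have A: "A > 0" "C > 0" using ne by (simp_all add: AB dec)
  then have A': "A' > 0" "C' > 0" using sgns(1,2) by (simp_all add: sgn_1_pos)
  obtain s t where st: "s \<in> {0..1}" "t \<in> {0..1}" "P + s *\<^sub>R d = R + t *\<^sub>R e"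
    and al: "\<not> (s = 0 \<and> \<alpha>)" "\<not> (s = 1 \<and> \<beta>)"
    using cr unfolding crossing_def dec by blast
  have c: "c = s *\<^sub>R d - t *\<^sub>R e" using st(3) by (simp add: dec algebra_simps)
  have "\<exists>s\<in>{0..1}. \<exists>t\<in>{0..1}. c' = s *\<^sub>R d' - t *\<^sub>R e' \<and> \<not> (s = 0 \<and> \<alpha>) \<and> \<not> (s = 1 \<and> \<beta>)"
  proof (cases "D = 0")
    case False
    have "D \<ge> 0" using Cauchy_Schwarz_ineq[of d e] by (simp add: Dmn AB power2_eq_square)
    with False have D: "D > 0" by simp
    then have D': "D' > 0" using sgns(3) by (simp add: sgn_1_pos)
    have f: "f = s * A - t * B" and g: "g = s * B - t * C"
      by (simp_all add: AB c inner_diff_left inner_commute[of e d])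
    have m: "m = s * D" and n: "n = t * D"
      unfolding Dmn f g by (simp_all add: algebra_simps)
    have "v = 0" unfolding vw m n c by (simp add: algebra_simps)
    then have "v' = 0" using sgns(8) by (simp add: sgn_0_0)
    then have "D' *\<^sub>R c' = m' *\<^sub>R d' - n' *\<^sub>R e'" unfolding vw' by (simp add: algebra_simps)
    then have "(1 / D') *\<^sub>R (D' *\<^sub>R c') = (1 / D') *\<^sub>R (m' *\<^sub>R d' - n' *\<^sub>R e')" by simp
    then have c': "c' = (m' / D') *\<^sub>R d' - (n' / D') *\<^sub>R e'" using D' by (simp add: scaleR_diff_right)
    have "m \<ge> 0" "m - D \<le> 0" "n \<ge> 0" "n - D \<le> 0"
      using st(1,2) D by (simp_all add: m n mult_left_le_one_le)
    then have "m' \<ge> 0" "m' - D' \<le> 0" "n' \<ge> 0" "n' - D' \<le> 0"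
      using sgn_eqD(4)[OF sgns(4)] sgn_eqD(5)[OF sgns(5)] sgn_eqD(4)[OF sgns(6)] sgn_eqD(5)[OF sgns(7)]
      by simp_all
    then have "m' / D' \<in> {0..1}" "n' / D' \<in> {0..1}" using D' by simp_all
    moreover have "m' / D' = 0 \<longleftrightarrow> s = 0"
    proof -
      have "m' = 0 \<longleftrightarrow> m = 0" using sgns(4) by (metis sgn_0_0)
      then show ?thesis using D D' by (simp add: m)
    qed
    moreover have "m' / D' = 1 \<longleftrightarrow> s = 1"
    proof -
      have "m' - D' = 0 \<longleftrightarrow> m - D = 0" using sgns(5) by (metis sgn_0_0)
      then show ?thesis using D D' by (auto simp: m)
    qed
    ultimately show ?thesis using c' al
      by (intro bexI[of _ "m' / D'"] bexI[of _ "n' / D'"]) auto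
  next
    case True
    then have "D' = 0" using sgns(3) by (simp add: sgn_0_0)
    have par: "y = (x \<bullet> y / (x \<bullet> x)) *\<^sub>R x" if "(x \<bullet> x) * (y \<bullet> y) - (x \<bullet> y) * (x \<bullet> y) = 0" "x \<bullet> x > 0" for x y :: 'a
    proof -
      let ?z = "(x \<bullet> x) *\<^sub>R y - (x \<bullet> y) *\<^sub>R x"
      have "?z \<bullet> ?z = (x \<bullet> x) * ((x \<bullet> x) * (y \<bullet> y) - (x \<bullet> y) * (x \<bullet> y))"
        by (simp add: inner_diff_left inner_diff_right inner_commute[of y x] algebra_simps)
      then have "?z = 0" using that(1) by simp
      then have "(1 / (x \<bullet> x)) *\<^sub>R ((x \<bullet> x) *\<^sub>R y) = (1 / (x \<bullet> x)) *\<^sub>R ((x \<bullet> y) *\<^sub>R x)" by simp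
      then show ?thesis using that(2) by simp
    qed
    have e: "e = (B / A) *\<^sub>R d" using par[of d e] True A by (simp add: Dmn AB)
    have e': "e' = (B' / A') *\<^sub>R d'" using par[of d' e'] \<open>D' = 0\<close> A' by (simp add: Dmn' AB')
    have B: "B / A \<noteq> 0"
    proof
      assume "B / A = 0"
      then have "e = 0" using e by simp
      with ne(2) show False by (simp add: dec)
    qed
    have B': "B' / A' \<noteq> 0"
    proof
      assume "B' / A' = 0"
      then have "e' = 0" using e' by simp
      with A'(2) show False by (simp add: AB')
    qed
    have c1: "c = (s - t * (B / A)) *\<^sub>R d" using c by (subst (asm) e) (simp add: algebra_simps)
    have f: "f / A = s - t * (B / A)" using A(1) unfolding AB(4) c1 by (simp add: AB)
    have "w = 0" unfolding vw AB(4) c1 by (simp add: AB algebra_simps)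
    then have "w' = 0" using sgns(9) by (simp add: sgn_0_0)
    then have "(1 / A') *\<^sub>R (A' *\<^sub>R c') = (1 / A') *\<^sub>R (f' *\<^sub>R d')" by (simp add: vw')
    then have c': "c' = (f' / A') *\<^sub>R d'" using A'(1) by simp
    have sgdiv: "sgn (x / y) = sgn x" if "y > 0" for x y :: real
      using that by (simp add: sgn_divide)
    have sgdiv1: "sgn (x / y - 1) = sgn (x - y)" if "y > 0" for x y :: real
      using that by (auto simp: sgn_if field_simps)
    have "\<exists>s\<in>{0..1}. \<exists>t\<in>{0..1}. s = (1 - t) * (f' / A') + t * ((f' + B') / A') \<and> \<not> (s = 0 \<and> \<alpha>) \<and> \<not> (s = 1 \<and> \<beta>)"
    proof (rule interval_crossing_cong[where r = "f / A" and q = "(f + B) / A" and s = s and t = t])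
      have "s = (1 - t) * (s - t * k) + t * (s - t * k + k)" for k by (simp add: algebra_simps)
      then show "s = (1 - t) * (f / A) + t * ((f + B) / A)"
        unfolding add_divide_distrib f .
      show "f / A \<noteq> (f + B) / A" "f' / A' \<noteq> (f' + B') / A'"
        using B B' by (simp_all add: add_divide_distrib)
      show "sgn (f / A) = sgn (f' / A')" "sgn (f / A - 1) = sgn (f' / A' - 1)"
        "sgn ((f + B) / A) = sgn ((f' + B') / A')" "sgn ((f + B) / A - 1) = sgn ((f' + B') / A' - 1)"
        using sgns(10-13) by (simp_all only: sgdiv[OF A(1)] sgdiv1[OF A(1)] sgdiv[OF A'(1)] sgdiv1[OF A'(1)])
    qed (use st al in auto)
    then obtain s' t' where st': "s' \<in> {0..1}" "t' \<in> {0..1}" "s' = (1 - t') * (f' / A') + t' * ((f' + B') / A')"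
      "\<not> (s' = 0 \<and> \<alpha>)" "\<not> (s' = 1 \<and> \<beta>)" by blast
    have "(1 - t') * x + t' * (x + k) = x + t' * k" for x k by (simp add: algebra_simps)
    then have "s' = f' / A' + t' * (B' / A')" using st'(3) unfolding add_divide_distrib by (simp only:)
    then have "f' / A' = s' - t' * (B' / A')" by simp
    then have "c' = (s' - t' * (B' / A')) *\<^sub>R d'" using c' by simp
    also have "\<dots> = s' *\<^sub>R d' - t' *\<^sub>R e'" by (subst e') (simp add: algebra_simps)
    finally show ?thesis using st' by blast
  qed
  then obtain s t where "s \<in> {0..1}" "t \<in> {0..1}" "c' = s *\<^sub>R d' - t *\<^sub>R e'" "\<not> (s = 0 \<and> \<alpha>)" "\<not> (s = 1 \<and> \<beta>)"
    by blast
  moreover from this(3) have "P' + s *\<^sub>R (Q' - P') = R' + t *\<^sub>R (S' - R')"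
    by (simp add: dec' algebra_simps)
  ultimately show ?thesis unfolding crossing_def by blast
qed

lemma crossing_flip_second: "crossing \<alpha> \<beta> P Q R S \<longleftrightarrow> crossing \<alpha> \<beta> P Q S R"
proof -
  have "crossing \<alpha> \<beta> P Q S R" if cr: "crossing \<alpha> \<beta> P Q R S" for R S
  proof -
    obtain s t where st: "s \<in> {0..1}" "t \<in> {0..1}" "P + s *\<^sub>R (Q - P) = R + t *\<^sub>R (S - R)"
      "\<not> (s = 0 \<and> \<alpha>)" "\<not> (s = 1 \<and> \<beta>)" using cr unfolding crossing_def by blast
    have "R + t *\<^sub>R (S - R) = S + (1 - t) *\<^sub>R (R - S)" by (simp add: algebra_simps)
    with st show ?thesis unfolding crossing_def
      by (intro bexI[of _ s] bexI[of _ "1 - t"]) auto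
  qed
  then show ?thesis by blast
qed

lemma crossing_flip_first: "crossing \<alpha> \<beta> P Q R S \<longleftrightarrow> crossing \<beta> \<alpha> Q P R S"
proof -
  have "crossing \<beta> \<alpha> Q P R S" if cr: "crossing \<alpha> \<beta> P Q R S" for \<alpha> \<beta> P Q
  proof -
    obtain s t where st: "s \<in> {0..1}" "t \<in> {0..1}" "P + s *\<^sub>R (Q - P) = R + t *\<^sub>R (S - R)"
      "\<not> (s = 0 \<and> \<alpha>)" "\<not> (s = 1 \<and> \<beta>)" using cr unfolding crossing_def by blast
    have "P + s *\<^sub>R (Q - P) = Q + (1 - s) *\<^sub>R (P - Q)" by (simp add: algebra_simps)
    with st show ?thesis unfolding crossing_def
      by (intro bexI[of _ "1 - s"] bexI[of _ t]) auto
  qed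
  then show ?thesis by blast
qed

lemma disjoint_stable:
  fixes P Q R S :: "'b \<Rightarrow> 'a::euclidean_space"
  assumes lim: "(P \<longlongrightarrow> p) F" "(Q \<longlongrightarrow> q) F" "(R \<longlongrightarrow> r) F" "(S \<longlongrightarrow> s) F"
    and no: "\<not> crossing False False p q r s"
  shows "eventually (\<lambda>x. \<not> crossing False False (P x) (Q x) (R x) (S x)) F"
proof -
  have pt: "(1 - u) *\<^sub>R a + u *\<^sub>R b = a + u *\<^sub>R (b - a)" for u and a b :: 'a
    by (simp add: algebra_simps)
  have "closed_segment p q \<inter> closed_segment r s = {}"
    using no unfolding crossing_def by (auto simp: closed_segment_def pt)
  then obtain \<delta> where \<delta>: "\<delta> > 0" "\<And>x y. x \<in> closed_segment p q \<Longrightarrow> y \<in> closed_segment r s \<Longrightarrow> \<delta> \<le> dist x y"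
    using separate_compact_closed[of "closed_segment p q" "closed_segment r s"] by auto
  have close: "dist (a' + u *\<^sub>R (b' - a')) (a + u *\<^sub>R (b - a)) < \<delta> / 2"
    if u: "u \<in> {0..1}" and d: "dist a' a < \<delta> / 4" "dist b' b < \<delta> / 4" for u and a b a' b' :: 'a
  proof -
    have "dist (a' + u *\<^sub>R (b' - a')) (a + u *\<^sub>R (b - a)) = norm ((1 - u) *\<^sub>R (a' - a) + u *\<^sub>R (b' - b))"
      by (simp add: dist_norm algebra_simps)
    also have "\<dots> \<le> \<bar>1 - u\<bar> * norm (a' - a) + \<bar>u\<bar> * norm (b' - b)"
      by (rule norm_triangle_le) simp
    also have "\<dots> \<le> 1 * norm (a' - a) + 1 * norm (b' - b)"
      using u by (intro add_mono mult_right_mono) auto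
    also have "\<dots> < \<delta> / 2" using d by (simp add: dist_norm)
    finally show ?thesis .
  qed
  have "\<forall>\<^sub>F x in F. dist (P x) p < \<delta> / 4" "\<forall>\<^sub>F x in F. dist (Q x) q < \<delta> / 4"
    "\<forall>\<^sub>F x in F. dist (R x) r < \<delta> / 4" "\<forall>\<^sub>F x in F. dist (S x) s < \<delta> / 4"
    using lim[THEN tendstoD, of "\<delta> / 4"] \<delta>(1) by simp_all
  then show ?thesis
  proof eventually_elim
    case (elim x)
    show ?case
    proof
      assume "crossing False False (P x) (Q x) (R x) (S x)"
      then obtain u u' where u: "u \<in> {0..1}" "u' \<in> {0..1}"
        and eq: "P x + u *\<^sub>R (Q x - P x) = R x + u' *\<^sub>R (S x - R x)"
        unfolding crossing_def by blast
      have "p + u *\<^sub>R (q - p) \<in> closed_segment p q" "r + u' *\<^sub>R (s - r) \<in> closed_segment r s"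
        unfolding closed_segment_def using u by (auto simp flip: pt)
      then have "\<delta> \<le> dist (p + u *\<^sub>R (q - p)) (r + u' *\<^sub>R (s - r))" by (rule \<delta>(2))
      also have "\<dots> \<le> dist (P x + u *\<^sub>R (Q x - P x)) (p + u *\<^sub>R (q - p)) + dist (P x + u *\<^sub>R (Q x - P x)) (r + u' *\<^sub>R (s - r))"
        by (metis dist_commute dist_triangle)
      also have "\<dots> < \<delta> / 2 + \<delta> / 2"
        using close[OF u(1) elim(1,2)] close[OF u(2) elim(3,4)] unfolding eq by (rule add_strict_mono)
      finally show False by simp
    qed
  qed
qed

text \<open>
  Segments with a common end \<open>p\<close> overlap if and only if they point in the same direction, which is the
  case of equality in the Cauchy--Schwarz inequality. Its failure is an open condition.
\<close>

lemma crossing_at_common_end: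
  fixes p q s :: "'a::euclidean_space"
  assumes "p \<noteq> q" "p \<noteq> s"
  shows "crossing True False p q p s \<longleftrightarrow> (q - p) \<bullet> (s - p) = norm (q - p) * norm (s - p)"
proof
  define d e where de: "d = q - p" "e = s - p"
  have pos: "norm d > 0" "norm e > 0" using assms by (auto simp: de)
  {
    assume "crossing True False p q p s"
    then obtain u t where ut: "u \<in> {0..1}" "t \<in> {0..1}" "u *\<^sub>R d = t *\<^sub>R e" "u \<noteq> 0"
      unfolding crossing_def de by auto
    have "u * t * (d \<bullet> e) = (u *\<^sub>R d) \<bullet> (t *\<^sub>R e)" by simp
    also have "\<dots> = norm (u *\<^sub>R d) * norm (t *\<^sub>R e)"
      unfolding ut(3) by (metis power2_eq_square power2_norm_eq_inner)
    also have "\<dots> = u * t * (norm d * norm e)" using ut(1,2) by simp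
    finally have "u * t * (d \<bullet> e) = u * t * (norm d * norm e)" .
    moreover have "t \<noteq> 0" using ut pos by auto
    ultimately show "(q - p) \<bullet> (s - p) = norm (q - p) * norm (s - p)" using ut(4) by (simp add: de)
  next
    assume "(q - p) \<bullet> (s - p) = norm (q - p) * norm (s - p)"
    then have eq: "norm d *\<^sub>R e = norm e *\<^sub>R d" by (simp add: norm_cauchy_schwarz_eq de)
    \<comment> \<open>Rescaling by the larger norm puts both parameters into \<open>[0, 1]\<close>.\<close>
    define M where "M = max (norm d) (norm e)"
    have M: "M > 0" "norm d \<le> M" "norm e \<le> M" using pos by (auto simp: M_def less_max_iff_disj)
    have "(norm e / M) *\<^sub>R d = (1 / M) *\<^sub>R (norm e *\<^sub>R d)" by simp
    also have "\<dots> = (norm d / M) *\<^sub>R e" unfolding eq[symmetric] by simp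
    finally show "crossing True False p q p s"
    proof -
      assume eq: "(norm e / M) *\<^sub>R d = (norm d / M) *\<^sub>R e"
      have "norm e / M \<in> {0..1}" using M(1,3) by simp
      moreover have "norm d / M \<in> {0..1}" using M(1,2) by simp
      moreover have "norm e / M \<noteq> 0" using M(1) pos(2) by simp
      ultimately show ?thesis using eq unfolding crossing_def de[symmetric]
        by (intro bexI[of _ "norm e / M"] bexI[of _ "norm d / M"]) simp_all
    qed
  }
qed

lemma common_end_stable:
  fixes P Q S :: "'b \<Rightarrow> 'a::euclidean_space"
  assumes lim: "(P \<longlongrightarrow> p) F" "(Q \<longlongrightarrow> q) F" "(S \<longlongrightarrow> s) F"
    and ne: "p \<noteq> q" "p \<noteq> s" and no: "\<not> crossing True False p q p s"
  shows "eventually (\<lambda>x. \<not> crossing True False (P x) (Q x) (P x) (S x)) F"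
proof -
  let ?f = "\<lambda>x. (Q x - P x) \<bullet> (S x - P x) - norm (Q x - P x) * norm (S x - P x)"
  have "(?f \<longlongrightarrow> (q - p) \<bullet> (s - p) - norm (q - p) * norm (s - p)) F"
    by (intro tendsto_intros lim)
  moreover have "(q - p) \<bullet> (s - p) - norm (q - p) * norm (s - p) \<noteq> 0"
    using no by (simp add: crossing_at_common_end[OF ne])
  ultimately have 1: "\<forall>\<^sub>F x in F. ?f x \<noteq> 0" by (rule tendsto_imp_eventually_ne)
  have "((\<lambda>x. P x - Q x) \<longlongrightarrow> p - q) F" "((\<lambda>x. P x - S x) \<longlongrightarrow> p - s) F" by (intro tendsto_intros lim)+
  then have "\<forall>\<^sub>F x in F. P x - Q x \<noteq> 0" "\<forall>\<^sub>F x in F. P x - S x \<noteq> 0"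
    using ne tendsto_imp_eventually_ne[of "\<lambda>x. P x - Q x" "p - q" F 0]
      tendsto_imp_eventually_ne[of "\<lambda>x. P x - S x" "p - s" F 0] by simp_all
  with 1 show ?thesis by eventually_elim (auto simp: crossing_at_common_end)
qed

context drawn_graph
begin

abbreviation cross :: "('w \<Rightarrow> real^3) \<Rightarrow> 'g \<Rightarrow> 'g \<Rightarrow> bool" where
  "cross X g h \<equiv> crossing (src g \<in> ends h) (dst g \<in> ends h) (X (src g)) (X (dst g)) (X (src h)) (X (dst h))"

lemma point_eq: "point X g u = X (src g) + u *\<^sub>R (X (dst g) - X (src g))"
  by (simp add: point_def algebra_simps)

text \<open>
  By nondegeneracy the parameter of a point on \<open>g\<close> is \<open>0\<close> or \<open>1\<close> exactly when the point is the first or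
  second end, so the flags of \<open>crossing\<close> describe the shared vertices.
\<close>

lemma cross_iff:
  assumes ne: "X (src g) \<noteq> X (dst g)"
  shows "cross X g h \<longleftrightarrow> \<not> seg X g \<inter> seg X h \<subseteq> X ` (ends g \<inter> ends h)"
proof -
  have s01: "point X g s = X (src g) \<longleftrightarrow> s = 0" "point X g s = X (dst g) \<longleftrightarrow> s = 1" for s
  proof -
    show "point X g s = X (src g) \<longleftrightarrow> s = 0" using ne by (auto simp: point_eq)
    have "X (dst g) - point X g s = (1 - s) *\<^sub>R (X (dst g) - X (src g))"
      by (simp add: point_def algebra_simps)
    then have "X (dst g) - point X g s = 0 \<longleftrightarrow> s = 1" using ne by simp
    then show "point X g s = X (dst g) \<longleftrightarrow> s = 1" by auto
  qed
  have mem: "point X g s \<in> X ` (ends g \<inter> ends h) \<longleftrightarrow> s = 0 \<and> src g \<in> ends h \<or> s = 1 \<and> dst g \<in> ends h" for s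
    using s01[of s] by (auto simp: ends_def)
  have "cross X g h \<longleftrightarrow> (\<exists>s\<in>{0..1}. \<exists>t\<in>{0..1}. point X g s = point X h t \<and> point X g s \<notin> X ` (ends g \<inter> ends h))"
    unfolding crossing_def point_eq[symmetric] mem by blast
  also have "\<dots> \<longleftrightarrow> \<not> seg X g \<inter> seg X h \<subseteq> X ` (ends g \<inter> ends h)"
    unfolding seg_eq_points by (force simp: image_iff)
  finally show ?thesis .
qed

lemma embedded_iff_no_cross:
  "embedded X \<longleftrightarrow> (\<forall>g\<in>G. X (src g) \<noteq> X (dst g)) \<and> (\<forall>g\<in>G. \<forall>h\<in>G. g \<noteq> h \<longrightarrow> \<not> cross X g h)"
  unfolding embedded_def using cross_iff by blast

text \<open>
  Two edges of an embedded drawing share at most one vertex. If they share none, the segments have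
  positive distance; if they share one, it stays a common end under the perturbation and the angle
  between the segments stays positive.
\<close>

lemma no_cross_stable:
  assumes X: "embedded X" and lim: "\<And>w. ((\<lambda>t. Y t w) \<longlongrightarrow> X w) F"
    and g: "g \<in> G" "h \<in> G" "g \<noteq> h"
  shows "eventually (\<lambda>t. \<not> cross (Y t) g h) F"
proof -
  have no: "\<not> cross X g h" using X g by (simp add: embedded_iff_no_cross)
  have ne: "X (src g) \<noteq> X (dst g)" "X (src h) \<noteq> X (dst h)" using embeddedD(1)[OF X] g by auto
  have not_both: "\<not> (src g \<in> ends h \<and> dst g \<in> ends h)"
  proof
    assume "src g \<in> ends h \<and> dst g \<in> ends h"
    then have "ends g = ends h" using ne by (auto simp: ends_def)
    then have "seg X g = seg X h"
      by (auto simp: ends_def seg_def doubleton_eq_iff closed_segment_commute)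
    then have "midpoint (X (src g)) (X (dst g)) \<in> seg X h" by (metis seg_def midpoint_in_closed_segment)
    with midpoint_on_seg[OF X g(1,2)] g(3) show False by blast
  qed
  consider "src g \<notin> ends h" "dst g \<notin> ends h"
    | "src g = src h" "dst g \<notin> ends h" | "src g = dst h" "dst g \<notin> ends h"
    | "dst g = src h" "src g \<notin> ends h" | "dst g = dst h" "src g \<notin> ends h"
    using not_both by (auto simp: ends_def)
  then show ?thesis
  proof cases
    case 1
    then show ?thesis using disjoint_stable[OF lim lim lim lim] no by simp
  next
    case 2
    have "eventually (\<lambda>t. \<not> crossing True False (Y t (src g)) (Y t (dst g)) (Y t (src g)) (Y t (dst h))) F"
      by (rule common_end_stable[OF lim lim lim]) (use no ne 2 in \<open>auto simp: ends_def\<close>)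
    then show ?thesis using 2 by (simp add: ends_def)
  next
    case 3
    have "eventually (\<lambda>t. \<not> crossing True False (Y t (src g)) (Y t (dst g)) (Y t (src g)) (Y t (src h))) F"
      by (rule common_end_stable[OF lim lim lim])
        (use no ne 3 in \<open>auto simp: ends_def crossing_flip_second[of _ _ _ _ "X (src h)"]\<close>)
    then show ?thesis using 3 by (simp add: ends_def crossing_flip_second[of _ _ _ _ "Y _ (src h)"])
  next
    case 4
    have "eventually (\<lambda>t. \<not> crossing True False (Y t (dst g)) (Y t (src g)) (Y t (dst g)) (Y t (dst h))) F"
      by (rule common_end_stable[OF lim lim lim])
        (use no ne 4 in \<open>auto simp: ends_def crossing_flip_first[of _ _ "X (src g)"]\<close>)
    then show ?thesis using 4 by (simp add: ends_def crossing_flip_first[of _ _ "Y _ (src g)"])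
  next
    case 5
    have "eventually (\<lambda>t. \<not> crossing True False (Y t (dst g)) (Y t (src g)) (Y t (dst g)) (Y t (src h))) F"
      by (rule common_end_stable[OF lim lim lim])
        (use no ne 5 in \<open>auto simp: ends_def crossing_flip_first[of _ _ "X (src g)"]
          crossing_flip_second[of _ _ _ _ "X (src h)"]\<close>)
    then show ?thesis using 5
      by (simp add: ends_def crossing_flip_first[of _ _ "Y _ (src g)"] crossing_flip_second[of _ _ _ _ "Y _ (src h)"])
  qed
qed

end

lemma crossing_translate: "crossing \<alpha> \<beta> (P + w) (Q + w) (R + w) (S + w) \<longleftrightarrow> crossing \<alpha> \<beta> P Q R S"
  unfolding crossing_def by (simp add: algebra_simps)

definition is_pol_vec :: "'i set \<Rightarrow> (('i \<Rightarrow> real) \<Rightarrow> real^'n) \<Rightarrow> bool" where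
  "is_pol_vec I f \<longleftrightarrow> (\<forall>j. is_pol I (\<lambda>x. f x $ j))"

lemma is_pol_vec_add: "is_pol_vec I f \<Longrightarrow> is_pol_vec I g \<Longrightarrow> is_pol_vec I (\<lambda>x. f x + g x)"
  and is_pol_vec_diff: "is_pol_vec I f \<Longrightarrow> is_pol_vec I g \<Longrightarrow> is_pol_vec I (\<lambda>x. f x - g x)"
  and is_pol_vec_scaleR: "is_pol I p \<Longrightarrow> is_pol_vec I f \<Longrightarrow> is_pol_vec I (\<lambda>x. p x *\<^sub>R f x)"
  and is_pol_inner: "is_pol_vec I f \<Longrightarrow> is_pol_vec I g \<Longrightarrow> is_pol I (\<lambda>x. f x \<bullet> g x)"
  unfolding is_pol_vec_def inner_vec_def inner_real_def by (auto intro!: is_pol_intros)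

lemma is_pol_probe:
  assumes "p \<in> set probes" "is_pol_vec I P" "is_pol_vec I Q" "is_pol_vec I R" "is_pol_vec I S"
  shows "is_pol I (\<lambda>x. p (P x) (Q x) (R x) (S x))"
  using assms(1) unfolding probes_def Let_def list.set
  by (elim insertE emptyE; hypsubst)
    (intro is_pol_add is_pol_diff is_pol_mult is_pol_inner is_pol_vec_add is_pol_vec_diff is_pol_vec_scaleR assms(2-))+

section \<open>Components of the space of embedded drawings\<close>

context labelled_graph
begin

text \<open>
  If all coordinates of vertices are less than \<open>2\<close> in absolute value, an edge deviates from its
  translation vector by less than half of this number in each coordinate. So an edge and a translate
  of an edge by a vector outside \<open>shifts\<close> are disjoint.
\<close>

definition reach :: int where
  "reach = 4 + 2 * (\<Sum>e\<in>E. \<Sum>j\<in>UNIV. \<bar>lam e $ j\<bar>)"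

definition shifts :: "(int^3) set" where
  "shifts = {k. \<forall>j. k $ j \<in> {- reach..reach}}"

lemma finite_shifts: "finite shifts"
  unfolding shifts_def by (rule finite_vec_range) simp

lemma zero_shift: "0 \<in> shifts"
proof -
  have "reach \<ge> 0" unfolding reach_def
    by (intro add_nonneg_nonneg mult_nonneg_nonneg sum_nonneg) auto
  then show ?thesis by (simp add: shifts_def)
qed

abbreviation drawing :: "('v \<Rightarrow> real^3) \<Rightarrow> 'v \<times> (int^3) \<Rightarrow> real^3" where
  "drawing y \<equiv> placement (mat 1) y"

lemma drawing_eq: "drawing y (v, k) = y v + of_int_vec k"
  by (simp add: placement_def)

lemma cross_shift: "cross (drawing y) (e, k + m) (e', l + m) \<longleftrightarrow> cross (drawing y) (e, k) (e', l)"
proof -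
  have "(v, i + m) \<in> ends (e', l + m) \<longleftrightarrow> (v, i) \<in> ends (e', l)" for v i
    by (simp add: ends_def add.assoc[symmetric])
  moreover have "drawing y (v, i + m) = drawing y (v, i) + of_int_vec m" for v i
    by (simp add: drawing_eq of_int_vec_add)
  ultimately show ?thesis
    using crossing_translate by (simp add: add.assoc[symmetric])
qed

lemma seg_bounded:
  assumes y: "\<And>v j. v \<in> tl ` E \<union> hd ` E \<Longrightarrow> \<bar>y v $ j\<bar> < 2" and e: "e \<in> E"
    and x: "x \<in> seg (drawing y) (e, k)"
  shows "2 * \<bar>x $ j - of_int (k $ j)\<bar> < of_int reach"
proof -
  define L where "L = real_of_int (\<Sum>e\<in>E. \<Sum>j\<in>UNIV. \<bar>lam e $ j\<bar>)"
  have "\<bar>lam e $ j\<bar> \<le> (\<Sum>j\<in>UNIV. \<bar>lam e $ j\<bar>)" by (intro member_le_sum) auto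
  also have "\<dots> \<le> (\<Sum>e\<in>E. \<Sum>j\<in>UNIV. \<bar>lam e $ j\<bar>)"
    using e finite_E by (intro member_le_sum[of e E "\<lambda>e. \<Sum>j\<in>UNIV. \<bar>lam e $ j\<bar>"] sum_nonneg) auto
  finally have lam: "\<bar>real_of_int (lam e $ j)\<bar> \<le> L" unfolding L_def by linarith
  obtain u where u: "0 \<le> u" "u \<le> 1" "x = (1 - u) *\<^sub>R (y (tl e) + of_int_vec (lam e + k)) + u *\<^sub>R (y (hd e) + of_int_vec k)"
    using x by (auto simp: seg_def closed_segment_def drawing_eq)
  have "x $ j - of_int (k $ j) = (1 - u) * (y (tl e) $ j + of_int (lam e $ j)) + u * (y (hd e) $ j)"
    unfolding u(3) by (simp add: of_int_vec_def algebra_simps)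
  also have "\<bar>\<dots>\<bar> \<le> (1 - u) * \<bar>y (tl e) $ j + of_int (lam e $ j)\<bar> + u * \<bar>y (hd e) $ j\<bar>"
    using u(1,2) abs_triangle_ineq[of "(1 - u) * (y (tl e) $ j + of_int (lam e $ j))" "u * (y (hd e) $ j)"]
    by (simp add: abs_mult)
  also have "\<dots> < 2 + L"
  proof -
    have t: "\<bar>y (tl e) $ j + of_int (lam e $ j)\<bar> < 2 + L" using y[of "tl e" j] e lam by simp
    have h: "\<bar>y (hd e) $ j\<bar> < 2 + L" using y[of "hd e" j] e lam by simp
    show ?thesis
    proof (cases "u = 0")
      case False
      then have "u * \<bar>y (hd e) $ j\<bar> < u * (2 + L)" using u(1) h by simp
      moreover have "(1 - u) * \<bar>y (tl e) $ j + of_int (lam e $ j)\<bar> \<le> (1 - u) * (2 + L)"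
        using u(2) t by (intro mult_left_mono) auto
      ultimately show ?thesis by (simp add: algebra_simps)
    qed (use t in simp)
  qed
  finally show ?thesis by (simp add: reach_def L_def)
qed

text \<open>
  A common translation moves the first edge to the representative of its orbit, and representatives
  cannot meet edges that are shifted too far.
\<close>

lemma admissible_iff_finite:
  assumes y: "\<And>v j. v \<in> tl ` E \<union> hd ` E \<Longrightarrow> \<bar>y v $ j\<bar> < 2"
  shows "admissible y \<longleftrightarrow> (\<forall>e\<in>E. drawing y (tl e, lam e) \<noteq> drawing y (hd e, 0)) \<and>
    (\<forall>e\<in>E. \<forall>e'\<in>E. \<forall>k\<in>shifts. (e, 0) \<noteq> (e', k) \<longrightarrow> \<not> cross (drawing y) (e, 0) (e', k))"
    (is "_ \<longleftrightarrow> ?N \<and> ?C")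
proof
  assume "admissible y"
  then have e: "\<forall>g\<in>E \<times> UNIV. drawing y (case g of (e, k) \<Rightarrow> (tl e, lam e + k)) \<noteq> drawing y (case g of (e, k) \<Rightarrow> (hd e, k))"
    and c: "\<forall>g\<in>E \<times> UNIV. \<forall>h\<in>E \<times> UNIV. g \<noteq> h \<longrightarrow> \<not> cross (drawing y) g h"
    unfolding admissible_def embedded_iff_no_cross by blast+
  have ?N
  proof
    fix e assume "e \<in> E"
    then show "drawing y (tl e, lam e) \<noteq> drawing y (hd e, 0)" using e[THEN bspec, of "(e, 0)"] by simp
  qed
  moreover have ?C
  proof (intro ballI impI)
    fix e e' and k :: "int^3" assume "e \<in> E" "e' \<in> E" "(e, 0) \<noteq> (e', k)"
    then show "\<not> cross (drawing y) (e, 0) (e', k)"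
      using c[THEN bspec, of "(e, 0)", THEN bspec, of "(e', k)"] by blast
  qed
  ultimately show "?N \<and> ?C" ..
next
  assume NC: "?N \<and> ?C"
  show "admissible y" unfolding admissible_def embedded_def
  proof (intro conjI ballI impI)
    fix g assume "g \<in> E \<times> (UNIV :: (int^3) set)"
    then obtain e k where g: "g = (e, k)" "e \<in> E" by blast
    have "drawing y (v, i + k) = drawing y (v, i) + of_int_vec k" for v i
      by (simp add: drawing_eq of_int_vec_add)
    from this[of "tl e" "lam e"] this[of "hd e" 0]
    show ne: "drawing y (case g of (e, k) \<Rightarrow> (tl e, lam e + k)) \<noteq> drawing y (case g of (e, k) \<Rightarrow> (hd e, k))"
      using NC g(2) by (simp add: g)
    fix h assume "h \<in> E \<times> (UNIV :: (int^3) set)" "g \<noteq> h"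
    then obtain e' l where h: "h = (e', l)" "e' \<in> E" "(e, 0) \<noteq> (e', l - k)" using g by auto
    show "seg (drawing y) g \<inter> seg (drawing y) h \<subseteq> drawing y ` (ends g \<inter> ends h)"
    proof (cases "l - k \<in> shifts")
      case True
      then have "\<not> cross (drawing y) (e, 0) (e', l - k)" using NC g(2) h by blast
      then have "\<not> cross (drawing y) g h"
        using cross_shift[where y = y and e = e and k = 0 and m = k and e' = e' and l = "l - k"] by (simp add: g(1) h(1))
      then show ?thesis using cross_iff[OF ne] by blast
    next
      case False
      then obtain j where "(l - k) $ j \<notin> {- reach..reach}" unfolding shifts_def by blast
      then have j: "\<bar>l $ j - k $ j\<bar> > reach" by (auto simp: abs_if)
      have "False" if x: "x \<in> seg (drawing y) g" "x \<in> seg (drawing y) h" for x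
      proof -
        have "2 * \<bar>x $ j - of_int (k $ j)\<bar> < of_int reach" "2 * \<bar>x $ j - of_int (l $ j)\<bar> < of_int reach"
          using seg_bounded[OF y] x g h by simp_all
        moreover have "\<bar>real_of_int (l $ j - k $ j)\<bar> \<le> \<bar>x $ j - of_int (k $ j)\<bar> + \<bar>x $ j - of_int (l $ j)\<bar>"
          using abs_triangle_ineq4[of "x $ j - of_int (k $ j)" "x $ j - of_int (l $ j)"] by simp
        moreover have "d < r" if "2 * A < r" "2 * B < r" "d \<le> A + B" for A B d r :: real
          using that by linarith
        ultimately have "\<bar>real_of_int (l $ j - k $ j)\<bar> < of_int reach" by blast
        with j show False by linarith
      qed
      then show ?thesis by blast
    qed
  qed
qed

definition coordinates :: "('v \<times> 3) set" where
  "coordinates = (tl ` E \<union> hd ` E) \<times> UNIV"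

definition config :: "('v \<times> 3 \<Rightarrow> real) \<Rightarrow> 'v \<Rightarrow> real^3" where
  "config x v = (\<chi> j. x (v, j))"

lemma finite_coordinates: "finite coordinates"
  using finite_E by (simp add: coordinates_def)

lemma config_bounded:
  assumes "x \<in> cube coordinates 2" "v \<in> tl ` E \<union> hd ` E"
  shows "\<bar>config x v $ j\<bar> < 2"
  using assms by (auto simp: cube_def coordinates_def config_def)

lemma continuous_on_config: "continuous_on S config"
  unfolding config_def
  by (intro continuous_on_coordinatewise_then_product continuous_on_vec_lambda
      continuous_on_subset[OF continuous_on_product_coordinates]) simp

text \<open>
  The functions whose signs decide whether a drawing with coordinates in the cube is embedded. By
  periodicity the first edge may be taken from the orbit representatives.
\<close>

definition probe_polys :: "(('v \<times> 3 \<Rightarrow> real) \<Rightarrow> real) set" where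
  "probe_polys = (\<lambda>(p, e, e', k) x. p (drawing (config x) (tl e, lam e)) (drawing (config x) (hd e, 0))
       (drawing (config x) (tl e', lam e' + k)) (drawing (config x) (hd e', k)))
     ` (set probes \<times> E \<times> E \<times> shifts)"

lemma finite_probe_polys: "finite probe_polys"
  unfolding probe_polys_def using finite_E finite_shifts by simp

lemma is_pol_probe_polys:
  assumes "f \<in> probe_polys"
  shows "is_pol coordinates f"
proof -
  obtain p e e' k where p: "p \<in> set probes" "e \<in> E" "e' \<in> E" and
    f: "f = (\<lambda>x. p (drawing (config x) (tl e, lam e)) (drawing (config x) (hd e, 0))
       (drawing (config x) (tl e', lam e' + k)) (drawing (config x) (hd e', k)))"
    using assms unfolding probe_polys_def by auto
  have "is_pol_vec coordinates (\<lambda>x. drawing (config x) (v, k))" if "v \<in> tl ` E \<union> hd ` E" for v k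
    unfolding drawing_eq
    using that by (auto simp: is_pol_vec_def config_def coordinates_def of_int_vec_def intro!: is_pol_intros)
  then show ?thesis unfolding f using p by (intro is_pol_probe) auto
qed

lemma inner_self_probe: "(\<lambda>P Q R S. (Q - P) \<bullet> (Q - P)) \<in> set probes"
  by (simp add: probes_def Let_def)

lemma admissible_cong:
  assumes x: "x \<in> cube coordinates 2" "x' \<in> cube coordinates 2"
    and sg: "\<And>f. f \<in> probe_polys \<Longrightarrow> sgn (f x) = sgn (f x')" and ad: "admissible (config x)"
  shows "admissible (config x')"
proof -
  have sgp: "sgn (p (drawing (config x) (tl e, lam e)) (drawing (config x) (hd e, 0))
       (drawing (config x) (tl e', lam e' + k)) (drawing (config x) (hd e', k))) =
     sgn (p (drawing (config x') (tl e, lam e)) (drawing (config x') (hd e, 0))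
       (drawing (config x') (tl e', lam e' + k)) (drawing (config x') (hd e', k)))"
    if "p \<in> set probes" "e \<in> E" "e' \<in> E" "k \<in> shifts" for p e e' k
  proof -
    have "(\<lambda>x. p (drawing (config x) (tl e, lam e)) (drawing (config x) (hd e, 0))
       (drawing (config x) (tl e', lam e' + k)) (drawing (config x) (hd e', k))) \<in> probe_polys"
      unfolding probe_polys_def using that by (intro image_eqI[of _ _ "(p, e, e', k)"]) auto
    from sg[OF this] show ?thesis .
  qed
  note NC = iffD1[OF admissible_iff_finite[OF config_bounded[OF x(1)]] ad]
  have N: "drawing (config x) (tl e, lam e) \<noteq> drawing (config x) (hd e, 0)" if "e \<in> E" for e
    using NC that by blast
  have N': "drawing (config x') (tl e, lam e + k) \<noteq> drawing (config x') (hd e, k)" if "e \<in> E" for e k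
  proof -
    have "drawing (config x') (tl e, lam e) \<noteq> drawing (config x') (hd e, 0)"
      using sgp[OF inner_self_probe that that zero_shift] N[OF that] by (auto simp: sgn_0_0)
    then show ?thesis by (simp add: drawing_eq of_int_vec_add)
  qed
  have C: "\<not> cross (drawing (config x)) (e, 0) (e', k)"
    if "e \<in> E" "e' \<in> E" "k \<in> shifts" "(e, 0) \<noteq> (e', k)" for e e' k
    using NC that by blast
  have C': "\<not> cross (drawing (config x')) (e, 0) (e', k)"
    if "e \<in> E" "e' \<in> E" "k \<in> shifts" "(e, 0) \<noteq> (e', k)" for e e' k
  proof
    assume "cross (drawing (config x')) (e, 0) (e', k)"
    then have c: "crossing ((tl e, lam e) \<in> ends (e', k)) ((hd e, 0) \<in> ends (e', k))
       (drawing (config x') (tl e, lam e)) (drawing (config x') (hd e, 0))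
       (drawing (config x') (tl e', lam e' + k)) (drawing (config x') (hd e', k))" by simp
    have "crossing ((tl e, lam e) \<in> ends (e', k)) ((hd e, 0) \<in> ends (e', k))
       (drawing (config x) (tl e, lam e)) (drawing (config x) (hd e, 0))
       (drawing (config x) (tl e', lam e' + k)) (drawing (config x) (hd e', k))"
    proof (rule crossing_cong[OF _ _ _ c])
      show "drawing (config x') (tl e, lam e) \<noteq> drawing (config x') (hd e, 0)" using N'[of e 0] that by simp
      show "drawing (config x') (tl e', lam e' + k) \<noteq> drawing (config x') (hd e', k)" using N' that by simp
    qed (rule sgp[OF _ that(1-3), symmetric])
    then have "cross (drawing (config x)) (e, 0) (e', k)" by simp
    with C[OF that] show False by blast
  qed
  have "\<forall>e\<in>E. drawing (config x') (tl e, lam e) \<noteq> drawing (config x') (hd e, 0)"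
    using N'[of _ 0] by simp
  then show ?thesis
    using C' admissible_iff_finite[of "config x'", OF config_bounded[OF x(2)]] by blast
qed

text \<open>
  By \<open>admissible_iff_finite\<close> being embedded is the conjunction of finitely many conditions, each of
  which persists near \<open>x\<close>.
\<close>

lemma admissible_stable_on_line:
  assumes x: "x \<in> cube coordinates 2" and ad: "admissible (config x)"
    and z: "\<And>i. i \<notin> coordinates \<Longrightarrow> z i = 0"
  shows "eventually (\<lambda>t. (\<lambda>i. x i + t * (z i - x i)) \<in> cube coordinates 2 \<and>
           admissible (config (\<lambda>i. x i + t * (z i - x i)))) (at_right 0)"
proof -
  define g where "g t i = x i + t * (z i - x i)" for t i
  have lim: "((\<lambda>t. g t i) \<longlongrightarrow> x i) (at_right 0)" for i
    unfolding g_def by (auto intro!: tendsto_eq_intros)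
  have limc: "((\<lambda>t. drawing (config (g t)) w) \<longlongrightarrow> drawing (config x) w) (at_right 0)" for w
    unfolding config_def by (cases w) (auto simp: drawing_eq intro!: tendsto_intros lim)
  have "eventually (\<lambda>t. \<forall>i\<in>coordinates. \<bar>g t i\<bar> < 2) (at_right 0)"
  proof (intro eventually_ball_finite finite_coordinates ballI)
    fix i assume "i \<in> coordinates"
    then have "\<bar>x i\<bar> < 2" using x by (simp add: cube_def)
    moreover have "((\<lambda>t. \<bar>g t i\<bar>) \<longlongrightarrow> \<bar>x i\<bar>) (at_right 0)" by (intro tendsto_intros lim)
    ultimately show "eventually (\<lambda>t. \<bar>g t i\<bar> < 2) (at_right 0)" by (simp add: order_tendstoD(2))
  qed
  moreover have "eventually (\<lambda>t. \<forall>e\<in>E. drawing (config (g t)) (tl e, lam e) - drawing (config (g t)) (hd e, 0) \<noteq> 0) (at_right 0)"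
  proof (intro eventually_ball_finite finite_E ballI)
    fix e assume "e \<in> E"
    then have "drawing (config x) (tl e, lam e) - drawing (config x) (hd e, 0) \<noteq> 0"
      using iffD1[OF admissible_iff_finite[OF config_bounded[OF x]] ad] by simp
    then show "eventually (\<lambda>t. drawing (config (g t)) (tl e, lam e) - drawing (config (g t)) (hd e, 0) \<noteq> 0) (at_right 0)"
      by (rule tendsto_imp_eventually_ne[rotated]) (intro tendsto_intros limc)
  qed
  moreover have "eventually (\<lambda>t. \<forall>e\<in>E. \<forall>e'\<in>E. \<forall>k\<in>shifts. (e, 0) \<noteq> (e', k) \<longrightarrow>
     \<not> cross (drawing (config (g t))) (e, 0) (e', k)) (at_right 0)"
  proof (intro eventually_ball_finite finite_E finite_shifts ballI)
    fix e e' k assume e: "e \<in> E" "e' \<in> E" "k \<in> shifts"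
    show "eventually (\<lambda>t. (e, 0) \<noteq> (e', k) \<longrightarrow> \<not> cross (drawing (config (g t))) (e, 0) (e', k)) (at_right 0)"
    proof (cases "(e, 0) = (e', k)")
      case False
      have "eventually (\<lambda>t. \<not> cross (drawing (config (g t))) (e, 0) (e', k)) (at_right 0)"
        using ad e False limc unfolding admissible_def by (intro no_cross_stable[of "drawing (config x)"]) auto
      then show ?thesis by (rule eventually_mono) blast
    qed simp
  qed
  ultimately have "eventually (\<lambda>t. g t \<in> cube coordinates 2 \<and> admissible (config (g t))) (at_right 0)"
  proof eventually_elim
    case (elim t)
    have c: "g t \<in> cube coordinates 2"
      using elim(1) x z by (auto simp: cube_def g_def)
    moreover have "admissible (config (g t))"
      by (subst admissible_iff_finite[OF config_bounded[OF c]]) (use elim(2,3) in auto)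
    ultimately show ?case ..
  qed
  then show ?thesis by (simp add: g_def[abs_def])
qed

text \<open>
  Along a path on which \<open>F\<close> does not vanish, each \<open>f \<in> probe_polys\<close> is either identically zero or never
  zero, so its sign is constant.
\<close>

lemma admissible_along_path:
  assumes F: "F = (\<lambda>x. \<Prod>f\<in>{f \<in> probe_polys. \<exists>x. f x \<noteq> 0}. f x)"
    and pc: "path_component {x \<in> cube coordinates 2. F x \<noteq> 0} x z" and ad: "admissible (config x)"
  shows "path_component {y. admissible y} (config x) (config z)"
proof -
  obtain g where g: "continuous_on {0..1} g" "\<And>t. t \<in> {0..1::real} \<Longrightarrow> g t \<in> cube coordinates 2 \<and> F (g t) \<noteq> 0"
    "g 0 = x" "g 1 = z"
    using pc unfolding path_component_def path_def path_image_def pathstart_def pathfinish_def by blast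
  have "admissible (config (g t))" if t: "t \<in> {0..1}" for t
  proof (rule admissible_cong[OF _ _ _ ad])
    show "x \<in> cube coordinates 2" using g(2)[of 0] g(3) by simp
    show "g t \<in> cube coordinates 2" using g(2)[OF t] by simp
    fix f assume f: "f \<in> probe_polys"
    show "sgn (f x) = sgn (f (g t))"
    proof (cases "\<exists>x. f x \<noteq> 0")
      case True
      obtain d where d: "pol coordinates d f" using is_pol_probe_polys[OF f] by (auto simp: is_pol_def)
      have "continuous_on {0..1} (\<lambda>t. f (g t))"
        by (rule pol_continuous_comp[OF d continuous_on_product_then_coordinatewise[OF g(1)]])
      moreover have "f (g t) \<noteq> 0" if "t \<in> {0..1}" for t
        using g(2)[OF that] f True finite_probe_polys unfolding F by auto
      ultimately show ?thesis using continuous_nonzero_sgn[of "\<lambda>t. f (g t)" t] t g(3) by simp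
    qed simp
  qed
  moreover have "continuous_on {0..1} (\<lambda>t. config (g t))"
    by (rule continuous_on_compose2[OF continuous_on_config g(1)]) (rule subset_UNIV)
  ultimately show ?thesis
    unfolding path_component_def path_def path_image_def pathstart_def pathfinish_def
    using g(3,4) by (intro exI[of _ "\<lambda>t. config (g t)"]) auto
qed

text \<open>
  A drawing may lie on the hypersurface \<open>F = 0\<close>. Moving it a little along the line towards a point
  where \<open>F\<close> does not vanish keeps it embedded and leaves the hypersurface; from there it is
  connected to one of finitely many drawings within the complement.
\<close>

theorem finitely_many_components_of_admissible:
  "\<exists>T. finite T \<and> (\<forall>y. admissible y \<and> (\<forall>v j. \<bar>y v $ j\<bar> \<le> 1) \<and> (\<forall>v. v \<notin> tl ` E \<union> hd ` E \<longrightarrow> y v = 0) \<longrightarrow>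
     (\<exists>z\<in>T. path_component {y. admissible y} y z))"
proof -
  define F where "F = (\<lambda>x. \<Prod>f\<in>{f \<in> probe_polys. \<exists>x. f x \<noteq> 0}. f x)"
  have "is_pol coordinates F" unfolding F_def by (intro is_pol_prod is_pol_probe_polys) simp
  then obtain d where d: "pol coordinates d F" by (auto simp: is_pol_def)
  obtain T where T: "finite T" "\<And>x. x \<in> cube coordinates 2 \<Longrightarrow> F x \<noteq> 0 \<Longrightarrow>
      \<exists>z\<in>T. path_component {y \<in> cube coordinates 2. F y \<noteq> 0} x z"
    using finitely_many_path_components[OF finite_coordinates d, of 2] by auto
  have "\<exists>z. F z \<noteq> 0"
    unfolding F_def
  proof (rule pol_prod_not_identically_zero[of _ coordinates])
    show "\<exists>d. pol coordinates d f" if "f \<in> {f \<in> probe_polys. \<exists>x. f x \<noteq> 0}" for f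
      using is_pol_probe_polys[of f] that by (simp add: is_pol_def)
  qed (use finite_probe_polys in auto)
  then obtain z0 where z0: "F z0 \<noteq> 0" by blast
  \<comment> \<open>The line towards \<open>z\<close> has to stay in the cube, where all other coordinates are zero.\<close>
  define z where "z i = (if i \<in> coordinates then z0 i else 0)" for i
  have z: "F z \<noteq> 0" "\<And>i. i \<notin> coordinates \<Longrightarrow> z i = 0"
    using z0 pol_cong[OF d, of z z0] by (simp_all add: z_def)
  have "\<exists>w\<in>config ` T. path_component {y. admissible y} y w"
    if y: "admissible y" "\<And>v j. \<bar>y v $ j\<bar> \<le> 1" "\<And>v. v \<notin> tl ` E \<union> hd ` E \<Longrightarrow> y v = 0" for y
  proof -
    define x where "x = (\<lambda>(v, j). y v $ j)"
    have xy: "config x = y" by (simp add: config_def x_def fun_eq_iff)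
    have x: "x \<in> cube coordinates 2"
    proof -
      have "\<bar>x i\<bar> < 2" for i using y(2)[of "fst i" "snd i"] by (simp add: x_def split_beta)
      moreover have "x i = 0" if "i \<notin> coordinates" for i
        using y(3)[of "fst i"] that by (cases i) (auto simp: x_def coordinates_def)
      ultimately show ?thesis by (simp add: cube_def)
    qed
    define g where "g t = (\<lambda>i. x i + t * (z i - x i))" for t
    obtain b where b: "b > 0" "\<And>t. 0 < t \<Longrightarrow> t < b \<Longrightarrow> g t \<in> cube coordinates 2 \<and> admissible (config (g t))"
      using admissible_stable_on_line[OF x, of z] y(1) z(2) unfolding eventually_at_right_field g_def xy by blast
    have "finite {t. F (g t) = 0}"
      using pol_finite_zeros_on_line[OF d, of x 1 z] z(1) unfolding g_def by simp
    moreover have "infinite {0<..<b}" using b(1) by (rule infinite_Ioo)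
    ultimately have "\<not> {0<..<b} \<subseteq> {t. F (g t) = 0}" using finite_subset by blast
    then obtain t where "t \<in> {0<..<b}" "t \<notin> {t. F (g t) = 0}" by blast
    then have t: "0 < t" "t < b" "F (g t) \<noteq> 0" by simp_all
    have 1: "path_component {y. admissible y} y (config (g t))"
      unfolding path_component_def
    proof (intro exI conjI)
      show "path (\<lambda>s. config (g (s * t)))"
        unfolding path_def g_def
        by (rule continuous_on_compose2[OF continuous_on_config])
          (auto intro!: continuous_intros continuous_on_coordinatewise_then_product)
      show "pathstart (\<lambda>s. config (g (s * t))) = y" by (simp add: pathstart_def g_def xy)
      show "pathfinish (\<lambda>s. config (g (s * t))) = config (g t)" by (simp add: pathfinish_def)
      show "path_image (\<lambda>s. config (g (s * t))) \<subseteq> {y. admissible y}"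
      proof
        fix w assume "w \<in> path_image (\<lambda>s. config (g (s * t)))"
        then obtain s where s: "0 \<le> s" "s \<le> 1" "w = config (g (s * t))" by (auto simp: path_image_def)
        show "w \<in> {y. admissible y}"
        proof (cases "s = 0")
          case True
          then have "w = y" using s(3) by (simp add: g_def xy)
          with y(1) show ?thesis by simp
        next
          case False
          have "s * t \<le> 1 * t" using s(2) t(1) by (intro mult_right_mono) auto
          then have "s * t < b" using t(2) by linarith
          moreover have "0 < s * t" using False s(1) t(1) by simp
          ultimately have "0 < s * t" "s * t < b" by simp_all
          with b(2) s(3) show ?thesis by simp
        qed
      qed
    qed
    obtain w where w: "w \<in> T" "path_component {y \<in> cube coordinates 2. F y \<noteq> 0} (g t) w"
      using T(2)[of "g t"] b(2)[OF t(1,2)] t(3) by blast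
    have "path_component {y. admissible y} (config (g t)) (config w)"
      using admissible_along_path[OF F_def w(2)] b(2)[OF t(1,2)] by blast
    with 1 w(1) show ?thesis using path_component_trans by blast
  qed
  with T(1) show ?thesis by (intro exI[of _ "config ` T"]) simp
qed

end

section \<open>Nets with a given labelled quotient graph\<close>

context labelled_graph
begin

text \<open>
  The coordinates of the representatives in the unit cell give the drawing. Its vertices are distinct
  points, because the representatives are pairwise inequivalent, and its edges are distinct segments,
  because distinct arcs correspond to distinct orbits and an edge differs from its translates. The
  edges of the net therefore meet only in shared vertices of the periodic cover.
\<close>

lemma net_of_quotient_graph:
  assumes N: "proper_linear_3periodic_net \<N>" and a: "periodicity_basis a \<N>"
    and p: "bij_betw p V (nodes \<N> \<inter> unit_cell a)" and orb: "bij_betw orb E (edge_orbit a ` edges \<N>)"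
    and V: "tl ` E \<union> hd ` E \<subseteq> V"
    and lab: "\<And>e. e \<in> E \<Longrightarrow> \<exists>k l. closed_segment (translate a k (p (tl e))) (translate a l (p (hd e))) \<in> orb e \<and>
        lam e = k - l"
  shows "\<exists>y. admissible y \<and> (\<forall>v j. \<bar>y v $ j\<bar> \<le> 1) \<and> (\<forall>v. v \<notin> tl ` E \<union> hd ` E \<longrightarrow> y v = 0) \<and>
    \<N> = net (placement a y)"
proof -
  let ?V = "tl ` E \<union> hd ` E"
  have det: "det a \<noteq> 0" using a by (simp add: periodicity_basis_def basis3_iff_det)
  then obtain a' where a': "a ** a' = mat 1" by (metis invertible_det_nz invertible_right_inverse)
  have cancel: "x = x'" if "x v* a = x' v* a" for x x' :: "real^3"
  proof -
    have "(x v* a) v* a' = (x' v* a) v* a'" using that by simp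
    then show ?thesis by (simp add: vector_matrix_mul_assoc a')
  qed
  have "\<exists>t. p v = t v* a \<and> (\<forall>j. 0 \<le> t $ j \<and> t $ j < 1)" if "v \<in> ?V" for v
  proof -
    have "v \<in> V" using V that by blast
    then have "p v \<in> unit_cell a" using bij_betwE[OF p] by blast
    then obtain t where t: "p v = (\<Sum>i\<in>UNIV. t $ i *\<^sub>R a $ i)" "\<forall>i. 0 \<le> t $ i \<and> t $ i < 1"
      unfolding unit_cell_def by blast
    then have "p v = t v* a" by (simp add: vector_matrix_mult_def vec_eq_iff)
    with t(2) show ?thesis by blast
  qed
  then have "\<exists>t. \<forall>v\<in>?V. p v = t v v* a \<and> (\<forall>j. 0 \<le> t v $ j \<and> t v $ j < 1)" by (intro bchoice ballI)
  then obtain t where t: "\<And>v. v \<in> ?V \<Longrightarrow> p v = t v v* a" "\<And>v j. v \<in> ?V \<Longrightarrow> 0 \<le> t v $ j \<and> t v $ j < 1"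
    by blast
  define y where "y v = (if v \<in> ?V then t v else 0)" for v
  define X where "X = placement a y"
  have y_cell: "0 \<le> y v $ j" "y v $ j < 1" for v j using t(2) by (auto simp: y_def)
  have Xp: "X (v, k) = translate a k (p v)" if "v \<in> ?V" for v k
    using t(1)[OF that] that by (simp add: X_def placement_def translate_eq y_def algebra_simps)
  have X_inj: "v = w \<and> k = l" if "v \<in> ?V" "w \<in> ?V" and eq: "X (v, k) = X (w, l)" for v w k l
  proof -
    have *: "y v + of_int_vec k = y w + of_int_vec l"
      by (rule cancel) (use eq in \<open>simp add: X_def placement_def\<close>)
    have kl: "k $ j = l $ j" for j
    proof -
      have "(y v + of_int_vec k) $ j = (y w + of_int_vec l) $ j" unfolding * ..
      then have "y v $ j + of_int (k $ j) = y w $ j + of_int (l $ j)" by (simp add: of_int_vec_def)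
      then show ?thesis using y_cell[of v j] y_cell[of w j] by linarith
    qed
    then have "k = l" by (simp add: vec_eq_iff)
    with * have "y v = y w" by simp
    then have "p v = p w" using t(1) that by (simp add: y_def)
    moreover have "inj_on p V" using p by (rule bij_betw_imp_inj_on)
    ultimately have "v = w" using that V by (meson inj_onD subsetD)
    with \<open>k = l\<close> show ?thesis by simp
  qed
  have edges_inv: "translate a k ` s \<in> edges \<N>" if "s \<in> edges \<N>" for k s
  proof -
    have "(\<lambda>s. translate a k ` s) ` edges \<N> = edges \<N>" using a by (simp add: periodicity_basis_def)
    then show ?thesis using that by blast
  qed
  have tr: "translate a k ` seg X (e, l) = seg X (e, k + l)" for e k l
    unfolding X_def by (rule translate_seg)
  have orb_eq: "seg X (e, 0) \<in> edges \<N> \<and> orb e = edge_orbit a (seg X (e, 0))" if e: "e \<in> E" for e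
  proof -
    obtain k l where kl: "closed_segment (translate a k (p (tl e))) (translate a l (p (hd e))) \<in> orb e" "lam e = k - l"
      using lab[OF e] by blast
    have "seg X (e, l) \<in> orb e" using kl e by (simp add: seg_def Xp)
    moreover obtain s where s: "s \<in> edges \<N>" "orb e = edge_orbit a s"
      using orb e by (meson bij_betwE imageE)
    ultimately obtain m where "seg X (e, l) = translate a m ` s" by (auto simp: edge_orbit_def)
    then have "seg X (e, 0) = translate a (- l) ` translate a m ` s" using tr[of "- l" e l] by simp
    then have *: "seg X (e, 0) = translate a (- l + m) ` s" by (simp add: translate_image_add)
    show ?thesis unfolding * edge_orbit_translate using s edges_inv by simp
  qed
  have edges: "edges \<N> = seg X ` (E \<times> UNIV)"
  proof (intro subset_antisym subsetI)
    fix s assume s: "s \<in> edges \<N>"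
    then obtain e where e: "e \<in> E" "edge_orbit a s = orb e"
      using orb by (metis bij_betw_imp_surj_on image_iff imageI)
    then have "edge_orbit a s = edge_orbit a (seg X (e, 0))" using orb_eq by simp
    then have "s \<in> edge_orbit a (seg X (e, 0))" using edge_orbit_self[of s a] by simp
    then obtain k where "s = translate a k ` seg X (e, 0)" by (auto simp: edge_orbit_def)
    with e(1) show "s \<in> seg X ` (E \<times> UNIV)" by (auto simp: tr)
  next
    fix s assume "s \<in> seg X ` (E \<times> UNIV)"
    then obtain e k where e: "e \<in> E" "s = seg X (e, k)" by blast
    then have "s = translate a k ` seg X (e, 0)" by (simp add: tr)
    with edges_inv orb_eq e(1) show "s \<in> edges \<N>" by simp
  qed
  have ne: "X (tl e, lam e + k) \<noteq> X (hd e, k)" if "e \<in> E" for e k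
  proof
    assume eq: "X (tl e, lam e + k) = X (hd e, k)"
    have "seg X (e, k) \<in> edges \<N>" unfolding edges using that by blast
    then obtain q r where "q \<noteq> r" "seg X (e, k) = closed_segment q r" using edge_ends[OF N] by blast
    with eq show False by (auto simp: seg_def doubleton_eq_iff closed_segment_eq_sing dest: sym)
  qed
  have endp: "is_endpoint q (seg X g) \<longleftrightarrow> q \<in> X ` ends g" if "g \<in> E \<times> UNIV" for q g
    using that ne by (auto simp: seg_def is_endpoint_closed_segment ends_def)
  have nodes: "nodes \<N> = X ` (\<Union>g\<in>E \<times> UNIV. ends g)"
  proof -
    have "nodes \<N> = {q. \<exists>s\<in>edges \<N>. is_endpoint q s}"
      using N by (simp add: proper_linear_3periodic_net_def)
    then show ?thesis unfolding edges using endp by auto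
  qed
  have seg_inj: "(e, k) = (e', k')" if "e \<in> E" "e' \<in> E" and eq: "seg X (e, k) = seg X (e', k')" for e e' k k'
  proof -
    have orb': "edge_orbit a (seg X (e, k)) = orb e" if "e \<in> E" for e k
      using orb_eq[OF that] edge_orbit_translate[of a k "seg X (e, 0)"] by (simp add: tr)
    have "orb e = orb e'" using orb'[OF that(1), of k] orb'[OF that(2), of k'] eq by simp
    then have [simp]: "e' = e"
      using inj_onD[OF bij_betw_imp_inj_on[OF orb], of e e'] that by simp
    have V: "tl e \<in> ?V" "hd e \<in> ?V" using that by auto
    have "{X (tl e, lam e + k), X (hd e, k)} = {X (tl e, lam e + k'), X (hd e, k')}"
      using eq by (simp add: seg_def)
    then consider "X (hd e, k) = X (hd e, k')" | "X (tl e, lam e + k) = X (hd e, k')" "X (hd e, k) = X (tl e, lam e + k')"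
      by (auto simp: doubleton_eq_iff)
    then have "k = k'"
    proof cases
      case 1
      then show ?thesis using X_inj[OF V(2) V(2)] by simp
    next
      case 2
      have kk': "lam e + k = k'" by (rule X_inj[OF V 2(1), THEN conjunct2])
      have "k = lam e + k'" by (rule X_inj[OF V(2,1) 2(2), THEN conjunct2])
      then have "k $ j = (lam e + k') $ j" for j by (rule arg_cong)
      moreover have "(lam e + k) $ j = k' $ j" for j unfolding kk' ..
      ultimately have comp: "k $ j = lam e $ j + k' $ j" "lam e $ j + k $ j = k' $ j" for j
        unfolding vector_add_component .
      have "k $ j = k' $ j" for j using comp[of j] by presburger
      then show ?thesis by (simp add: vec_eq_iff)
    qed
    then show ?thesis by simp
  qed
  have "embedded X" unfolding embedded_def
  proof (intro conjI ballI impI)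
    fix g assume g: "g \<in> E \<times> (UNIV :: (int^3) set)"
    then show "X (case g of (e, k) \<Rightarrow> (tl e, lam e + k)) \<noteq> X (case g of (e, k) \<Rightarrow> (hd e, k))" using ne by auto
    fix h assume h: "h \<in> E \<times> (UNIV :: (int^3) set)" "g \<noteq> h"
    have segs: "seg X g \<in> edges \<N>" "seg X h \<in> edges \<N>" "seg X g \<noteq> seg X h"
      using g h seg_inj[of "fst g" "fst h" "snd g" "snd h"] unfolding edges by auto
    show "seg X g \<inter> seg X h \<subseteq> X ` (ends g \<inter> ends h)"
    proof
      fix x assume x: "x \<in> seg X g \<inter> seg X h"
      have "is_endpoint x (seg X h)" "is_endpoint x (seg X g)"
        using edges_meet_in_endpoint[OF N segs] edges_meet_in_endpoint[OF N segs(2,1) segs(3)[symmetric]] x by auto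
      then obtain v w where v: "v \<in> ends g" "x = X v" and w: "w \<in> ends h" "x = X w"
        unfolding endp[OF g] endp[OF h(1)] by blast
      have "v \<in> ?V \<times> UNIV" "w \<in> ?V \<times> UNIV" using v(1) w(1) g h(1) vertices_eq by blast+
      then have "v = w" using X_inj[of "fst v" "fst w" "snd v" "snd w"] v(2) w(2) by (auto simp: prod_eq_iff)
      with v w show "x \<in> X ` (ends g \<inter> ends h)" by blast
    qed
  qed
  then have "admissible y" using embedded_placement[OF det] by (simp add: X_def)
  moreover have "\<bar>y v $ j\<bar> \<le> 1" for v j using y_cell[of v j] by simp
  moreover have "\<N> = net (placement a y)"
    using nodes edges by (simp add: net_def prod_eq_iff X_def)
  ultimately show ?thesis by (intro exI[of _ y]) (auto simp: y_def)
qed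

end

theorem corollary6p6:
  fixes H :: "('v, 'e) pre_digraph" and lam :: "'e \<Rightarrow> int^3"
  assumes "fin_digraph H"
  shows "finite ({\<N>. proper_linear_3periodic_net \<N> \<and>
                     (\<exists>a. periodicity_basis a \<N> \<and> has_labelled_quotient_graph \<N> a H lam)}
                 // periodic_isotopy)"
proof -
  interpret H: fin_digraph H by (rule assms)
  interpret labelled_graph "arcs H" "tail H" "head H" lam by unfold_locales simp
  let ?V = "tail H ` arcs H \<union> head H ` arcs H"
  obtain B where B: "finite B" "\<And>a :: real^3^3. det a \<noteq> 0 \<Longrightarrow> \<exists>b\<in>B. path_component {a. det a \<noteq> 0} a b"
    using finitely_many_components_of_bases by blast
  obtain T where T: "finite T"
    "\<forall>y. admissible y \<and> (\<forall>v j. \<bar>y v $ j\<bar> \<le> 1) \<and> (\<forall>v. v \<notin> ?V \<longrightarrow> y v = 0) \<longrightarrow>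
       (\<exists>z\<in>T. path_component {y. admissible y} y z)"
    using finitely_many_components_of_admissible by (elim exE conjE) (rule that)
  let ?cls = "\<lambda>(b, z). periodic_isotopy `` {net (placement b z)}"
  have "{\<N>. proper_linear_3periodic_net \<N> \<and>
           (\<exists>a. periodicity_basis a \<N> \<and> has_labelled_quotient_graph \<N> a H lam)} // periodic_isotopy
      \<subseteq> ?cls ` (B \<times> T)"
  proof
    fix C assume "C \<in> {\<N>. proper_linear_3periodic_net \<N> \<and>
           (\<exists>a. periodicity_basis a \<N> \<and> has_labelled_quotient_graph \<N> a H lam)} // periodic_isotopy"
    then obtain \<N> a where C: "C = periodic_isotopy `` {\<N>}" and N: "proper_linear_3periodic_net \<N>"
      and a: "periodicity_basis a \<N>" "has_labelled_quotient_graph \<N> a H lam"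
      by (auto elim!: quotientE)
    have det: "det a \<noteq> 0" using a(1) by (simp add: periodicity_basis_def basis3_iff_det)
    obtain p orb where "bij_betw p (verts H) (nodes \<N> \<inter> unit_cell a)"
      "bij_betw orb (arcs H) (edge_orbit a ` edges \<N>)"
      "\<And>e. e \<in> arcs H \<Longrightarrow> \<exists>k l. closed_segment (translate a k (p (tail H e))) (translate a l (p (head H e))) \<in> orb e \<and>
        lam e = k - l"
      using a(2) unfolding has_labelled_quotient_graph_def by blast
    moreover have "?V \<subseteq> verts H" by auto
    ultimately obtain y where y: "admissible y \<and> (\<forall>v j. \<bar>y v $ j\<bar> \<le> 1) \<and> (\<forall>v. v \<notin> ?V \<longrightarrow> y v = 0)"
      and N_eq: "\<N> = net (placement a y)"
      using net_of_quotient_graph[OF N a(1), of p "verts H" orb] by blast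
    obtain b where b: "b \<in> B" "path_component {a. det a \<noteq> 0} a b" using B(2)[OF det] by blast
    obtain z where z: "z \<in> T" "path_component {y. admissible y} y z" using T(2) y by blast
    have "proper_linear_3periodic_net (net (placement b z))"
      using path_component_mem(2)[OF b(2)] path_component_mem(2)[OF z(2)] by (simp add: net_placement_proper)
    then have "(\<N>, net (placement b z)) \<in> periodic_isotopy"
      using N periodically_isotopic_of_paths[OF b(2) z(2)] by (simp add: periodic_isotopy_def N_eq)
    then have "C = periodic_isotopy `` {net (placement b z)}"
      unfolding C by (rule periodic_isotopy_class_eq)
    with b(1) z(1) show "C \<in> ?cls ` (B \<times> T)" by (intro image_eqI[of _ _ "(b, z)"]) auto
  qed
  then show ?thesis using B(1) T(1) by (meson finite_SigmaI finite_surj)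
qed

end
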